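(* Let $M$ be a compact metric space, $\pi\in\mathcal P(M)$, let $\{\nu_n\}_{n\in\mathbb N}$ be a sequence in $\mathcal P(M)$ converging to $\nu\in\mathcal P(M)$, let $G^E:M\times M\to(-\infty,\infty]$ be lower semicontinuous and let $G^I:M\times M\to(-\infty,\infty]$ be symmetric and lower semicontinuous. Put $V_n(x)=\int_MG^E(x,y)\,d\nu_n(y)$ and $$W_n(x_1,\dots,x_n)=\frac1n\sum_{i=1}^nV_n(x_i)+\frac1{n^2}\sum_{1\le i<j\le n}G^I(x_i,x_j),$$ $$W^E(\mu)=\int_{M\times M}G^E(x,y)\,d\mu(x)d\nu(y),\qquad W^I(\mu)=\frac12\int_{M\times M}G^I(x,y)\,d\mu(x)d\mu(y),\qquad W=W^E+W^I.$$ Suppose that $x\mapsto\int_MG^E(x,y)\,d\nu(y)$ is continuous. Let $$\tilde{\mathcal N}=\Big\{\mu\in\mathcal P(M):D(\mu\|\pi)<\infty\text{ and }y\mapsto\int_MG^E(x,y)\,d\mu(x)\text{ is continuous}\Big\}$$ and suppose that for every $\mu\in\mathcal P(M)$ with $W^I(\mu)<\infty$ there exists a sequence $\{\mu_n\}_{n\in\mathbb N}$ in $\tilde{\mathcal N}$ such that $\mu_n\to\mu$ and $W^I(\mu_n)\to W^I(\mu)$. Then $W$ is the zero temperature macroscopic limit of $\{W_n\}_{n\in\mathbb N}$. In particular, if we choose positive $\beta_n\to\infty$, the general Laplace principle and large deviation principle for such limits may be applied to $(\{W_n\}_{n\in\mathbb N},W)$: setting $d\gamma_n=e^{-n\beta_nW_n}d\pi^{\otimes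 n}$, one has for every bounded continuous $f:\mathcal P(M)\to\mathbb R$ $$\frac1{n\beta_n}\log\int_{M^n}e^{-n\beta_nf\circ i_n}\,d\gamma_n\ \xrightarrow[n\to\infty]{}\ -\inf_{\mu\in\mathcal P(M)}\{f(\mu)+W(\mu)\},$$ and, if $Z_n=\gamma_n(M^n)>0$ for all $n$, the pushforwards by $i_n$ of the probability measures $\gamma_n/Z_n$ satisfy a large deviation principle on $\mathcal P(M)$ with speed $n\beta_n$ and rate function $W-\inf W$.
   Context: $\mathcal P(M)$ is the space of Borel probability measures with the weak topology, and convergence of measures is in this topology. $i_n(x_1,\dots,x_n)=\frac1n\sum_{i=1}^n\delta_{x_i}\in\mathcal P(M)$. $D(\mu\|\pi)=\int\frac{d\mu}{d\pi}\log\frac{d\mu}{d\pi}\,d\pi$ if $\mu\ll\pi$ and $\infty$ otherwise. For symmetric measurable $W_n:M^n\to(-\infty,\infty]$ define $\tilde W_n:\mathcal P(M)\to(-\infty,\infty]$ by $\tilde W_n(\mu)=W_n(x_1,\dots,x_n)$ if $\mu=\frac1n\sum_{i=1}^n\delta_{x_i}$, and $\tilde W_n(\mu)=\infty$ if $\mu$ is not of this form. A measurable $W:\mathcal P(M)\to(-\infty,\infty]$ is the zero temperature macroscopic limit of $\{W_n\}$ if: the sequence $\{W_n\}$ is stable, i.e. $W_n\ge C$ for all $n$ for some $C\in\mathbb R$; (A1) whenever $\mu_n\to\mu$ in $\mathcal P(M)$, $\liminf_n\tilde W_n(\mu_n)\ge W(\mu)$; and (A2') for every $\mu$ with $W(\mu)<\infty$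 there is a sequence $\{\mu_n\}$ in $\mathcal N$ with $\mu_n\to\mu$ and $\limsup_nW(\mu_n)\le W(\mu)$, where $\mathcal N=\{\mu\in\mathcal P(M):D(\mu\|\pi)<\infty,\ \limsup_n\mathbb E_{\mu^{\otimes n}}[W_n]\le W(\mu)\}$. Large deviation principle with speed $n\beta_n$ and rate $I$ for a sequence of probability measures $Q_n$ on $\mathcal P(M)$: $\liminf_n\frac1{n\beta_n}\log Q_n(A)\ge-\inf_AI$ for $A$ open and $\limsup_n\frac1{n\beta_n}\log Q_n(C)\le-\inf_CI$ for $C$ closed.
   Formalization: The large deviation principle is stated under the extra assumption that W is not identically infinite (inf W < ∞), since otherwise the rate function W − inf W is undefined (e.g. M=[0,1], π Lebesgue, G^E=0, G^I=1/|x−y|). *)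

theory Defs
  imports "HOL-Probability.Probability"
begin

section \<open>Extended-valued integrals, exponential and logarithm\<close>

text \<open>
  The integral of the positive part minus the integral of the negative part. It is meaningful as
  soon as one of the two is finite (in \<^typ>\<open>ereal\<close> one has \<open>\<infinity> - \<infinity> = \<infinity>\<close>). Lower semicontinuous
  functions with values in \<open>(-\<infinity>, \<infinity>]\<close> on a compact space are bounded below, so for finite measures
  only the positive part can be infinite.
\<close>

definition ext_integral :: "'a measure \<Rightarrow> ('a \<Rightarrow> ereal) \<Rightarrow> ereal" where
  "ext_integral M f =
     enn2ereal (\<integral>\<^sup>+ x. e2ennreal (f x) \<partial>M) - enn2ereal (\<integral>\<^sup>+ x. e2ennreal (- f x) \<partial>M)"

definition ext_exp :: "ereal \<Rightarrow> ennreal" where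
  "ext_exp t = (if t = -\<infinity> then 0 else if t = \<infinity> then \<infinity> else ennreal (exp (real_of_ereal t)))"

definition ext_ln :: "ennreal \<Rightarrow> ereal" where
  "ext_ln z = (if z = 0 then -\<infinity> else if z = \<infinity> then \<infinity> else ereal (ln (enn2real z)))"

definition lower_semicontinuous :: "('a::topological_space \<Rightarrow> ereal) \<Rightarrow> bool" where
  "lower_semicontinuous f \<longleftrightarrow> (\<forall>c. open {x. c < f x})"

text \<open>
  Continuity of a function that is given by an extended-valued integral: all its values are finite
  and it is continuous as a real function.
\<close>

definition real_continuous :: "('a::topological_space \<Rightarrow> ereal) \<Rightarrow> bool" where
  "real_continuous h \<longleftrightarrow> (\<exists>g::'a \<Rightarrow> real. continuous_on UNIV g \<and> (\<forall>x. h x = ereal (g x)))"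


section \<open>The space of Borel probability measures\<close>

abbreviation prob_measures :: "'a::topological_space measure set" where
  "prob_measures \<equiv> space (prob_algebra borel)"

definition weak_topology :: "'a::topological_space measure topology" where
  "weak_topology = topology_generated_by
     {{\<mu> \<in> prob_measures. (\<integral>x. f x \<partial>\<mu>) \<in> U} | (f :: 'a \<Rightarrow> real) U.
        continuous_on UNIV f \<and> bounded (range f) \<and> open U}"

lemma topspace_weak_topology: "topspace weak_topology = prob_measures"
proof -
  let ?B = "{{\<mu> \<in> prob_measures. (\<integral>x. f x \<partial>\<mu>) \<in> U} | (f :: 'a \<Rightarrow> real) U.
        continuous_on UNIV f \<and> bounded (range f) \<and> open U}"
  have "(prob_measures :: 'a measure set) =
      {\<mu> \<in> prob_measures. (\<integral>x. (0::real) \<partial>\<mu>) \<in> UNIV}"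
    by simp
  moreover have "continuous_on UNIV (\<lambda>x::'a. 0::real)" "bounded (range (\<lambda>x::'a. 0::real))"
    by (auto intro: finite_imp_bounded)
  ultimately have "prob_measures \<in> ?B"
    by (blast intro: open_UNIV)
  then have "\<Union> ?B = prob_measures"
    by blast
  then show ?thesis
    by (simp only: weak_topology_def topology_generated_by_topspace)
qed

definition weak_borel :: "'a::topological_space measure measure" where
  "weak_borel = sigma prob_measures {A. openin weak_topology A}"

text \<open>Relative entropy. The library's \<open>KL_divergence\<close> is real-valued, and \<open>0\<close> where it should be \<open>\<infinity>\<close>.\<close>

definition rel_entropy :: "'a measure \<Rightarrow> 'a measure \<Rightarrow> ereal" where
  "rel_entropy \<mu> \<pi> =
     (if absolutely_continuous \<pi> \<mu>
      then ext_integral \<pi>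
        (\<lambda>x. ereal (enn2real (RN_deriv \<pi> \<mu> x) * ln (enn2real (RN_deriv \<pi> \<mu> x))))
      else \<infinity>)"


section \<open>Configurations and empirical measures\<close>

text \<open>
  A point of \<open>M\<^sup>n\<close> is an extensional function on \<open>{..<n}\<close>, as in \<^const>\<open>PiM\<close>; the coordinates
  \<open>x\<^sub>1, \<dots>, x\<^sub>n\<close> are \<open>x 0, \<dots>, x (n - 1)\<close>. Sequences indexed by the number \<open>n\<close> of particles start
  at \<open>n = 1\<close>; their entry at \<open>0\<close> is irrelevant.
\<close>

abbreviation configs :: "nat \<Rightarrow> (nat \<Rightarrow> 'a) set" where
  "configs n \<equiv> {..<n} \<rightarrow>\<^sub>E UNIV"

definition empirical :: "nat \<Rightarrow> (nat \<Rightarrow> 'a::topological_space) \<Rightarrow> 'a measure" where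
  "empirical n x =
     measure_of UNIV (sets borel) (\<lambda>A. (\<Sum>i<n. emeasure (return borel (x i)) A) / of_nat n)"

lemma emeasure_empirical:
  assumes "A \<in> sets borel"
  shows "emeasure (empirical n x) A = (\<Sum>i<n. indicator A (x i)) / of_nat n"
proof -
  have "countably_additive (sets borel)
      (\<lambda>A. (\<Sum>i<n. emeasure (return borel (x i)) A) / of_nat n)"
  proof (rule countably_additiveI)
    fix A :: "nat \<Rightarrow> 'a set"
    assume A: "range A \<subseteq> sets borel" "disjoint_family A"
    have "(\<Sum>k. (\<Sum>i<n. emeasure (return borel (x i)) (A k)) / of_nat n) =
        (\<Sum>i<n. \<Sum>k. emeasure (return borel (x i)) (A k)) / of_nat n"
      by (simp add: divide_ennreal_def suminf_sum)
    also have "\<dots> = (\<Sum>i<n. emeasure (return borel (x i)) (\<Union> (range A))) / of_nat n"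
      using A by (intro arg_cong[where f = "\<lambda>s. s / of_nat n"] sum.cong refl suminf_emeasure) auto
    finally show "(\<Sum>k. (\<Sum>i<n. emeasure (return borel (x i)) (A k)) / of_nat n) =
        (\<Sum>i<n. emeasure (return borel (x i)) (\<Union> (range A))) / of_nat n" .
  qed
  moreover have "sigma_algebra UNIV (sets (borel :: 'a measure))"
    using sets.sigma_algebra_axioms[of "borel :: 'a measure"] by simp
  ultimately have "emeasure (empirical n x) A =
      (\<Sum>i<n. emeasure (return borel (x i)) A) / of_nat n"
    unfolding empirical_def
    by (intro emeasure_measure_of_sigma) (auto simp: assms positive_def)
  with assms show ?thesis
    by simp
qed

definition symmetric_fun :: "nat \<Rightarrow> ((nat \<Rightarrow> 'a) \<Rightarrow> 'b) \<Rightarrow> bool" where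
  "symmetric_fun n w \<longleftrightarrow> (\<forall>\<sigma>. \<sigma> permutes {..<n} \<longrightarrow> (\<forall>x \<in> configs n. w (x \<circ> \<sigma>) = w x))"

text \<open>The choice of \<open>x\<close> does not matter for a symmetric \<open>W n\<close>.\<close>

definition lift_energy ::
  "(nat \<Rightarrow> (nat \<Rightarrow> 'a::topological_space) \<Rightarrow> ereal) \<Rightarrow> nat \<Rightarrow> 'a measure \<Rightarrow> ereal" where
  "lift_energy W n \<mu> =
     (if \<exists>x \<in> configs n. \<mu> = empirical n x
      then W n (SOME x. x \<in> configs n \<and> \<mu> = empirical n x)
      else \<infinity>)"


section \<open>Zero temperature macroscopic limits\<close>

definition recovery_set ::
  "'a::topological_space measure \<Rightarrow> (nat \<Rightarrow> (nat \<Rightarrow> 'a) \<Rightarrow> ereal) \<Rightarrow> ('a measure \<Rightarrow> ereal) \<Rightarrow>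
     'a measure set" where
  "recovery_set \<pi> Wn W = {\<mu> \<in> prob_measures. rel_entropy \<mu> \<pi> < \<infinity> \<and>
     limsup (\<lambda>n. ext_integral (PiM {..<n} (\<lambda>_. \<mu>)) (Wn n)) \<le> W \<mu>}"

definition stable :: "(nat \<Rightarrow> (nat \<Rightarrow> 'a) \<Rightarrow> ereal) \<Rightarrow> bool" where
  "stable Wn \<longleftrightarrow> (\<exists>C::real. \<forall>n\<ge>1. \<forall>x \<in> configs n. ereal C \<le> Wn n x)"

definition zero_temperature_limit ::
  "'a::topological_space measure \<Rightarrow> (nat \<Rightarrow> (nat \<Rightarrow> 'a) \<Rightarrow> ereal) \<Rightarrow> ('a measure \<Rightarrow> ereal) \<Rightarrow> bool"
  where
  "zero_temperature_limit \<pi> Wn W \<longleftrightarrow>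
     (\<forall>n\<ge>1. Wn n \<in> borel_measurable (PiM {..<n} (\<lambda>_. borel)) \<and> symmetric_fun n (Wn n)
        \<and> (\<forall>x \<in> configs n. Wn n x \<noteq> -\<infinity>)) \<and>
     W \<in> borel_measurable weak_borel \<and> (\<forall>\<mu> \<in> prob_measures. W \<mu> \<noteq> -\<infinity>) \<and>
     stable Wn \<and>
     (\<forall>\<mu>s \<mu>. (\<forall>n. \<mu>s n \<in> prob_measures) \<and> limitin weak_topology \<mu>s \<mu> sequentially \<longrightarrow>
        W \<mu> \<le> liminf (\<lambda>n. lift_energy Wn n (\<mu>s n))) \<and>
     (\<forall>\<mu> \<in> prob_measures. W \<mu> < \<infinity> \<longrightarrow>
        (\<exists>\<mu>s. (\<forall>n. \<mu>s n \<in> recovery_set \<pi> Wn W) \<and> limitin weak_topology \<mu>s \<mu> sequentially \<and>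
          limsup (\<lambda>n. W (\<mu>s n)) \<le> W \<mu>))"


section \<open>Gibbs measures and large deviations\<close>

definition gibbs ::
  "'a::topological_space measure \<Rightarrow> (nat \<Rightarrow> (nat \<Rightarrow> 'a) \<Rightarrow> ereal) \<Rightarrow> (nat \<Rightarrow> real) \<Rightarrow> nat \<Rightarrow>
     (nat \<Rightarrow> 'a) measure" where
  "gibbs \<pi> Wn \<beta> n =
     density (PiM {..<n} (\<lambda>_. \<pi>)) (\<lambda>x. ext_exp (- (ereal (real n * \<beta> n) * Wn n x)))"

definition partition_function ::
  "'a::topological_space measure \<Rightarrow> (nat \<Rightarrow> (nat \<Rightarrow> 'a) \<Rightarrow> ereal) \<Rightarrow> (nat \<Rightarrow> real) \<Rightarrow> nat \<Rightarrow>
     ennreal" where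
  "partition_function \<pi> Wn \<beta> n = emeasure (gibbs \<pi> Wn \<beta> n) (space (gibbs \<pi> Wn \<beta> n))"

definition gibbs_law ::
  "'a::topological_space measure \<Rightarrow> (nat \<Rightarrow> (nat \<Rightarrow> 'a) \<Rightarrow> ereal) \<Rightarrow> (nat \<Rightarrow> real) \<Rightarrow> nat \<Rightarrow>
     'a measure measure" where
  "gibbs_law \<pi> Wn \<beta> n =
     distr (scale_measure (inverse (partition_function \<pi> Wn \<beta> n)) (gibbs \<pi> Wn \<beta> n))
       weak_borel (empirical n)"

definition large_deviation_principle ::
  "(nat \<Rightarrow> real) \<Rightarrow> (nat \<Rightarrow> 'a::topological_space measure measure) \<Rightarrow> ('a measure \<Rightarrow> ereal) \<Rightarrow> bool"
  where
  "large_deviation_principle s Q I \<longleftrightarrow>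
     (\<forall>n\<ge>1. prob_space (Q n) \<and> sets (Q n) = sets weak_borel) \<and>
     (\<forall>A. openin weak_topology A \<longrightarrow>
        - (INF \<mu>\<in>A. I \<mu>) \<le> liminf (\<lambda>n. ereal (1 / s n) * ext_ln (emeasure (Q n) A))) \<and>
     (\<forall>C. closedin weak_topology C \<longrightarrow>
        limsup (\<lambda>n. ereal (1 / s n) * ext_ln (emeasure (Q n) C)) \<le> - (INF \<mu>\<in>C. I \<mu>))"


section \<open>Two-body energies with an external field\<close>

definition field_potential ::
  "('a \<times> 'a \<Rightarrow> ereal) \<Rightarrow> (nat \<Rightarrow> 'a measure) \<Rightarrow> nat \<Rightarrow> 'a \<Rightarrow> ereal" where
  "field_potential GE \<nu>s n x = ext_integral (\<nu>s n) (\<lambda>y. GE (x, y))"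

definition n_body_energy ::
  "('a \<times> 'a \<Rightarrow> ereal) \<Rightarrow> ('a \<times> 'a \<Rightarrow> ereal) \<Rightarrow> (nat \<Rightarrow> 'a measure) \<Rightarrow> nat \<Rightarrow> (nat \<Rightarrow> 'a) \<Rightarrow> ereal"
  where
  "n_body_energy GE GI \<nu>s n x =
     ereal (1 / real n) * (\<Sum>i<n. field_potential GE \<nu>s n (x i)) +
     ereal (1 / (real n)\<^sup>2) * (\<Sum>(i, j) \<in> {(i, j). i < j \<and> j < n}. GI (x i, x j))"

definition external_energy :: "('a \<times> 'a \<Rightarrow> ereal) \<Rightarrow> 'a measure \<Rightarrow> 'a measure \<Rightarrow> ereal" where
  "external_energy GE \<nu> \<mu> = ext_integral (\<mu> \<Otimes>\<^sub>M \<nu>) GE"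

definition interaction_energy :: "('a \<times> 'a \<Rightarrow> ereal) \<Rightarrow> 'a measure \<Rightarrow> ereal" where
  "interaction_energy GI \<mu> = ereal (1 / 2) * ext_integral (\<mu> \<Otimes>\<^sub>M \<mu>) GI"

definition macroscopic_energy ::
  "('a \<times> 'a \<Rightarrow> ereal) \<Rightarrow> ('a \<times> 'a \<Rightarrow> ereal) \<Rightarrow> 'a measure \<Rightarrow> 'a measure \<Rightarrow> ereal" where
  "macroscopic_energy GE GI \<nu> \<mu> = external_energy GE \<nu> \<mu> + interaction_energy GI \<mu>"

definition regular_measures ::
  "'a::topological_space measure \<Rightarrow> ('a \<times> 'a \<Rightarrow> ereal) \<Rightarrow> 'a measure set" where
  "regular_measures \<pi> GE = {\<mu> \<in> prob_measures. rel_entropy \<mu> \<pi> < \<infinity> \<and>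
     real_continuous (\<lambda>y. ext_integral \<mu> (\<lambda>x. GE (x, y)))}"

end

theory Submission
  imports Defs
begin

text \<open>
  On a compact space the energies are bounded below and are monotone limits of energies with
  continuous kernels. For a continuous kernel the energy of an empirical measure is weakly continuous
  up to a diagonal term of order $1/n$, which gives (A1); for a regular measure $\mu$ the expectation of
  $W_n$ under $\mu^n$ is explicit and converges, so that the regular measures lie in $\mathcal N$ and
  the approximation hypothesis gives (A2').

  The upper bounds follow from the trivial estimate of $\int e^{-n\beta_n(f\circ i_n + W_n)}$ by the
  supremum of the integrand, (A1), and the compactness of $\mathcal P(M)$. For the lower bounds one changes
  measure from $\pi^n$ to $\mu^n$ with $\mu \in \mathcal N$ and applies Jensen's inequality on
  $\{i_n \in A\}$, which has $\mu^n$-probability tending to $1$; since $\beta_n \to \infty$, the entropy term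
  vanishes in the limit.
\<close>

section \<open>Weak topology and empirical measures\<close>

text \<open>The two continuity conditions on \<open>GE\<close> handle the moving measures
  \<open>\<nu>s n\<close>. By Fubini, the expected field term under the product of \<mu> is the
  integral against \<open>\<nu>s n\<close> of y \<mapsto> \<integral> GE (x, y) d\<mu>(x), and weak
  convergence of \<open>\<nu>s\<close> passes to the limit because that function is continuous: this
  is what regularity of \<mu> provides. Continuity of x \<mapsto> \<integral> GE (x, y) d\<nu>(y)
  makes the external energy finite and weakly continuous, so convergence of the interaction energies
  alone yields convergence of W along the approximating sequence. Continuous minorants are needed
  because \<open>GI\<close> may be infinite on the diagonal, which the n-body energy omits but the
  energy of an empirical measure contains. For a fixed continuous kernel the diagonal contributes at
  most a constant over n, so n tends to infinity before the level of the minorant does. The only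
  structure on M is a metric; a countable base extracted from compactness reconciles open sets of
  products with product \<sigma>-algebras.\<close>

lemma compact_countable_base:
  assumes "compact (UNIV :: 'a::metric_space set)"
  obtains B :: "nat \<Rightarrow> 'a::metric_space set" where "\<And>k. open (B k)"
    "\<And>U x. open U \<Longrightarrow> x \<in> U \<Longrightarrow> \<exists>k. x \<in> B k \<and> B k \<subseteq> U"
proof -
  have "\<forall>k::nat. \<exists>F. finite F \<and> (UNIV :: 'a set) \<subseteq> (\<Union>x\<in>F. ball x (1 / Suc k))"
    using assms unfolding compact_eq_totally_bounded by (metis of_nat_0_less_iff zero_less_Suc zero_less_divide_1_iff)
  then obtain F where F: "\<And>k::nat. finite (F k)" "\<And>k. (UNIV :: 'a set) \<subseteq> (\<Union>x\<in>F k. ball x (1 / Suc k))"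
    by metis
  define \<B> where "\<B> = (\<Union>k. (\<lambda>x. ball x (1 / real (Suc k))) ` F k)"
  have "countable \<B>"
    unfolding \<B>_def using F(1) by (auto intro: countable_finite)
  \<comment> \<open>\<open>from_nat_into\<close> has range exactly \<B> only when \<B> is nonempty;
    the net at scale 1 contains a point because the type is inhabited.\<close>
  moreover obtain c where "c \<in> F 0"
    using subsetD[OF F(2)[of 0], of undefined] by blast
  then have "ball c (1 / real (Suc 0)) \<in> \<B>"
    unfolding \<B>_def by blast
  then have "\<B> \<noteq> {}"
    by blast
  ultimately have ran: "range (from_nat_into \<B>) = \<B>"
    by (rule range_from_nat_into[rotated])
  show ?thesis
  proof (rule that[of "from_nat_into \<B>"])
    show "open (from_nat_into \<B> k)" for k
      using rangeI[of "from_nat_into \<B>" k] unfolding ran by (auto simp: \<B>_def)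
    fix U and x :: 'a assume "open U" "x \<in> U"
    then obtain e where e: "e > 0" "ball x e \<subseteq> U"
      by (meson openE)
    \<comment> \<open>A ball of radius below e / 2 that contains x lies in the ball of radius e
      around x.\<close>
    obtain k where k: "1 / real (Suc k) < e / 2"
      using nat_approx_posE[of "e / 2"] e by auto
    obtain c where c: "c \<in> F k" "x \<in> ball c (1 / Suc k)"
      using F(2)[of k] by fast
    have "ball c (1 / Suc k) \<subseteq> U"
    proof
      fix y assume "y \<in> ball c (1 / Suc k)"
      then have "dist x y < e"
        using c k dist_triangle[of x y c] by (auto simp: dist_commute)
      then show "y \<in> U"
        using e by auto
    qed
    moreover have "ball c (1 / Suc k) \<in> range (from_nat_into \<B>)"
      unfolding ran unfolding \<B>_def using c by blast
    ultimately show "\<exists>k. x \<in> from_nat_into \<B> k \<and> from_nat_into \<B> k \<subseteq> U"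
      using c by (metis imageE)
  qed
qed

text \<open>In a general metric space open sets of the square need not belong to the product of the
  Borel \<sigma>-algebras. With a countable base an open set is a countable union of rectangles of
  base sets.\<close>

lemma open_pair_measurable:
  fixes U :: "('a::metric_space \<times> 'a) set"
  assumes "compact (UNIV :: 'a set)" and "open U"
  shows "U \<in> sets (borel \<Otimes>\<^sub>M borel)"
proof -
  obtain B :: "nat \<Rightarrow> 'a set" where B: "\<And>k. open (B k)"
      "\<And>U x. open U \<Longrightarrow> x \<in> U \<Longrightarrow> \<exists>k. x \<in> B k \<and> B k \<subseteq> U"
    using compact_countable_base[OF assms(1)] by blast
  define J where "J = {(k, l). B k \<times> B l \<subseteq> U}"
  have "U = (\<Union>(k, l)\<in>J. B k \<times> B l)"
  proof (intro equalityI subsetI)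
    fix p assume p: "p \<in> U"
    obtain a b where ab: "p = (a, b)"
      by (cases p)
    obtain X Y where XY: "open X" "open Y" "p \<in> X \<times> Y" "X \<times> Y \<subseteq> U"
      using open_prod_elim[OF \<open>open U\<close> p] by blast
    have "a \<in> X" "b \<in> Y"
      using XY(3) ab by auto
    then obtain k l where "a \<in> B k" "B k \<subseteq> X" "b \<in> B l" "B l \<subseteq> Y"
      using B(2)[OF XY(1)] B(2)[OF XY(2)] by meson
    then have "(k, l) \<in> J" "p \<in> B k \<times> B l"
      using XY ab by (auto simp: J_def)
    then show "p \<in> (\<Union>(k, l)\<in>J. B k \<times> B l)"
      by blast
  qed (auto simp: J_def)
  moreover have "(\<Union>(k, l)\<in>J. B k \<times> B l) \<in> sets (borel \<Otimes>\<^sub>M borel)"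
    by (intro sets.countable_UN'') (auto intro!: pair_measureI borel_open B)
  ultimately show ?thesis
    by simp
qed

lemma borel_measurable_pair_continuous:
  fixes \<phi> :: "'a::metric_space \<times> 'a \<Rightarrow> 'b::topological_space"
  assumes "compact (UNIV :: 'a set)" and "continuous_on UNIV \<phi>"
  shows "\<phi> \<in> borel_measurable (borel \<Otimes>\<^sub>M borel)"
proof (rule borel_measurableI)
  fix S :: "'b set" assume "open S"
  then have "open (\<phi> -` S)"
    using assms(2) by (rule open_vimage)
  then show "\<phi> -` S \<inter> space (borel \<Otimes>\<^sub>M borel) \<in> sets (borel \<Otimes>\<^sub>M borel)"
    using open_pair_measurable[OF assms(1)] by (simp add: space_pair_measure)
qed

lemma borel_measurable_pair_lower_semicontinuous:
  fixes G :: "'a::metric_space \<times> 'a \<Rightarrow> ereal"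
  assumes "compact (UNIV :: 'a set)" and "lower_semicontinuous G"
  shows "G \<in> borel_measurable (borel \<Otimes>\<^sub>M borel)"
proof (rule borel_measurableI_greater)
  fix y
  have "open {x. y < G x}"
    using assms(2) by (simp add: lower_semicontinuous_def)
  then show "{x \<in> space (borel \<Otimes>\<^sub>M borel). y < G x} \<in> sets (borel \<Otimes>\<^sub>M borel)"
    using open_pair_measurable[OF assms(1)] by (simp add: space_pair_measure)
qed

text \<open>The argument for pairs, with boxes indexed by maps from the finite set I to the base. It
  makes the empirical measure a measurable function of the configuration.\<close>

lemma openin_product_measurable:
  fixes S :: "('i \<Rightarrow> 'a::metric_space) set"
  assumes "compact (UNIV :: 'a set)" and "finite I"
    and S: "openin (product_topology (\<lambda>_. euclidean) I) S"
  shows "S \<in> sets (PiM I (\<lambda>_. borel))"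
proof -
  obtain B :: "nat \<Rightarrow> 'a set" where B: "\<And>k. open (B k)"
      "\<And>U x. open U \<Longrightarrow> x \<in> U \<Longrightarrow> \<exists>k. x \<in> B k \<and> B k \<subseteq> U"
    using compact_countable_base[OF assms(1)] by blast
  define J where "J = {k \<in> I \<rightarrow>\<^sub>E UNIV. Pi\<^sub>E I (\<lambda>i. B (k i)) \<subseteq> S}"
  have "S = (\<Union>k\<in>J. Pi\<^sub>E I (\<lambda>i. B (k i)))"
  proof (intro equalityI subsetI)
    fix x assume "x \<in> S"
    from S[unfolded openin_product_topology_alt, rule_format, OF this]
    obtain U where "\<forall>i\<in>I. openin euclidean (U i)" and U: "x \<in> Pi\<^sub>E I U" "Pi\<^sub>E I U \<subseteq> S"
      by (elim exE conjE)
    then have "open (U i)" if "i \<in> I" for i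
      using that by simp
    have "\<forall>i\<in>I. \<exists>k. x i \<in> B k \<and> B k \<subseteq> U i"
      using U by (auto intro!: B(2) \<open>\<And>i. i \<in> I \<Longrightarrow> open (U i)\<close>)
    then obtain k where k: "\<And>i. i \<in> I \<Longrightarrow> x i \<in> B (k i) \<and> B (k i) \<subseteq> U i"
      by metis
    have "Pi\<^sub>E I (\<lambda>i. B (k i)) \<subseteq> Pi\<^sub>E I U"
      using k by (auto simp: PiE_iff)
    \<comment> \<open>The index maps must be extensional: only then is their set countable.\<close>
    then have "restrict k I \<in> J"
      using U k by (auto simp: J_def cong: PiE_cong)
    moreover have "x \<in> Pi\<^sub>E I (\<lambda>i. B (restrict k I i))"
      using U k by (auto simp: PiE_iff)
    ultimately show "x \<in> (\<Union>k\<in>J. Pi\<^sub>E I (\<lambda>i. B (k i)))"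
      by blast
  qed (auto simp: J_def)
  moreover have "countable J"
    unfolding J_def by (rule countable_subset[OF _ countable_PiE[of I "\<lambda>_. UNIV :: nat set"]]) (auto simp: \<open>finite I\<close>)
  then have "(\<Union>k\<in>J. Pi\<^sub>E I (\<lambda>i. B (k i))) \<in> sets (PiM I (\<lambda>_. borel))"
    by (intro sets.countable_UN'' sets_PiM_I_finite assms borel_open B)
  ultimately show ?thesis
    by simp
qed

section \<open>Weak convergence through bounded continuous test functions\<close>

lemma prob_measuresD:
  assumes "\<mu> \<in> prob_measures"
  shows "prob_space \<mu>" "sets \<mu> = sets borel" "space \<mu> = UNIV"
  using assms sets_eq_imp_space_eq[of \<mu> borel] by (auto simp: space_prob_algebra)

lemma prob_measuresI: "prob_space \<mu> \<Longrightarrow> sets \<mu> = sets borel \<Longrightarrow> \<mu> \<in> prob_measures"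
  by (auto simp: space_prob_algebra)

lemma openin_weak_topology_iff:
  "openin weak_topology A \<longleftrightarrow> generate_topology_on
     {{\<mu> \<in> prob_measures. (\<integral>x. f x \<partial>\<mu>) \<in> U} | (f :: 'a::topological_space \<Rightarrow> real) U.
        continuous_on UNIV f \<and> bounded (range f) \<and> open U} A"
  by (simp add: weak_topology_def openin_topology_generated_by_iff)

lemma openin_weak_topology_subset: "openin weak_topology A \<Longrightarrow> A \<subseteq> prob_measures"
  using openin_subset topspace_weak_topology by metis

lemma openin_weak_basis:
  fixes f :: "'a::topological_space \<Rightarrow> real"
  assumes "continuous_on UNIV f" "bounded (range f)" "open U"
  shows "openin weak_topology {\<mu> \<in> prob_measures. (\<integral>x. f x \<partial>\<mu>) \<in> U}"
  unfolding openin_weak_topology_iff using assms by (intro generate_topology_on.Basis) blast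

text \<open>Neighbourhoods only have to be checked on the generating sets, by induction over the
  generation of the topology. The filter is arbitrary because later uses include subsequences,
  restrictions to a set of indices, and neighbourhood filters of measures.\<close>

lemma limitin_weak_topology:
  fixes \<mu>s :: "'i \<Rightarrow> 'a::topological_space measure"
  shows "limitin weak_topology \<mu>s \<mu> F \<longleftrightarrow> \<mu> \<in> prob_measures \<and> (\<forall>\<^sub>F i in F. \<mu>s i \<in> prob_measures) \<and>
    (\<forall>f :: 'a \<Rightarrow> real. continuous_on UNIV f \<longrightarrow> bounded (range f) \<longrightarrow>
      ((\<lambda>i. \<integral>x. f x \<partial>\<mu>s i) \<longlongrightarrow> (\<integral>x. f x \<partial>\<mu>)) F)" (is "?L \<longleftrightarrow> ?R")
proof
  assume L: ?L
  then have \<mu>: "\<mu> \<in> prob_measures"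
    by (metis limitin_topspace topspace_weak_topology)
  show ?R
  proof (intro conjI allI impI)
    show "\<forall>\<^sub>F i in F. \<mu>s i \<in> prob_measures"
      using limitinD[OF L openin_topspace] \<mu> by (simp add: topspace_weak_topology)
    fix f :: "'a \<Rightarrow> real" assume f: "continuous_on UNIV f" "bounded (range f)"
    show "((\<lambda>i. \<integral>x. f x \<partial>\<mu>s i) \<longlongrightarrow> (\<integral>x. f x \<partial>\<mu>)) F"
    proof (rule topological_tendstoI)
      fix S assume "open S" "(\<integral>x. f x \<partial>\<mu>) \<in> S"
      then show "\<forall>\<^sub>F i in F. (\<integral>x. f x \<partial>\<mu>s i) \<in> S"
        using limitinD[OF L openin_weak_basis[OF f \<open>open S\<close>]] \<mu>
        by (auto elim: eventually_mono)
    qed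
  qed (rule \<mu>)
next
  assume R: ?R
  show ?L
    unfolding limitin_def
  proof (intro conjI allI impI)
    show "\<mu> \<in> topspace weak_topology"
      using R by (simp add: topspace_weak_topology)
    fix A assume "openin weak_topology A \<and> \<mu> \<in> A"
    then have "generate_topology_on {{\<mu> \<in> prob_measures. (\<integral>x. f x \<partial>\<mu>) \<in> U} | (f :: 'a \<Rightarrow> real) U.
        continuous_on UNIV f \<and> bounded (range f) \<and> open U} A" "\<mu> \<in> A"
      by (auto simp: openin_weak_topology_iff)
    then show "\<forall>\<^sub>F i in F. \<mu>s i \<in> A"
    proof (induction rule: generate_topology_on.induct)
      case (Int a b)
      then show ?case
        by (auto intro: eventually_conj)
    next
      case (UN K)
      then obtain k where "k \<in> K" "\<forall>\<^sub>F i in F. \<mu>s i \<in> k"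
        by blast
      then show ?case
        by (auto elim!: eventually_mono)
    next
      case (Basis s)
      then obtain f :: "'a \<Rightarrow> real" and U where s: "s = {\<mu> \<in> prob_measures. (\<integral>x. f x \<partial>\<mu>) \<in> U}"
        "continuous_on UNIV f" "bounded (range f)" "open U"
        by blast
      then have "\<forall>\<^sub>F i in F. (\<integral>x. f x \<partial>\<mu>s i) \<in> U"
        using R Basis by (auto dest: topological_tendstoD)
      moreover have "\<forall>\<^sub>F i in F. \<mu>s i \<in> prob_measures"
        using R by blast
      ultimately show ?case
        by eventually_elim (simp add: s)
    qed simp
  qed
qed

section \<open>Empirical measures as images of the uniform measure on the indices\<close>

lemma empirical_eq_distr:
  assumes "n \<ge> 1"
  shows "empirical n x = distr (uniform_count_measure {..<n}) borel x"
proof (rule measure_eqI)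
  fix A assume "A \<in> sets (empirical n x)"
  then have A: "A \<in> sets (borel :: 'a measure)"
    using sets.sigma_sets_eq[of "borel :: 'a measure"] by (simp add: empirical_def sets_measure_of_conv)
  have "emeasure (distr (uniform_count_measure {..<n}) borel x) A = ennreal (card (x -` A \<inter> {..<n}) / n)"
    using A assms by (subst emeasure_distr) (auto simp: emeasure_uniform_count_measure space_uniform_count_measure)
  also have "\<dots> = of_nat (card (x -` A \<inter> {..<n})) / of_nat n"
    using assms by (simp add: divide_ennreal ennreal_of_nat_eq_real_of_nat)
  also have "of_nat (card (x -` A \<inter> {..<n})) = (\<Sum>i<n. indicator A (x i) :: ennreal)"
    by (simp add: indicator_def sum.If_cases Int_def vimage_def conj_commute)
  finally show "emeasure (empirical n x) A = emeasure (distr (uniform_count_measure {..<n}) borel x) A"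
    using A by (simp add: emeasure_empirical)
qed (use sets.sigma_sets_eq[of "borel :: 'a measure"] in \<open>simp add: empirical_def sets_measure_of_conv\<close>)

lemma empirical_in_prob_measures:
  assumes "n \<ge> 1"
  shows "empirical n x \<in> prob_measures"
proof (rule prob_measuresI)
  show "prob_space (empirical n x)"
    unfolding empirical_eq_distr[OF assms]
    by (intro prob_space.prob_space_distr prob_space_uniform_count_measure) (use assms in \<open>auto simp: lessThan_empty_iff\<close>)
qed (simp add: empirical_eq_distr[OF assms])

lemma integral_empirical:
  fixes f :: "'a::topological_space \<Rightarrow> real"
  assumes "n \<ge> 1" and "f \<in> borel_measurable borel"
  shows "(\<integral>y. f y \<partial>empirical n x) = (\<Sum>i<n. f (x i)) / n"
  unfolding empirical_eq_distr[OF assms(1)] using assms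
  by (subst integral_distr)
     (auto simp: uniform_count_measure_def lebesgue_integral_point_measure_finite sum_divide_distrib)

text \<open>The preimage of a subbasic set is a condition on the average of the values
  \<open>f (x i)\<close>, which depends continuously on the configuration.\<close>

lemma continuous_map_empirical:
  assumes "n \<ge> 1"
  shows "continuous_map (product_topology (\<lambda>_. euclidean) {..<n}) weak_topology (empirical n)"
  unfolding weak_topology_def
proof (rule continuous_on_generated_topo)
  fix U assume "U \<in> {{\<mu> \<in> prob_measures. (\<integral>x. f x \<partial>\<mu>) \<in> U} | (f :: 'a \<Rightarrow> real) U.
        continuous_on UNIV f \<and> bounded (range f) \<and> open U}"
  then obtain f :: "'a \<Rightarrow> real" and V where U: "U = {\<mu> \<in> prob_measures. (\<integral>x. f x \<partial>\<mu>) \<in> V}"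
    and f: "continuous_on UNIV f" "open V"
    by blast
  have "continuous_map (product_topology (\<lambda>_. euclidean) {..<n}) euclidean (\<lambda>x. f (x i))" if "i < n" for i
    using continuous_map_compose[OF continuous_map_product_projection[of i "{..<n}" "\<lambda>_. euclidean"], of euclidean f]
      f(1) that by (simp add: o_def)
  then have "continuous_map (product_topology (\<lambda>_. euclidean) {..<n}) euclidean (\<lambda>x. (1 / n) * (\<Sum>i<n. f (x i)))"
    by (intro continuous_map_real_mult_left continuous_map_sum) auto
  then have "continuous_map (product_topology (\<lambda>_. euclidean) {..<n}) euclidean (\<lambda>x. (\<Sum>i<n. f (x i)) / n)"
    by simp
  from openin_continuous_map_preimage[OF this, of V]
  have op: "openin (product_topology (\<lambda>_. euclidean) {..<n})
      {x \<in> topspace (product_topology (\<lambda>_. euclidean) {..<n}). (\<Sum>i<n. f (x i)) / n \<in> V}"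
    using f(2) by (simp only: open_openin)
  have eq: "empirical n x \<in> U \<longleftrightarrow> (\<Sum>i<n. f (x i)) / n \<in> V" for x
    using integral_empirical[OF assms borel_measurable_continuous_onI[OF f(1)], of x]
      empirical_in_prob_measures[OF assms, of x] by (simp add: U)
  have "empirical n -` U \<inter> topspace (product_topology (\<lambda>_. euclidean) {..<n}) =
      {x \<in> topspace (product_topology (\<lambda>_. euclidean) {..<n}). (\<Sum>i<n. f (x i)) / n \<in> V}"
    using eq by blast
  with op show "openin (product_topology (\<lambda>_. euclidean) {..<n})
     (empirical n -` U \<inter> topspace (product_topology (\<lambda>_. euclidean) {..<n}))"
    by (simp only:)
next
  show "empirical n ` topspace (product_topology (\<lambda>_. euclidean) {..<n}) \<subseteq>
     \<Union> {{\<mu> \<in> prob_measures. (\<integral>x. f x \<partial>\<mu>) \<in> U} | (f :: 'a \<Rightarrow> real) U.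
        continuous_on UNIV f \<and> bounded (range f) \<and> open U}"
    using topspace_weak_topology[where 'a='a] empirical_in_prob_measures[OF assms, where 'a='a]
    unfolding weak_topology_def topology_generated_by_topspace image_subset_iff
    by simp
qed

section \<open>The Borel \<sigma>-algebra of the weak topology\<close>

lemma sets_weak_borel: "sets weak_borel = sigma_sets prob_measures {A. openin weak_topology A}"
  unfolding weak_borel_def by (rule sets_measure_of) (auto dest: openin_weak_topology_subset)

lemma space_weak_borel: "space weak_borel = prob_measures"
  unfolding weak_borel_def by (rule space_measure_of) (auto dest: openin_weak_topology_subset)

lemma openin_weak_borel: "openin weak_topology A \<Longrightarrow> A \<in> sets weak_borel"
  by (auto simp: sets_weak_borel)

lemma closedin_weak_borel: "closedin weak_topology A \<Longrightarrow> A \<in> sets weak_borel"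
  using sets.compl_sets[OF openin_weak_borel, of "topspace weak_topology - A"]
  by (auto simp: closedin_def topspace_weak_topology space_weak_borel double_diff)

lemma measurable_empirical:
  assumes "compact (UNIV :: 'a::metric_space set)" and "n \<ge> 1"
  shows "empirical n \<in> PiM {..<n} (\<lambda>_. borel :: 'a measure) \<rightarrow>\<^sub>M weak_borel"
proof (rule measurable_sigma_sets[OF sets_weak_borel])
  show "{A. openin weak_topology A} \<subseteq> Pow (prob_measures :: 'a measure set)"
    using openin_weak_topology_subset by blast
  show "empirical n \<in> space (PiM {..<n} (\<lambda>_. borel :: 'a measure)) \<rightarrow> prob_measures"
    using empirical_in_prob_measures[OF assms(2), where 'a='a] by blast
  fix A :: "'a measure set" assume "A \<in> {A. openin weak_topology A}"
  then have "openin (product_topology (\<lambda>_. euclidean) {..<n})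
      {x \<in> topspace (product_topology (\<lambda>_. euclidean) {..<n}). empirical n x \<in> A}"
    using openin_continuous_map_preimage[OF continuous_map_empirical[OF assms(2)]] by blast
  then have "{x \<in> topspace (product_topology (\<lambda>_. euclidean) {..<n}). empirical n x \<in> A} \<in>
      sets (PiM {..<n} (\<lambda>_. borel :: 'a measure))"
    by (rule openin_product_measurable[OF assms(1) finite_lessThan])
  moreover have "empirical n -` A \<inter> space (PiM {..<n} (\<lambda>_. borel :: 'a measure)) =
      {x \<in> topspace (product_topology (\<lambda>_. euclidean) {..<n}). empirical n x \<in> A}"
    unfolding space_PiM topspace_product_topology space_borel topspace_euclidean by blast
  ultimately show "empirical n -` A \<inter> space (PiM {..<n} (\<lambda>_. borel)) \<in> sets (PiM {..<n} (\<lambda>_. borel :: 'a measure))"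
    by (simp only:)
qed

lemma borel_measurable_weak_continuous:
  assumes "continuous_map weak_topology euclideanreal f"
  shows "f \<in> borel_measurable weak_borel"
proof (rule borel_measurableI)
  fix S :: "real set" assume "open S"
  then have "{x \<in> topspace weak_topology. f x \<in> S} \<in> sets weak_borel"
    using openin_weak_borel[OF openin_continuous_map_preimage[OF assms, of S]] by simp
  moreover have "f -` S \<inter> space weak_borel = {x \<in> topspace weak_topology. f x \<in> S}"
    unfolding space_weak_borel topspace_weak_topology by blast
  ultimately show "f -` S \<inter> space weak_borel \<in> sets weak_borel"
    by (simp only:)
qed

section \<open>Extended-valued integrals and semicontinuous functions\<close>

text \<open>Adding the lower bound makes the integrand nonnegative, so a difference of two integrals
  becomes a single nonnegative one, to which monotone convergence and Tonelli apply.\<close>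

lemma ext_integral_shift:
  assumes "prob_space M" and [measurable]: "f \<in> borel_measurable M"
    and "\<And>x. ereal (- K) \<le> f x" and "0 \<le> K"
  shows "ext_integral M f = enn2ereal (\<integral>\<^sup>+x. e2ennreal (f x + ereal K) \<partial>M) - ereal K"
proof -
  interpret prob_space M by fact
  \<comment> \<open>Pointwise, (f + K) plus the negative part of f equals the positive part plus K.
    Integrating this and cancelling the integral of the negative part, which is at most K and hence
    finite, gives the claim.\<close>
  have pw: "e2ennreal (f x + ereal K) + e2ennreal (- f x) = e2ennreal (f x) + ennreal K" for x
  proof (cases "f x")
    case (real r)
    have "ennreal (r + K) + ennreal (- r) = ennreal r + ennreal K"
    proof (cases "r \<ge> 0")
      case True
      then show ?thesis
        using \<open>0 \<le> K\<close> by (simp add: ennreal_plus ennreal_neg)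
    next
      case False
      moreover have "- K \<le> r"
        using assms(3)[of x] real by simp
      ultimately show ?thesis
        by (simp add: ennreal_neg flip: ennreal_plus)
    qed
    then show ?thesis
      by (simp add: real)
  next
    case MInf
    then show ?thesis
      using assms(3)[of x] by simp
  qed (simp add: e2ennreal_infty)
  have le: "(\<integral>\<^sup>+x. e2ennreal (- f x) \<partial>M) \<le> ennreal K"
  proof -
    have "e2ennreal (- f x) \<le> ennreal K" for x
    proof -
      have "- f x \<le> ereal K"
        using assms(3)[of x] by (cases "f x") auto
      then have "e2ennreal (- f x) \<le> e2ennreal (ereal K)"
        by (rule e2ennreal_mono)
      then show ?thesis
        by simp
    qed
    then have "(\<integral>\<^sup>+x. e2ennreal (- f x) \<partial>M) \<le> (\<integral>\<^sup>+x. ennreal K \<partial>M)"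
      by (intro nn_integral_mono)
    then show ?thesis
      by (simp add: emeasure_space_1)
  qed
  have "(\<integral>\<^sup>+x. e2ennreal (f x + ereal K) \<partial>M) + (\<integral>\<^sup>+x. e2ennreal (- f x) \<partial>M) =
      (\<integral>\<^sup>+x. e2ennreal (f x) \<partial>M) + ennreal K"
    by (subst nn_integral_add[symmetric], measurable, simp add: pw)
       (simp add: nn_integral_add emeasure_space_1)
  then have eq: "enn2ereal (\<integral>\<^sup>+x. e2ennreal (f x + ereal K) \<partial>M) + enn2ereal (\<integral>\<^sup>+x. e2ennreal (- f x) \<partial>M) =
      enn2ereal (\<integral>\<^sup>+x. e2ennreal (f x) \<partial>M) + ereal K"
    using \<open>0 \<le> K\<close> by (metis enn2ereal_ennreal plus_ennreal.rep_eq)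
  have "enn2ereal (\<integral>\<^sup>+x. e2ennreal (- f x) \<partial>M) \<le> ereal K"
    using le \<open>0 \<le> K\<close> by (metis enn2ereal_ennreal less_eq_ennreal.rep_eq)
  moreover have "0 \<le> enn2ereal (\<integral>\<^sup>+x. e2ennreal (- f x) \<partial>M)"
    by simp
  ultimately obtain q where q: "enn2ereal (\<integral>\<^sup>+x. e2ennreal (- f x) \<partial>M) = ereal q"
    by (cases "enn2ereal (\<integral>\<^sup>+x. e2ennreal (- f x) \<partial>M)") auto
  show ?thesis
    using eq unfolding ext_integral_def q
    by (cases "enn2ereal (\<integral>\<^sup>+x. e2ennreal (f x + ereal K) \<partial>M)"; 
        cases "enn2ereal (\<integral>\<^sup>+x. e2ennreal (f x) \<partial>M)") auto
qed

lemma ext_integral_mono: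
  assumes "\<And>x. x \<in> space M \<Longrightarrow> f x \<le> g x"
  shows "ext_integral M f \<le> ext_integral M g"
  unfolding ext_integral_def
  by (intro ereal_minus_mono)
     (auto intro!: nn_integral_mono e2ennreal_mono assms simp flip: less_eq_ennreal.rep_eq)

lemma ext_integral_real:
  fixes g :: "'a \<Rightarrow> real"
  assumes "integrable M g"
  shows "ext_integral M (\<lambda>x. ereal (g x)) = ereal (\<integral>x. g x \<partial>M)"
proof -
  have e: "e2ennreal (ereal r) = ennreal r" for r
    by simp
  have "(\<integral>\<^sup>+x. ennreal (g x) \<partial>M) \<noteq> \<infinity>" "(\<integral>\<^sup>+x. ennreal (- g x) \<partial>M) \<noteq> \<infinity>"
    using assms by (simp_all add: real_integrable_def)
  then show ?thesis
    unfolding ext_integral_def real_lebesgue_integral_def[OF assms] uminus_ereal.simps e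
    by (cases "\<integral>\<^sup>+x. ennreal (g x) \<partial>M" ; cases "\<integral>\<^sup>+x. ennreal (- g x) \<partial>M") auto
qed

lemma ext_integral_ge:
  assumes "prob_space M" and "\<And>x. ereal (- K) \<le> f x"
  shows "ereal (- K) \<le> ext_integral M f"
proof -
  interpret prob_space M by fact
  have "ereal (- K) = ext_integral M (\<lambda>_. ereal (- K))"
    by (subst ext_integral_real) (auto simp: prob_space)
  also have "\<dots> \<le> ext_integral M f"
    by (intro ext_integral_mono assms)
  finally show ?thesis .
qed

text \<open>A finite integral of a function bounded below forces finiteness almost everywhere, so
  the value that \<open>real_of_ereal\<close> assigns to \<infinity> is taken on a null set only and
  the ordinary integral is recovered.\<close>

lemma ext_integral_finite:
  assumes "prob_space M" and [measurable]: "f \<in> borel_measurable M"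
    and "\<And>x. ereal (- K) \<le> f x" and "0 \<le> K" and "ext_integral M f < \<infinity>"
  shows "AE x in M. f x \<noteq> \<infinity>" "integrable M (\<lambda>x. real_of_ereal (f x))"
    "ext_integral M f = ereal (\<integral>x. real_of_ereal (f x) \<partial>M)"
proof -
  interpret prob_space M by fact
  have eq: "ext_integral M f = enn2ereal (\<integral>\<^sup>+x. e2ennreal (f x + ereal K) \<partial>M) - ereal K"
    by (rule ext_integral_shift) fact+
  have "(\<integral>\<^sup>+x. e2ennreal (f x + ereal K) \<partial>M) \<noteq> \<infinity>"
  proof
    assume "(\<integral>\<^sup>+x. e2ennreal (f x + ereal K) \<partial>M) = \<infinity>"
    then show False
      using eq assms(5) by simp
  qed
  then have "AE x in M. e2ennreal (f x + ereal K) \<noteq> \<infinity>"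
    by (intro nn_integral_noteq_infinite) auto
  then show AE: "AE x in M. f x \<noteq> \<infinity>"
    by eventually_elim (auto simp: e2ennreal_infty)
  have "integrable M (\<lambda>x. real_of_ereal (f x) + K)"
  proof (rule integrableI_nonneg)
    show "AE x in M. 0 \<le> real_of_ereal (f x) + K"
      using AE
    proof eventually_elim
      case (elim x)
      then show ?case
        using assms(3)[of x] by (cases "f x") auto
    qed
    have "(\<integral>\<^sup>+x. ennreal (real_of_ereal (f x) + K) \<partial>M) = (\<integral>\<^sup>+x. e2ennreal (f x + ereal K) \<partial>M)"
      using AE
    proof (intro nn_integral_cong_AE, eventually_elim)
      case (elim x)
      then show ?case
        using assms(3)[of x] by (cases "f x") auto
    qed
    then show "(\<integral>\<^sup>+x. ennreal (real_of_ereal (f x) + K) \<partial>M) < \<infinity>"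
      using \<open>(\<integral>\<^sup>+x. e2ennreal (f x + ereal K) \<partial>M) \<noteq> \<infinity>\<close> by (simp add: less_top)
  qed measurable
  then have "integrable M (\<lambda>x. real_of_ereal (f x) + K - K)"
    by (rule Bochner_Integration.integrable_diff) simp
  then show int: "integrable M (\<lambda>x. real_of_ereal (f x))"
    by simp
  have "ext_integral M f = ext_integral M (\<lambda>x. ereal (real_of_ereal (f x)))"
    unfolding ext_integral_def
  proof (intro arg_cong2[where f = "(-)"] arg_cong[where f = enn2ereal] nn_integral_cong_AE)
    show "AE x in M. e2ennreal (f x) = e2ennreal (ereal (real_of_ereal (f x)))"
      using AE
    proof eventually_elim
      case (elim x)
      then show ?case
        using assms(3)[of x] by (cases "f x") auto
    qed
    show "AE x in M. e2ennreal (- f x) = e2ennreal (- ereal (real_of_ereal (f x)))"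
      using AE
    proof eventually_elim
      case (elim x)
      then show ?case
        using assms(3)[of x] by (cases "f x") auto
    qed
  qed
  then show "ext_integral M f = ereal (\<integral>x. real_of_ereal (f x) \<partial>M)"
    using ext_integral_real[OF int] by simp
qed

lemma e2ennreal_ext_integral_shift:
  assumes "prob_space M" and [measurable]: "f \<in> borel_measurable M"
    and "\<And>x. ereal (- K) \<le> f x" and "0 \<le> K"
  shows "e2ennreal (ext_integral M f + ereal K) = (\<integral>\<^sup>+x. e2ennreal (f x + ereal K) \<partial>M)"
proof -
  have "ext_integral M f + ereal K = enn2ereal (\<integral>\<^sup>+x. e2ennreal (f x + ereal K) \<partial>M)"
    unfolding ext_integral_shift[OF assms]
    by (cases "enn2ereal (\<integral>\<^sup>+x. e2ennreal (f x + ereal K) \<partial>M)") auto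
  then show ?thesis
    by simp
qed

text \<open>Tonelli for the shifted function G + K. The inner integrals inherit the lower bound -K
  since the measures are probabilities, so one constant serves for both layers of
  integration.\<close>

lemma
  fixes G :: "'a \<times> 'b \<Rightarrow> ereal"
  assumes "prob_space M" "prob_space N" and [measurable]: "G \<in> borel_measurable (M \<Otimes>\<^sub>M N)"
    and G: "\<And>p. ereal (- K) \<le> G p" and "0 \<le> K"
  shows borel_measurable_ext_integral_fst: "(\<lambda>x. ext_integral N (\<lambda>y. G (x, y))) \<in> borel_measurable M"
    and ext_integral_fst:
      "ext_integral (M \<Otimes>\<^sub>M N) G = ext_integral M (\<lambda>x. ext_integral N (\<lambda>y. G (x, y)))"
    and ext_integral_snd:
      "ext_integral (M \<Otimes>\<^sub>M N) G = ext_integral N (\<lambda>y. ext_integral M (\<lambda>x. G (x, y)))"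
proof -
  interpret M: prob_space M by fact
  interpret N: prob_space N by fact
  interpret MN: pair_prob_space M N ..
  have sh1: "ext_integral N (\<lambda>y. G (x, y)) = enn2ereal (\<integral>\<^sup>+y. e2ennreal (G (x, y) + ereal K) \<partial>N) - ereal K"
    if "x \<in> space M" for x
    using that by (intro ext_integral_shift assms) measurable
  show meas1: "(\<lambda>x. ext_integral N (\<lambda>y. G (x, y))) \<in> borel_measurable M"
    by (subst measurable_cong[OF sh1]) measurable
  have sh2: "ext_integral M (\<lambda>x. G (x, y)) = enn2ereal (\<integral>\<^sup>+x. e2ennreal (G (x, y) + ereal K) \<partial>M) - ereal K"
    if "y \<in> space N" for y
    using that by (intro ext_integral_shift assms) measurable
  have meas2: "(\<lambda>y. ext_integral M (\<lambda>x. G (x, y))) \<in> borel_measurable N"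
    by (subst measurable_cong[OF sh2]) measurable
  have sh: "ext_integral (M \<Otimes>\<^sub>M N) G = enn2ereal (\<integral>\<^sup>+p. e2ennreal (G p + ereal K) \<partial>(M \<Otimes>\<^sub>M N)) - ereal K"
    by (intro ext_integral_shift MN.prob_space_axioms assms)
  have "(\<integral>\<^sup>+p. e2ennreal (G p + ereal K) \<partial>(M \<Otimes>\<^sub>M N)) =
      (\<integral>\<^sup>+x. \<integral>\<^sup>+y. e2ennreal (G (x, y) + ereal K) \<partial>N \<partial>M)"
    by (subst N.nn_integral_fst[symmetric]) auto
  also have "\<dots> = (\<integral>\<^sup>+x. e2ennreal (ext_integral N (\<lambda>y. G (x, y)) + ereal K) \<partial>M)"
    by (intro nn_integral_cong e2ennreal_ext_integral_shift[symmetric] assms) measurable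
  finally show "ext_integral (M \<Otimes>\<^sub>M N) G = ext_integral M (\<lambda>x. ext_integral N (\<lambda>y. G (x, y)))"
    unfolding sh by (subst ext_integral_shift[OF assms(1) meas1 ext_integral_ge])
      (simp_all add: assms)
  have "(\<integral>\<^sup>+p. e2ennreal (G p + ereal K) \<partial>(M \<Otimes>\<^sub>M N)) =
      (\<integral>\<^sup>+y. \<integral>\<^sup>+x. e2ennreal (G (x, y) + ereal K) \<partial>M \<partial>N)"
    by (subst MN.nn_integral_snd[symmetric]) auto
  also have "\<dots> = (\<integral>\<^sup>+y. e2ennreal (ext_integral M (\<lambda>x. G (x, y)) + ereal K) \<partial>N)"
    by (intro nn_integral_cong e2ennreal_ext_integral_shift[symmetric] assms) measurable
  finally show "ext_integral (M \<Otimes>\<^sub>M N) G = ext_integral N (\<lambda>y. ext_integral M (\<lambda>x. G (x, y)))"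
    unfolding sh by (subst ext_integral_shift[OF assms(2) meas2 ext_integral_ge])
      (simp_all add: assms)
qed

text \<open>Monotone convergence after a shift by the common lower bound.\<close>

lemma ext_integral_LIMSEQ:
  fixes \<phi> :: "nat \<Rightarrow> 'a \<Rightarrow> real"
  assumes "prob_space M" and "f \<in> borel_measurable M" and "\<And>k. integrable M (\<phi> k)"
    and lower: "\<And>k x. - K \<le> \<phi> k x" and "0 \<le> K"
    and inc: "\<And>k x. \<phi> k x \<le> \<phi> (Suc k) x" and lim: "\<And>x. (\<lambda>k. ereal (\<phi> k x)) \<longlonglongrightarrow> f x"
  shows "(\<lambda>k. ereal (\<integral>x. \<phi> k x \<partial>M)) \<longlonglongrightarrow> ext_integral M f"
proof -
  have f: "ereal (- K) \<le> f x" for x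
    by (rule LIMSEQ_le_const[OF lim]) (simp add: lower)
  have sh: "ereal (\<integral>x. \<phi> k x \<partial>M) = enn2ereal (\<integral>\<^sup>+x. e2ennreal (ereal (\<phi> k x) + ereal K) \<partial>M) - ereal K" for k
    using assms by (subst ext_integral_shift[symmetric]) (auto simp: ext_integral_real)
  have "(\<lambda>k. \<integral>\<^sup>+x. e2ennreal (ereal (\<phi> k x) + ereal K) \<partial>M) \<longlonglongrightarrow> (\<integral>\<^sup>+x. e2ennreal (f x + ereal K) \<partial>M)"
  proof (rule nn_integral_LIMSEQ)
    show "incseq (\<lambda>k x. e2ennreal (ereal (\<phi> k x) + ereal K))"
      by (intro incseq_SucI le_funI e2ennreal_mono add_right_mono) (simp add: inc)
    show "(\<lambda>x. e2ennreal (ereal (\<phi> k x) + ereal K)) \<in> borel_measurable M" for k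
      using assms(3) by measurable
    show "(\<lambda>k. e2ennreal (ereal (\<phi> k x) + ereal K)) \<longlonglongrightarrow> e2ennreal (f x + ereal K)" for x
      by (intro tendsto_e2ennrealI tendsto_add_ereal_general1 lim tendsto_const) auto
  qed
  then have "(\<lambda>k. enn2ereal (\<integral>\<^sup>+x. e2ennreal (ereal (\<phi> k x) + ereal K) \<partial>M) - ereal K) \<longlonglongrightarrow>
      enn2ereal (\<integral>\<^sup>+x. e2ennreal (f x + ereal K) \<partial>M) - ereal K"
    by (intro tendsto_diff_ereal_general tendsto_enn2erealI tendsto_const) auto
  then show ?thesis
    unfolding sh by (subst ext_integral_shift[OF assms(1,2) f \<open>0 \<le> K\<close>])
qed

section \<open>Lower semicontinuous functions: lower bounds and continuous minorants\<close>

lemma lower_semicontinuous_bounded_below: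
  fixes G :: "'b::topological_space \<Rightarrow> ereal"
  assumes "compact (UNIV :: 'b set)" and "lower_semicontinuous G" and "\<And>p. G p \<noteq> -\<infinity>"
  obtains K where "0 \<le> K" "\<And>p. ereal (- K) \<le> G p"
proof -
  \<comment> \<open>The superlevel sets at -n are open by semicontinuity and exhaust the space since
    G avoids -\<infinity>; a finite subcover gives the bound, the sum of its indices dominating each
    of them.\<close>
  have "(UNIV :: 'b set) \<subseteq> (\<Union>n::nat. {p. ereal (- real n) < G p})"
  proof
    fix p
    have "\<exists>n::nat. ereal (- real n) < G p"
    proof (cases "G p")
      case (real r)
      then show ?thesis
        using reals_Archimedean2[of "- r"] by (auto simp: minus_less_iff)
    qed (use assms(3) in auto)
    then show "p \<in> (\<Union>n::nat. {p. ereal (- real n) < G p})"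
      by blast
  qed
  moreover have "open {p. ereal (- real n) < G p}" for n
    using assms(2) by (simp add: lower_semicontinuous_def)
  ultimately have "\<exists>C. finite C \<and> (UNIV :: 'b set) \<subseteq> (\<Union>n\<in>C. {p. ereal (- real n) < G p})"
    using compactE_image[OF assms(1), of UNIV "\<lambda>n::nat. {p. ereal (- real n) < G p}"] by metis
  then obtain C where C: "finite C" "(UNIV :: 'b set) \<subseteq> (\<Union>n\<in>C. {p. ereal (- real n) < G p})"
    by blast
  show thesis
  proof (rule that[of "real (\<Sum>C)"])
    fix p
    obtain n where "n \<in> C" "ereal (- real n) < G p"
      using C(2) by blast
    moreover have "n \<le> \<Sum>C"
      using \<open>n \<in> C\<close> C(1) by (rule member_le_sum[of n C "\<lambda>n. n", simplified])
    then have "ereal (- real (\<Sum>C)) \<le> ereal (- real n)"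
      by (simp del: of_nat_sum)
    ultimately show "ereal (- real (\<Sum>C)) \<le> G p"
      by (meson less_imp_le order_trans)
  qed (simp add: sum_nonneg)
qed

text \<open>The approximants are the Lipschitz regularizations $\inf_q (\min(G(q), k) + k\, d(p, q))$.\<close>

lemma lower_semicontinuous_approx:
  fixes G :: "'b::metric_space \<Rightarrow> ereal"
  assumes "lower_semicontinuous G" and G: "\<And>p. ereal (- K) \<le> G p" and "0 \<le> K"
  obtains \<phi> :: "nat \<Rightarrow> 'b \<Rightarrow> real"
  where "\<And>k. continuous_on UNIV (\<phi> k)" "\<And>k p. - K \<le> \<phi> k p" "\<And>k p. \<phi> k p \<le> \<phi> (Suc k) p"
    "\<And>k p. ereal (\<phi> k p) \<le> G p" "\<And>p. (\<lambda>k. ereal (\<phi> k p)) \<longlonglongrightarrow> G p"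
proof -
  \<comment> \<open>Truncation at level k makes the function real-valued, so that the infimum below
    is a real number even where G is infinite.\<close>
  define g where "g k q = real_of_ereal (min (G q) (ereal (real k)))" for k q
  have g: "ereal (g k q) = min (G q) (ereal (real k))" for k q
    unfolding g_def using G[of q] by (cases "G q") (auto simp: min_def)
  have g_ge: "- K \<le> g k q" for k q
  proof -
    have "ereal (- K) \<le> ereal (g k q)"
      unfolding g using G[of q] \<open>0 \<le> K\<close> by simp
    then show ?thesis
      by simp
  qed
  have g_mono: "g k q \<le> g (Suc k) q" for k q
  proof -
    have "ereal (g k q) \<le> ereal (g (Suc k) q)"
      unfolding g by (rule min.mono) auto
    then show ?thesis
      by simp
  qed
  define \<phi> where "\<phi> k p = (INF q. g k q + k * dist p q)" for k p
  have bdd: "bdd_below (range (\<lambda>q. g k q + k * dist p q))" for k p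
    by (rule bdd_belowI2[of _ "- K"]) (metis add_increasing2 g_ge mult_nonneg_nonneg of_nat_0_le_iff zero_le_dist)
  have le: "\<phi> k p \<le> g k q + k * dist p q" for k p q
    unfolding \<phi>_def by (rule cINF_lower[OF bdd]) simp
  have ge: "c \<le> \<phi> k p" if "\<And>q. c \<le> g k q + k * dist p q" for c k p
    unfolding \<phi>_def by (rule cINF_greatest) (simp_all add: that)
  have upper: "ereal (\<phi> k p) \<le> G p" for k p
  proof -
    have "ereal (\<phi> k p) \<le> ereal (g k p)"
      using le[of k p p] by simp
    then show ?thesis
      unfolding g by simp
  qed
  show thesis
  proof (rule that[of \<phi>])
    fix k
    have lip: "\<phi> k p \<le> \<phi> k p' + k * dist p p'" for p p'
    proof -
      have "\<phi> k p - k * dist p p' \<le> \<phi> k p'"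
      proof (rule ge)
        fix q
        have "\<phi> k p \<le> g k q + k * dist p q"
          by (rule le)
        also have "k * dist p q \<le> k * (dist p p' + dist p' q)"
          by (intro mult_left_mono dist_triangle) simp
        finally show "\<phi> k p - k * dist p p' \<le> g k q + k * dist p' q"
          by (simp add: algebra_simps)
      qed
      then show ?thesis
        by simp
    qed
    have "dist (\<phi> k p) (\<phi> k p') \<le> k * dist p p'" for p p'
      using lip[of p p'] lip[of p' p] by (simp add: dist_real_def dist_commute)
    then have "k-lipschitz_on UNIV (\<phi> k)"
      by (intro lipschitz_onI) auto
    then show "continuous_on UNIV (\<phi> k)"
      by (rule lipschitz_on_continuous_on)
  next
    show "- K \<le> \<phi> k p" for k p
      by (rule ge) (metis add_increasing2 g_ge mult_nonneg_nonneg of_nat_0_le_iff zero_le_dist)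
    show "\<phi> k p \<le> \<phi> (Suc k) p" for k p
    proof (rule ge)
      fix q
      have "\<phi> k p \<le> g k q + k * dist p q"
        by (rule le)
      also have "\<dots> \<le> g (Suc k) q + Suc k * dist p q"
        by (intro add_mono g_mono mult_right_mono) auto
      finally show "\<phi> k p \<le> g (Suc k) q + Suc k * dist p q" .
    qed
    show "(\<lambda>k. ereal (\<phi> k p)) \<longlonglongrightarrow> G p" for p
    proof (rule order_tendstoI)
      fix a assume "G p < a"
      then show "\<forall>\<^sub>F k in sequentially. ereal (\<phi> k p) < a"
        using upper by (intro always_eventually allI) (rule le_less_trans)
    next
      fix a assume "a < G p"
      then obtain c where c: "a < ereal c" "ereal c < G p"
        by (metis ereal_dense2)
      have "open {q. ereal c < G q}"
        using assms(1) by (simp add: lower_semicontinuous_def)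
      then obtain \<delta> where \<delta>: "\<delta> > 0" "\<And>q. dist p q < \<delta> \<Longrightarrow> ereal c < G q"
        using c by (metis (no_types, lifting) mem_Collect_eq open_dist dist_commute)
      \<comment> \<open>Two thresholds: k \<ge> c keeps the truncation at least c on the
        \<delta>-ball where G exceeds c, and k \<ge> (c + K) / \<delta> makes the distance penalty
        outside that ball raise the lower bound -K to at least c.\<close>
      have "\<forall>\<^sub>F k in sequentially. c \<le> real k"
        by (rule eventually_ge_at_top[THEN filterlim_real_sequentially[unfolded filterlim_iff, rule_format]])
      moreover have "\<forall>\<^sub>F k in sequentially. (c + K) / \<delta> \<le> real k"
        by (rule eventually_ge_at_top[THEN filterlim_real_sequentially[unfolded filterlim_iff, rule_format]])
      ultimately show "\<forall>\<^sub>F k in sequentially. a < ereal (\<phi> k p)"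
      proof eventually_elim
        case (elim k)
        have "c \<le> \<phi> k p"
        proof (rule ge)
          fix q
          show "c \<le> g k q + k * dist p q"
          proof (cases "dist p q < \<delta>")
            case True
            then have "ereal c \<le> ereal (g k q)"
              unfolding g using \<delta>(2)[of q] elim by (auto simp: less_imp_le)
            then show ?thesis
              by (simp add: add_increasing2)
          next
            case False
            then have "c + K \<le> k * dist p q"
              using elim \<delta>(1) by (meson divide_le_eq mult_left_mono not_less of_nat_0_le_iff order_trans)
            then show ?thesis
              using g_ge[of k q] by linarith
          qed
        qed
        then show ?case
          using c(1) by (meson ereal_less_eq(3) less_le_trans)
      qed
    qed
  qed (rule upper)
qed

section \<open>Two-body energies\<close>

lemma bounded_range_continuous:
  fixes f :: "'b::metric_space \<Rightarrow> real"
  assumes "compact (UNIV :: 'b set)" and "continuous_on UNIV f"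
  shows "bounded (range f)"
  using compact_continuous_image[OF assms(2,1)] by (rule compact_imp_bounded)

lemma compact_UNIV_pair:
  assumes "compact (UNIV :: 'a::metric_space set)"
  shows "compact (UNIV :: ('a \<times> 'a) set)"
  using compact_Times[OF assms assms] by simp

lemma integrable_continuous:
  fixes f :: "'a::metric_space \<Rightarrow> real"
  assumes "compact (UNIV :: 'a set)" and "continuous_on UNIV f" and "\<mu> \<in> prob_measures"
  shows "integrable \<mu> f"
proof -
  interpret prob_space \<mu>
    using assms(3) by (rule prob_measuresD)
  obtain B where "\<And>x. norm (f x) \<le> B"
    using bounded_range_continuous[OF assms(1,2)] unfolding bounded_iff by auto
  moreover have "f \<in> borel_measurable \<mu>"
    using borel_measurable_continuous_onI[OF assms(2)] prob_measuresD(2)[OF assms(3)]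
    by (simp cong: measurable_cong_sets)
  ultimately show ?thesis
    by (intro integrable_const_bound[where B = B]) auto
qed

lemma abs_integral_diff_le:
  fixes f g :: "'b \<Rightarrow> real"
  assumes "prob_space M" "integrable M f" "integrable M g" "\<And>x. \<bar>f x - g x\<bar> \<le> e"
  shows "\<bar>(\<integral>x. f x \<partial>M) - (\<integral>x. g x \<partial>M)\<bar> \<le> e"
proof -
  interpret prob_space M by fact
  have "\<bar>(\<integral>x. f x \<partial>M) - (\<integral>x. g x \<partial>M)\<bar> = \<bar>\<integral>x. f x - g x \<partial>M\<bar>"
    using assms by simp
  also have "\<dots> \<le> (\<integral>x. \<bar>f x - g x\<bar> \<partial>M)"
    by (rule integral_abs_bound)
  also have "\<dots> \<le> (\<integral>x. e \<partial>M)"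
    using assms by (intro integral_mono) auto
  finally show ?thesis
    by (simp add: prob_space)
qed

lemma continuous_on_Pair_left:
  assumes "continuous_on UNIV \<phi>"
  shows "continuous_on UNIV (\<lambda>y. \<phi> (x, y))"
  by (rule continuous_on_compose2[OF assms]) (auto intro!: continuous_intros)

lemma uniform_continuity_pair:
  fixes \<phi> :: "'a::metric_space \<times> 'a \<Rightarrow> real"
  assumes "compact (UNIV :: 'a set)" and "continuous_on UNIV \<phi>" and "0 < e"
  obtains d where "0 < d" "\<And>x x' y. dist x x' < d \<Longrightarrow> \<bar>\<phi> (x, y) - \<phi> (x', y)\<bar> < e"
proof -
  have "uniformly_continuous_on UNIV \<phi>"
    using assms(2) compact_UNIV_pair[OF assms(1)] by (rule compact_uniformly_continuous)
  then obtain d where "0 < d" "\<And>p q. dist p q < d \<Longrightarrow> dist (\<phi> p) (\<phi> q) < e"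
    using \<open>0 < e\<close> unfolding uniformly_continuous_on_def by (metis UNIV_I dist_commute)
  then show thesis
    by (intro that[of d]) (auto simp: dist_Pair_Pair dist_real_def)
qed

lemma continuous_on_integral_pair:
  fixes \<phi> :: "'a::metric_space \<times> 'a \<Rightarrow> real"
  assumes "compact (UNIV :: 'a set)" and "continuous_on UNIV \<phi>" and "\<nu> \<in> prob_measures"
  shows "continuous_on UNIV (\<lambda>x. \<integral>y. \<phi> (x, y) \<partial>\<nu>)"
  unfolding continuous_on_iff
proof (intro ballI allI impI)
  fix x :: 'a and e :: real assume "0 < e"
  then have "0 < e / 2"
    by simp
  then obtain d where d: "0 < d" "\<And>x x' y. dist x x' < d \<Longrightarrow> \<bar>\<phi> (x, y) - \<phi> (x', y)\<bar> < e / 2"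
    using uniform_continuity_pair[OF assms(1,2)] by metis
  show "\<exists>d>0. \<forall>x'\<in>UNIV. dist x' x < d \<longrightarrow> dist (\<integral>y. \<phi> (x', y) \<partial>\<nu>) (\<integral>y. \<phi> (x, y) \<partial>\<nu>) < e"
  proof (intro exI[of _ d] conjI ballI impI)
    fix x' assume "dist x' x < d"
    then have "\<bar>\<phi> (x', y) - \<phi> (x, y)\<bar> \<le> e / 2" for y
      using d(2)[of x' x y] by simp
    then have "\<bar>(\<integral>y. \<phi> (x', y) \<partial>\<nu>) - (\<integral>y. \<phi> (x, y) \<partial>\<nu>)\<bar> \<le> e / 2"
      by (intro abs_integral_diff_le integrable_continuous continuous_on_Pair_left prob_measuresD assms)
    then show "dist (\<integral>y. \<phi> (x', y) \<partial>\<nu>) (\<integral>y. \<phi> (x, y) \<partial>\<nu>) < e"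
      using \<open>0 < e\<close> by (simp add: dist_real_def)
  qed (rule d)
qed

text \<open>Uniformity comes from the modulus of continuity of \<phi> in its first variable, which
  is inherited by the integral against every probability measure. Weak convergence is used only at
  the points of a finite net; the three errors of e / 3 are two moves to the net and one convergence
  there.\<close>

lemma uniform_limit_integral_pair:
  fixes \<phi> :: "'a::metric_space \<times> 'a \<Rightarrow> real"
  assumes "compact (UNIV :: 'a set)" and "continuous_on UNIV \<phi>"
    and lim: "limitin weak_topology \<nu>s \<nu> F" and "0 < e"
  shows "\<forall>\<^sub>F i in F. \<forall>x. \<bar>(\<integral>y. \<phi> (x, y) \<partial>\<nu>s i) - (\<integral>y. \<phi> (x, y) \<partial>\<nu>)\<bar> \<le> e"
proof -
  have \<nu>: "\<nu> \<in> prob_measures" "\<forall>\<^sub>F i in F. \<nu>s i \<in> prob_measures"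
    using lim by (auto simp: limitin_weak_topology)
  have "0 < e / 3"
    using \<open>0 < e\<close> by simp
  then obtain d where d: "0 < d" "\<And>x x' y. dist x x' < d \<Longrightarrow> \<bar>\<phi> (x, y) - \<phi> (x', y)\<bar> < e / 3"
    using uniform_continuity_pair[OF assms(1,2)] by metis
  obtain C :: "'a set" where C: "finite C" "UNIV \<subseteq> (\<Union>c\<in>C. ball c d)"
    using assms(1) d(1) unfolding compact_eq_totally_bounded by metis
  have "\<forall>\<^sub>F i in F. \<bar>(\<integral>y. \<phi> (c, y) \<partial>\<nu>s i) - (\<integral>y. \<phi> (c, y) \<partial>\<nu>)\<bar> < e / 3" for c
  proof -
    have "((\<lambda>i. \<integral>y. \<phi> (c, y) \<partial>\<nu>s i) \<longlongrightarrow> (\<integral>y. \<phi> (c, y) \<partial>\<nu>)) F"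
      using lim continuous_on_Pair_left[OF assms(2)] bounded_range_continuous[OF assms(1)]
      unfolding limitin_weak_topology by blast
    from tendstoD[OF this \<open>0 < e / 3\<close>] show ?thesis
      by (simp add: dist_real_def)
  qed
  then have "\<forall>\<^sub>F i in F. \<forall>c\<in>C. \<bar>(\<integral>y. \<phi> (c, y) \<partial>\<nu>s i) - (\<integral>y. \<phi> (c, y) \<partial>\<nu>)\<bar> < e / 3"
    using C(1) by (intro eventually_ball_finite) auto
  then show ?thesis
    using \<nu>(2)
  proof eventually_elim
    case (elim i)
    show ?case
    proof
      fix x
      obtain c where c: "c \<in> C" "dist x c < d"
        using C(2) by (metis UNIV_I UN_iff dist_commute mem_ball subset_iff)
      have le: "\<bar>(\<integral>y. \<phi> (x, y) \<partial>\<rho>) - (\<integral>y. \<phi> (c, y) \<partial>\<rho>)\<bar> \<le> e / 3" if "\<rho> \<in> prob_measures" for \<rho>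
        using d(2)[OF c(2)] that
        by (intro abs_integral_diff_le integrable_continuous continuous_on_Pair_left prob_measuresD assms)
           (simp_all add: less_imp_le)
      show "\<bar>(\<integral>y. \<phi> (x, y) \<partial>\<nu>s i) - (\<integral>y. \<phi> (x, y) \<partial>\<nu>)\<bar> \<le> e"
        using le[OF elim(2)] le[OF \<nu>(1)] elim(1)[rule_format, OF c(1)] by linarith
    qed
  qed
qed

text \<open>Both measures move. Replacing the inner one by its limit changes the inner integral
  uniformly little, and what remains is a fixed continuous function integrated against the outer
  measure.\<close>

lemma tendsto_integral_pair:
  fixes \<phi> :: "'a::metric_space \<times> 'a \<Rightarrow> real"
  assumes "compact (UNIV :: 'a set)" and "continuous_on UNIV \<phi>"
    and lim: "limitin weak_topology \<mu>s \<mu> F" "limitin weak_topology \<nu>s \<nu> F"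
  shows "((\<lambda>i. \<integral>x. \<integral>y. \<phi> (x, y) \<partial>\<nu>s i \<partial>\<mu>s i) \<longlongrightarrow> (\<integral>x. \<integral>y. \<phi> (x, y) \<partial>\<nu> \<partial>\<mu>)) F"
proof (rule tendstoI)
  fix e :: real assume "0 < e"
  have \<nu>: "\<nu> \<in> prob_measures" "\<forall>\<^sub>F i in F. \<nu>s i \<in> prob_measures" "\<forall>\<^sub>F i in F. \<mu>s i \<in> prob_measures"
    using lim by (auto simp: limitin_weak_topology)
  note cont = continuous_on_integral_pair[OF assms(1,2)]
  have "((\<lambda>i. \<integral>x. \<integral>y. \<phi> (x, y) \<partial>\<nu> \<partial>\<mu>s i) \<longlongrightarrow> (\<integral>x. \<integral>y. \<phi> (x, y) \<partial>\<nu> \<partial>\<mu>)) F"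
    using lim(1) cont[OF \<nu>(1)] bounded_range_continuous[OF assms(1)]
    unfolding limitin_weak_topology by blast
  then have "\<forall>\<^sub>F i in F. dist (\<integral>x. \<integral>y. \<phi> (x, y) \<partial>\<nu> \<partial>\<mu>s i) (\<integral>x. \<integral>y. \<phi> (x, y) \<partial>\<nu> \<partial>\<mu>) < e / 2"
    using \<open>0 < e\<close> by (intro tendstoD) simp_all
  moreover have "\<forall>\<^sub>F i in F. \<forall>x. \<bar>(\<integral>y. \<phi> (x, y) \<partial>\<nu>s i) - (\<integral>y. \<phi> (x, y) \<partial>\<nu>)\<bar> \<le> e / 2"
    using \<open>0 < e\<close> by (intro uniform_limit_integral_pair assms) simp_all
  ultimately show "\<forall>\<^sub>F i in F. dist (\<integral>x. \<integral>y. \<phi> (x, y) \<partial>\<nu>s i \<partial>\<mu>s i) (\<integral>x. \<integral>y. \<phi> (x, y) \<partial>\<nu> \<partial>\<mu>) < e"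
    using \<nu>(2,3)
  proof eventually_elim
    case (elim i)
    have "\<bar>(\<integral>x. \<integral>y. \<phi> (x, y) \<partial>\<nu>s i \<partial>\<mu>s i) - (\<integral>x. \<integral>y. \<phi> (x, y) \<partial>\<nu> \<partial>\<mu>s i)\<bar> \<le> e / 2"
      using elim by (intro abs_integral_diff_le integrable_continuous prob_measuresD cont \<nu> assms) simp_all
    then show ?case
      using elim(1) unfolding dist_real_def by linarith
  qed
qed

lemma sets_pair_prob_measures:
  assumes "\<mu> \<in> prob_measures" "\<nu> \<in> prob_measures"
  shows "sets (\<mu> \<Otimes>\<^sub>M \<nu>) = sets (borel \<Otimes>\<^sub>M borel)"
  using assms by (intro sets_pair_measure_cong prob_measuresD)

lemma prob_space_pair:
  assumes "prob_space M" "prob_space N"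
  shows "prob_space (M \<Otimes>\<^sub>M N)"
proof -
  interpret M: prob_space M by fact
  interpret N: prob_space N by fact
  interpret pair_prob_space M N ..
  show ?thesis
    by (rule prob_space_axioms)
qed

lemma integrable_pair_continuous:
  fixes \<phi> :: "'a::metric_space \<times> 'a \<Rightarrow> real"
  assumes "compact (UNIV :: 'a set)" and "continuous_on UNIV \<phi>"
    and "\<mu> \<in> prob_measures" "\<nu> \<in> prob_measures"
  shows "integrable (\<mu> \<Otimes>\<^sub>M \<nu>) \<phi>"
proof -
  interpret prob_space "\<mu> \<Otimes>\<^sub>M \<nu>"
    by (intro prob_space_pair prob_measuresD assms)
  obtain B where "\<And>x. norm (\<phi> x) \<le> B"
    using bounded_range_continuous[OF compact_UNIV_pair[OF assms(1)] assms(2)] unfolding bounded_iff by auto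
  moreover have "\<phi> \<in> borel_measurable (\<mu> \<Otimes>\<^sub>M \<nu>)"
    using borel_measurable_pair_continuous[OF assms(1,2)] sets_pair_prob_measures[OF assms(3,4)]
    by (simp cong: measurable_cong_sets)
  ultimately show ?thesis
    by (intro integrable_const_bound[where B = B]) auto
qed

lemma integral_pair_continuous:
  fixes \<phi> :: "'a::metric_space \<times> 'a \<Rightarrow> real"
  assumes "compact (UNIV :: 'a set)" and "continuous_on UNIV \<phi>"
    and "\<mu> \<in> prob_measures" "\<nu> \<in> prob_measures"
  shows "(\<integral>p. \<phi> p \<partial>(\<mu> \<Otimes>\<^sub>M \<nu>)) = (\<integral>x. \<integral>y. \<phi> (x, y) \<partial>\<nu> \<partial>\<mu>)"
proof -
  interpret M: prob_space \<mu> using assms(3) by (rule prob_measuresD)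
  interpret N: prob_space \<nu> using assms(4) by (rule prob_measuresD)
  interpret pair_prob_space \<mu> \<nu> ..
  show ?thesis
    using integral_fst'[OF integrable_pair_continuous[OF assms]] by simp
qed

text \<open>Taking the minimum with the transposed function makes the approximants symmetric.\<close>

lemma pair_energy_approx:
  fixes G :: "'a::metric_space \<times> 'a \<Rightarrow> ereal"
  assumes compact: "compact (UNIV :: 'a set)" and lsc: "lower_semicontinuous G"
    and ne: "\<And>p. G p \<noteq> -\<infinity>"
  shows "\<exists>\<phi> :: nat \<Rightarrow> 'a \<times> 'a \<Rightarrow> real. (\<forall>k. continuous_on UNIV (\<phi> k)) \<and> (\<forall>k p. ereal (\<phi> k p) \<le> G p) \<and>
    (\<forall>\<mu> \<nu>. \<mu> \<in> prob_measures \<longrightarrow> \<nu> \<in> prob_measures \<longrightarrow>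
      (\<lambda>k. ereal (\<integral>x. \<integral>y. \<phi> k (x, y) \<partial>\<nu> \<partial>\<mu>)) \<longlonglongrightarrow> ext_integral (\<mu> \<Otimes>\<^sub>M \<nu>) G) \<and>
    ((\<forall>x y. G (x, y) = G (y, x)) \<longrightarrow> (\<forall>k x y. \<phi> k (x, y) = \<phi> k (y, x)))" (is "\<exists>\<phi>. ?P \<phi>")
proof -
  obtain K where K: "0 \<le> K" "\<And>p. ereal (- K) \<le> G p"
    using lower_semicontinuous_bounded_below[OF compact_UNIV_pair[OF compact] lsc ne] by metis
  obtain \<psi> :: "nat \<Rightarrow> 'a \<times> 'a \<Rightarrow> real" where \<psi>: "\<And>k. continuous_on UNIV (\<psi> k)" "\<And>k p. - K \<le> \<psi> k p"
    "\<And>k p. \<psi> k p \<le> \<psi> (Suc k) p" "\<And>k p. ereal (\<psi> k p) \<le> G p" "\<And>p. (\<lambda>k. ereal (\<psi> k p)) \<longlonglongrightarrow> G p"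
    using lower_semicontinuous_approx[OF lsc K(2,1)] by metis
  \<comment> \<open>Stated for arbitrary monotone approximants, because it serves both the original
    ones and their symmetrization.\<close>
  have lim: "(\<lambda>k. ereal (\<integral>x. \<integral>y. \<phi> k (x, y) \<partial>\<nu> \<partial>\<mu>)) \<longlonglongrightarrow> ext_integral (\<mu> \<Otimes>\<^sub>M \<nu>) G"
    if \<phi>: "\<And>k. continuous_on UNIV (\<phi> k)" "\<And>k p. - K \<le> \<phi> k p"
    "\<And>k p. \<phi> k p \<le> \<phi> (Suc k) p" "\<And>p. (\<lambda>k. ereal (\<phi> k p)) \<longlonglongrightarrow> G p"
    and \<mu>: "\<mu> \<in> prob_measures" "\<nu> \<in> prob_measures" for \<phi> \<mu> \<nu>
  proof -
    have meas: "G \<in> borel_measurable (\<mu> \<Otimes>\<^sub>M \<nu>)"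
      using borel_measurable_pair_lower_semicontinuous[OF compact lsc] sets_pair_prob_measures[OF \<mu>]
      by (simp cong: measurable_cong_sets)
    have "(\<lambda>k. ereal (\<integral>p. \<phi> k p \<partial>(\<mu> \<Otimes>\<^sub>M \<nu>))) \<longlonglongrightarrow> ext_integral (\<mu> \<Otimes>\<^sub>M \<nu>) G"
      by (rule ext_integral_LIMSEQ[OF prob_space_pair[OF prob_measuresD(1)[OF \<mu>(1)] prob_measuresD(1)[OF \<mu>(2)]] meas])
        (auto intro!: integrable_pair_continuous compact \<phi> \<mu> K)
    then show ?thesis
      by (simp add: integral_pair_continuous[OF compact \<phi>(1) \<mu>])
  qed
  show ?thesis
  proof (cases "\<forall>x y. G (x, y) = G (y, x)")
    case False
    have "?P \<psi>"
      using \<psi> lim[of \<psi>] False by blast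
    then show ?thesis
      by (rule exI[of ?P \<psi>])
  next
    case True
    define \<phi> where "\<phi> k p = min (\<psi> k p) (\<psi> k (prod.swap p))" for k p
    have swap: "G (prod.swap p) = G p" for p
      using True by (cases p) simp
    have \<phi>: "continuous_on UNIV (\<phi> k)" for k
      unfolding \<phi>_def
      by (intro continuous_on_min \<psi>(1) continuous_on_compose2[OF \<psi>(1)]) (auto intro: continuous_on_swap)
    have "ereal (\<phi> k p) \<le> G p" for k p
      using \<psi>(4)[of k p] unfolding \<phi>_def ereal_min by (simp add: min.coboundedI1)
    moreover have "(\<lambda>k. ereal (\<phi> k p)) \<longlonglongrightarrow> G p" for p
    proof -
      have "(\<lambda>k. min (ereal (\<psi> k p)) (ereal (\<psi> k (prod.swap p)))) \<longlonglongrightarrow> min (G p) (G (prod.swap p))"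
        by (intro tendsto_min \<psi>(5))
      then show ?thesis
        by (simp add: \<phi>_def swap ereal_min)
    qed
    moreover have "\<phi> k p \<le> \<phi> (Suc k) p" for k p
      unfolding \<phi>_def by (intro min.mono \<psi>(3))
    moreover have "- K \<le> \<phi> k p" for k p
      unfolding \<phi>_def by (intro min.boundedI \<psi>(2))
    moreover have "\<phi> k (x, y) = \<phi> k (y, x)" for k x y
      by (simp add: \<phi>_def min.commute)
    ultimately have "?P \<phi>"
      using \<phi> lim[of \<phi>] by blast
    then show ?thesis
      by (rule exI[of ?P \<phi>])
  qed
qed

lemma sum_pairs_Suc:
  fixes g :: "nat \<times> nat \<Rightarrow> 'b::comm_monoid_add"
  shows "(\<Sum>p \<in> {(i, j). i < j \<and> j < Suc n}. g p) = (\<Sum>p \<in> {(i, j). i < j \<and> j < n}. g p) + (\<Sum>i<n. g (i, n))"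
proof -
  have "finite {(i, j). i < j \<and> j < n}"
    by (rule finite_subset[of _ "{..<n} \<times> {..<n}"]) auto
  moreover have "{(i, j). i < j \<and> j < Suc n} = {(i, j). i < j \<and> j < n} \<union> (\<lambda>i. (i, n)) ` {..<n}"
    by auto
  ultimately have "(\<Sum>p \<in> {(i, j). i < j \<and> j < Suc n}. g p) =
      (\<Sum>p \<in> {(i, j). i < j \<and> j < n}. g p) + (\<Sum>p \<in> (\<lambda>i. (i, n)) ` {..<n}. g p)"
    by (simp only:) (rule sum.union_disjoint, auto)
  then show ?thesis
    by (simp add: sum.reindex inj_on_def)
qed

text \<open>The full double sum counts each unordered pair twice and each diagonal term once. This
  is where the diagonal correction originates.\<close>

lemma sum_pairs_symmetric:
  fixes g :: "nat \<Rightarrow> nat \<Rightarrow> real"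
  assumes "\<And>i j. g i j = g j i"
  shows "(\<Sum>(i, j) \<in> {(i, j). i < j \<and> j < n}. g i j) = ((\<Sum>i<n. \<Sum>j<n. g i j) - (\<Sum>i<n. g i i)) / 2"
proof (induction n)
  case (Suc n)
  have "(\<Sum>i<Suc n. \<Sum>j<Suc n. g i j) = (\<Sum>i<n. \<Sum>j<n. g i j) + (\<Sum>i<n. g i n) + (\<Sum>i<n. g n i) + g n n"
    by (simp add: sum.distrib)
  also have "(\<Sum>i<n. g n i) = (\<Sum>i<n. g i n)"
    using assms by simp
  finally show ?case
    using Suc by (simp add: sum_pairs_Suc field_simps)
qed simp

text \<open>Used with the identity for f, and with the constant map to \<nu> or the identity for g,
  to make the two parts of the kernel energy weakly continuous.\<close>

lemma continuous_map_integral_pair: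
  fixes \<phi> :: "'a::metric_space \<times> 'a \<Rightarrow> real" and f g :: "'a measure \<Rightarrow> 'a measure"
  assumes "compact (UNIV :: 'a set)" and "continuous_on UNIV \<phi>"
    and "continuous_map weak_topology weak_topology f" "continuous_map weak_topology weak_topology g"
  shows "continuous_map weak_topology euclideanreal (\<lambda>\<mu>. \<integral>x. \<integral>y. \<phi> (x, y) \<partial>g \<mu> \<partial>f \<mu>)"
  unfolding continuous_map_atin limitin_canonical_iff
proof
  fix \<mu> :: "'a measure" assume "\<mu> \<in> topspace weak_topology"
  then have "limitin weak_topology f (f \<mu>) (atin weak_topology \<mu>)" "limitin weak_topology g (g \<mu>) (atin weak_topology \<mu>)"
    using assms(3,4) unfolding continuous_map_atin by blast+
  then show "((\<lambda>\<mu>. \<integral>x. \<integral>y. \<phi> (x, y) \<partial>g \<mu> \<partial>f \<mu>) \<longlongrightarrow> (\<integral>x. \<integral>y. \<phi> (x, y) \<partial>g \<mu> \<partial>f \<mu>)) (atin weak_topology \<mu>)"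
    by (rule tendsto_integral_pair[OF assms(1,2)])
qed

section \<open>Two-body energies: lower bounds, measurability and (A1)\<close>

locale two_body =
  fixes \<nu> :: "'a::metric_space measure"
    and \<nu>s :: "nat \<Rightarrow> 'a measure"
    and GE GI :: "'a \<times> 'a \<Rightarrow> ereal"
  assumes compact: "compact (UNIV :: 'a set)"
    and \<nu>s: "\<And>n. n \<ge> 1 \<Longrightarrow> \<nu>s n \<in> prob_measures"
    and \<nu>: "\<nu> \<in> prob_measures"
    and \<nu>s_lim: "limitin weak_topology \<nu>s \<nu> sequentially"
    and GE_range: "\<And>p. GE p \<noteq> -\<infinity>"
    and GE_lsc: "lower_semicontinuous GE"
    and GI_range: "\<And>p. GI p \<noteq> -\<infinity>"
    and GI_lsc: "lower_semicontinuous GI"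
    and GI_sym: "\<And>x y. GI (x, y) = GI (y, x)"
begin

abbreviation "Wn \<equiv> n_body_energy GE GI \<nu>s"
abbreviation "W \<equiv> macroscopic_energy GE GI \<nu>"
abbreviation kernel_energy :: "('a \<times> 'a \<Rightarrow> real) \<Rightarrow> ('a \<times> 'a \<Rightarrow> real) \<Rightarrow> 'a measure \<Rightarrow> real" where
  "kernel_energy \<phi> \<psi> \<mu> \<equiv> (\<integral>x. \<integral>y. \<phi> (x, y) \<partial>\<nu> \<partial>\<mu>) + (\<integral>x. \<integral>y. \<psi> (x, y) \<partial>\<mu> \<partial>\<mu>) / 2"

text \<open>One constant for both kernels, so that all energies share their lower bounds; its
  existence is shown next, as the maximum of the two separate bounds.\<close>

definition lower_bound :: real where
  "lower_bound = (SOME K. 0 \<le> K \<and> (\<forall>p. ereal (- K) \<le> GE p) \<and> (\<forall>p. ereal (- K) \<le> GI p))"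

lemma lower_bound: "0 \<le> lower_bound" "ereal (- lower_bound) \<le> GE p" "ereal (- lower_bound) \<le> GI p"
proof -
  obtain K where K: "0 \<le> K" "\<And>p. ereal (- K) \<le> GE p"
    using lower_semicontinuous_bounded_below[OF compact_UNIV_pair[OF compact] GE_lsc GE_range] by metis
  obtain L where L: "0 \<le> L" "\<And>p. ereal (- L) \<le> GI p"
    using lower_semicontinuous_bounded_below[OF compact_UNIV_pair[OF compact] GI_lsc GI_range] by metis
  have "ereal (- max K L) \<le> GE p" "ereal (- max K L) \<le> GI p" for p
    using K(2)[of p] L(2)[of p] by (auto elim!: order_trans[rotated])
  then have "0 \<le> max K L \<and> (\<forall>p. ereal (- max K L) \<le> GE p) \<and> (\<forall>p. ereal (- max K L) \<le> GI p)"
    using K(1) by (simp add: max.coboundedI1)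
  from someI[of "\<lambda>K. 0 \<le> K \<and> (\<forall>p. ereal (- K) \<le> GE p) \<and> (\<forall>p. ereal (- K) \<le> GI p)", OF this]
  show "0 \<le> lower_bound" "ereal (- lower_bound) \<le> GE p" "ereal (- lower_bound) \<le> GI p"
    unfolding lower_bound_def by blast+
qed

lemma field_potential_ge:
  assumes "n \<ge> 1"
  shows "ereal (- lower_bound) \<le> field_potential GE \<nu>s n x"
  unfolding field_potential_def
  by (intro ext_integral_ge prob_measuresD \<nu>s assms lower_bound)

text \<open>The average of the field and the pair sum contribute one \<open>lower_bound\<close>
  each; for the pairs, the crude count of at most $n^2$ cancels the prefactor.\<close>

lemma n_body_energy_ge:
  assumes "n \<ge> 1"
  shows "ereal (- 2 * lower_bound) \<le> Wn n x"
proof -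
  have "ereal (- lower_bound) = ereal (1 / n) * (\<Sum>i<n. ereal (- lower_bound))"
    using assms by simp
  also have "\<dots> \<le> ereal (1 / n) * (\<Sum>i<n. field_potential GE \<nu>s n (x i))"
    by (intro ereal_mult_left_mono sum_mono field_potential_ge assms) simp
  finally have 1: "ereal (- lower_bound) \<le> ereal (1 / n) * (\<Sum>i<n. field_potential GE \<nu>s n (x i))" .
  have "real (card {(i, j). i < j \<and> j < n}) \<le> real (card ({..<n} \<times> {..<n}))"
    by (intro of_nat_mono card_mono) auto
  then have "real (card {(i, j). i < j \<and> j < n}) * lower_bound \<le> (real n)\<^sup>2 * lower_bound"
    by (intro mult_right_mono lower_bound) (simp add: power2_eq_square)
  then have "ereal (- lower_bound) \<le> ereal (1 / (real n)\<^sup>2) * (\<Sum>(i, j) \<in> {(i, j). i < j \<and> j < n}. ereal (- lower_bound))"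
    using assms by (simp add: split_def field_simps)
  also have "\<dots> \<le> ereal (1 / (real n)\<^sup>2) * (\<Sum>(i, j) \<in> {(i, j). i < j \<and> j < n}. GI (x i, x j))"
    by (intro ereal_mult_left_mono sum_mono) (auto simp: lower_bound simp del: uminus_ereal.simps)
  finally show ?thesis
    unfolding n_body_energy_def using add_mono[OF 1] by force
qed

lemma external_energy_ge: "\<mu> \<in> prob_measures \<Longrightarrow> ereal (- lower_bound) \<le> external_energy GE \<nu> \<mu>"
  unfolding external_energy_def
  by (intro ext_integral_ge prob_space_pair prob_measuresD \<nu> lower_bound)

lemma interaction_energy_ge: "\<mu> \<in> prob_measures \<Longrightarrow> ereal (- lower_bound) \<le> interaction_energy GI \<mu>"
proof -
  assume "\<mu> \<in> prob_measures"
  then have "ereal (- lower_bound) \<le> ext_integral (\<mu> \<Otimes>\<^sub>M \<mu>) GI"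
    by (intro ext_integral_ge prob_space_pair prob_measuresD lower_bound)
  then have "ereal (1 / 2) * ereal (- lower_bound) \<le> interaction_energy GI \<mu>"
    unfolding interaction_energy_def by (intro ereal_mult_left_mono) auto
  moreover have "ereal (- lower_bound) \<le> ereal (1 / 2) * ereal (- lower_bound)"
    using lower_bound(1) by simp
  ultimately show ?thesis
    by (rule order_trans[rotated])
qed

lemma macroscopic_energy_ge: "\<mu> \<in> prob_measures \<Longrightarrow> ereal (- 2 * lower_bound) \<le> W \<mu>"
  using add_mono[OF external_energy_ge interaction_energy_ge, of \<mu> \<mu>]
  by (simp add: macroscopic_energy_def)

text \<open>A common source for measurability of W and for (A1). Symmetry of the interaction
  minorants is retained because the sum over i < j must be compared with a double integral.\<close>

lemma macroscopic_energy_approx: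
  obtains \<phi> \<psi> :: "nat \<Rightarrow> 'a \<times> 'a \<Rightarrow> real"
  where "\<And>k. continuous_on UNIV (\<phi> k)" "\<And>k p. ereal (\<phi> k p) \<le> GE p"
    "\<And>k. continuous_on UNIV (\<psi> k)" "\<And>k p. ereal (\<psi> k p) \<le> GI p" "\<And>k x y. \<psi> k (x, y) = \<psi> k (y, x)"
    "\<And>\<mu>. \<mu> \<in> prob_measures \<Longrightarrow>
      (\<lambda>k. ereal (kernel_energy (\<phi> k) (\<psi> k) \<mu>)) \<longlonglongrightarrow> W \<mu>"
proof -
  obtain \<phi> where \<phi>: "\<And>k. continuous_on UNIV (\<phi> k)" "\<And>k p. ereal (\<phi> k p) \<le> GE p"
    "\<And>\<mu> \<nu>. \<mu> \<in> prob_measures \<Longrightarrow> \<nu> \<in> prob_measures \<Longrightarrow>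
      (\<lambda>k. ereal (\<integral>x. \<integral>y. \<phi> k (x, y) \<partial>\<nu> \<partial>\<mu>)) \<longlonglongrightarrow> ext_integral (\<mu> \<Otimes>\<^sub>M \<nu>) GE"
    using pair_energy_approx[OF compact GE_lsc GE_range] by blast
  obtain \<psi> where \<psi>: "\<And>k. continuous_on UNIV (\<psi> k)" "\<And>k p. ereal (\<psi> k p) \<le> GI p"
    "\<And>\<mu> \<nu>. \<mu> \<in> prob_measures \<Longrightarrow> \<nu> \<in> prob_measures \<Longrightarrow>
      (\<lambda>k. ereal (\<integral>x. \<integral>y. \<psi> k (x, y) \<partial>\<nu> \<partial>\<mu>)) \<longlonglongrightarrow> ext_integral (\<mu> \<Otimes>\<^sub>M \<nu>) GI"
    "\<And>k x y. \<psi> k (x, y) = \<psi> k (y, x)"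
    using pair_energy_approx[OF compact GI_lsc GI_range] GI_sym by blast
  have "(\<lambda>k. ereal (kernel_energy (\<phi> k) (\<psi> k) \<mu>)) \<longlonglongrightarrow> W \<mu>"
    if \<mu>: "\<mu> \<in> prob_measures" for \<mu>
  proof -
    have "(\<lambda>k. ereal (1 / 2) * ereal (\<integral>x. \<integral>y. \<psi> k (x, y) \<partial>\<mu> \<partial>\<mu>)) \<longlonglongrightarrow> interaction_energy GI \<mu>"
      unfolding interaction_energy_def by (intro tendsto_cmult_ereal \<psi>(3) \<mu>) simp
    \<comment> \<open>Excludes \<infinity> - \<infinity> when the two limits are added.\<close>
    moreover have "external_energy GE \<nu> \<mu> \<noteq> -\<infinity>" "interaction_energy GI \<mu> \<noteq> -\<infinity>"
      using external_energy_ge[OF \<mu>] interaction_energy_ge[OF \<mu>] by auto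
    ultimately have "(\<lambda>k. ereal (\<integral>x. \<integral>y. \<phi> k (x, y) \<partial>\<nu> \<partial>\<mu>) + ereal (1 / 2) * ereal (\<integral>x. \<integral>y. \<psi> k (x, y) \<partial>\<mu> \<partial>\<mu>))
        \<longlonglongrightarrow> W \<mu>"
      unfolding macroscopic_energy_def
      by (intro tendsto_add_ereal_general) (auto simp: external_energy_def intro!: \<phi>(3) \<mu> \<nu>)
    then show ?thesis
      by simp
  qed
  with \<phi> \<psi> show thesis
    by (intro that[of \<phi> \<psi>]) auto
qed

text \<open>W is a pointwise limit of weakly continuous kernel energies.\<close>

lemma borel_measurable_macroscopic_energy: "W \<in> borel_measurable weak_borel"
proof -
  obtain \<phi> \<psi> :: "nat \<Rightarrow> 'a \<times> 'a \<Rightarrow> real"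
    where \<phi>: "\<And>k. continuous_on UNIV (\<phi> k)" "\<And>k. continuous_on UNIV (\<psi> k)"
    "\<And>\<mu>. \<mu> \<in> prob_measures \<Longrightarrow>
      (\<lambda>k. ereal (kernel_energy (\<phi> k) (\<psi> k) \<mu>)) \<longlonglongrightarrow> W \<mu>"
    by (rule macroscopic_energy_approx) blast
  have "continuous_map weak_topology weak_topology (\<lambda>\<mu>. \<nu>)"
    using \<nu> by (simp add: topspace_weak_topology)
  then have [measurable]: "(\<lambda>\<mu>. \<integral>x. \<integral>y. \<phi> k (x, y) \<partial>\<nu> \<partial>\<mu>) \<in> borel_measurable weak_borel"
      "(\<lambda>\<mu>. \<integral>x. \<integral>y. \<psi> k (x, y) \<partial>\<mu> \<partial>\<mu>) \<in> borel_measurable weak_borel" for k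
    using continuous_map_integral_pair[OF compact \<phi>(1), of "\<lambda>\<mu>. \<mu>" "\<lambda>_. \<nu>"]
      continuous_map_integral_pair[OF compact \<phi>(2), of "\<lambda>\<mu>. \<mu>" "\<lambda>\<mu>. \<mu>"]
    by (auto intro!: borel_measurable_weak_continuous)
  show ?thesis
    by (rule borel_measurable_LIMSEQ_order[OF \<phi>(3)]) (simp_all add: space_weak_borel)
qed

text \<open>A level k is fixed at which the kernel energy of \<mu> already exceeds y. Both kernels
  are then replaced by their minorants at that level, whose energy at the empirical measure
  converges along F; only the diagonal has to be subtracted.\<close>

lemma n_body_energy_liminf:
  assumes F: "F \<le> sequentially" and lim: "limitin weak_topology (\<lambda>n. empirical n (x n)) \<mu> F"
    and y: "y < W \<mu>"
  shows "\<forall>\<^sub>F n in F. y < Wn n (x n)"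
proof -
  have \<mu>: "\<mu> \<in> prob_measures"
    using lim by (simp add: limitin_weak_topology)
  obtain \<phi> \<psi> :: "nat \<Rightarrow> 'a \<times> 'a \<Rightarrow> real"
    where \<phi>: "\<And>k. continuous_on UNIV (\<phi> k)" "\<And>k p. ereal (\<phi> k p) \<le> GE p"
    "\<And>k. continuous_on UNIV (\<psi> k)" "\<And>k p. ereal (\<psi> k p) \<le> GI p" "\<And>k x y. \<psi> k (x, y) = \<psi> k (y, x)"
    "\<And>\<mu>. \<mu> \<in> prob_measures \<Longrightarrow>
      (\<lambda>k. ereal (kernel_energy (\<phi> k) (\<psi> k) \<mu>)) \<longlonglongrightarrow> W \<mu>"
    by (rule macroscopic_energy_approx) blast
  have "\<forall>\<^sub>F k in sequentially. y < ereal (kernel_energy (\<phi> k) (\<psi> k) \<mu>)"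
    using order_tendstoD(1)[OF \<phi>(6)[OF \<mu>] y] .
  then obtain k where k: "y < ereal (kernel_energy (\<phi> k) (\<psi> k) \<mu>)"
    using eventually_happens'[OF sequentially_bot] by blast
  obtain B where B: "\<And>p. \<bar>\<psi> k p\<bar> \<le> B"
    using bounded_range_continuous[OF compact_UNIV_pair[OF compact] \<phi>(3)[of k]] unfolding bounded_iff by auto
  define e where "e n = empirical n (x n)" for n
  \<comment> \<open>Kernel energy of the empirical measure, with the field taken against
    \<open>\<nu>s n\<close>, less a bound for the diagonal: half of n terms, each at most B, divided
    by $n^2$.\<close>
  define L where "L n = (\<integral>a. \<integral>b. \<phi> k (a, b) \<partial>\<nu>s n \<partial>e n) + (\<integral>a. \<integral>b. \<psi> k (a, b) \<partial>e n \<partial>e n) / 2 - B / 2 * (1 / n)"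
    for n :: nat
  have "(L \<longlongrightarrow> kernel_energy (\<phi> k) (\<psi> k) \<mu> - B / 2 * 0) F"
    unfolding L_def e_def
    by (intro tendsto_intros tendsto_integral_pair compact \<phi> lim)
       (auto intro: filterlim_mono[OF _ order_refl F] lim_1_over_n simp: limitin_def,
        use \<nu>s_lim F in \<open>auto simp: limitin_def le_filter_def\<close>)
  then have "((\<lambda>n. ereal (L n)) \<longlongrightarrow> ereal (kernel_energy (\<phi> k) (\<psi> k) \<mu>)) F"
    by simp
  then have "\<forall>\<^sub>F n in F. y < ereal (L n)"
    using k by (rule order_tendstoD)
  moreover have "\<forall>\<^sub>F n in F. n \<ge> 1"
    using F eventually_ge_at_top[of "1::nat"] by (simp add: le_filter_def)
  ultimately show ?thesis
  proof eventually_elim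
    case (elim n)
    have n: "n \<ge> 1"
      by (rule elim)
    have \<nu>n: "\<nu>s n \<in> prob_measures"
      by (rule \<nu>s[OF n])
    have e: "e n \<in> prob_measures"
      unfolding e_def by (rule empirical_in_prob_measures[OF n])
    have meas: "(\<lambda>a. \<integral>b. \<rho> (a, b) \<partial>\<tau>) \<in> borel_measurable borel"
      if "continuous_on UNIV \<rho>" "\<tau> \<in> prob_measures" for \<rho> :: "'a \<times> 'a \<Rightarrow> real" and \<tau>
      by (intro borel_measurable_continuous_onI continuous_on_integral_pair compact that)
    have I1: "(\<integral>a. \<integral>b. \<phi> k (a, b) \<partial>\<nu>s n \<partial>e n) = (\<Sum>i<n. \<integral>b. \<phi> k (x n i, b) \<partial>\<nu>s n) / n"
      unfolding e_def by (rule integral_empirical[OF n meas[OF \<phi>(1) \<nu>n]])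
    have "(\<integral>a. \<integral>b. \<psi> k (a, b) \<partial>e n \<partial>e n) = (\<Sum>i<n. \<integral>b. \<psi> k (x n i, b) \<partial>e n) / n"
      using integral_empirical[OF n meas[OF \<phi>(3)[of k] e], of "x n"] by (simp add: e_def)
    also have "\<dots> = (\<Sum>i<n. (\<Sum>j<n. \<psi> k (x n i, x n j)) / n) / n"
      unfolding e_def
      by (intro arg_cong2[where f = "(/)"] sum.cong refl integral_empirical n borel_measurable_continuous_onI
          continuous_on_Pair_left \<phi>)
    finally have I2: "(\<integral>a. \<integral>b. \<psi> k (a, b) \<partial>e n \<partial>e n) = (\<Sum>i<n. \<Sum>j<n. \<psi> k (x n i, x n j)) / (real n)\<^sup>2"
      by (simp add: sum_divide_distrib power2_eq_square)
    have "(\<Sum>i<n. \<psi> k (x n i, x n i)) \<le> (\<Sum>i<n. B)"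
      by (intro sum_mono) (use B in \<open>simp add: abs_le_iff\<close>)
    then have diag: "(\<Sum>i<n. \<psi> k (x n i, x n i)) / (real n)\<^sup>2 \<le> B * (1 / n)"
      using n by (simp add: power2_eq_square field_simps)
    have "(\<Sum>(i, j) \<in> {(i, j). i < j \<and> j < n}. \<psi> k (x n i, x n j)) =
        ((\<Sum>i<n. \<Sum>j<n. \<psi> k (x n i, x n j)) - (\<Sum>i<n. \<psi> k (x n i, x n i))) / 2"
      by (rule sum_pairs_symmetric) (rule \<phi>)
    then have "L n \<le> (1 / n) * (\<Sum>i<n. \<integral>b. \<phi> k (x n i, b) \<partial>\<nu>s n) +
        (1 / (real n)\<^sup>2) * (\<Sum>(i, j) \<in> {(i, j). i < j \<and> j < n}. \<psi> k (x n i, x n j))"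
      using diag by (simp add: L_def I1 I2 diff_divide_distrib)
    then have "ereal (L n) \<le> ereal (1 / n) * (\<Sum>i<n. ereal (\<integral>b. \<phi> k (x n i, b) \<partial>\<nu>s n)) +
        ereal (1 / (real n)\<^sup>2) * (\<Sum>(i, j) \<in> {(i, j). i < j \<and> j < n}. ereal (\<psi> k (x n i, x n j)))"
      by (simp add: split_def)
    also have "\<dots> \<le> Wn n (x n)"
      unfolding n_body_energy_def
    proof (intro add_mono ereal_mult_left_mono sum_mono)
      fix i
      have "ereal (\<integral>b. \<phi> k (x n i, b) \<partial>\<nu>s n) = ext_integral (\<nu>s n) (\<lambda>b. ereal (\<phi> k (x n i, b)))"
        by (intro ext_integral_real[symmetric] integrable_continuous compact continuous_on_Pair_left \<phi> \<nu>n)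
      also have "\<dots> \<le> field_potential GE \<nu>s n (x n i)"
        unfolding field_potential_def by (intro ext_integral_mono \<phi>)
      finally show "ereal (\<integral>b. \<phi> k (x n i, b) \<partial>\<nu>s n) \<le> field_potential GE \<nu>s n (x n i)" .
    qed (auto simp: \<phi>)
    finally show ?case
      using elim(1) by (rule less_le_trans[rotated])
  qed
qed

end

section \<open>Weak sequential compactness\<close>

text \<open>
  A compact metric space is coded into the reals by a Borel injection whose inverse is uniformly
  continuous; Helly's selection theorem then yields weak sequential compactness.
\<close>

lemma compact_real_code:
  assumes "compact (UNIV :: 'a::metric_space set)"
  obtains h :: "'a::metric_space \<Rightarrow> real" where "h \<in> borel_measurable borel" "\<And>x. 0 \<le> h x" "\<And>x. h x \<le> 2"
    "\<And>e. 0 < e \<Longrightarrow> \<exists>d>0. \<forall>x y. \<bar>h x - h y\<bar> < d \<longrightarrow> dist x y < e"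
proof -
  obtain B :: "nat \<Rightarrow> 'a set" where B: "\<And>k. open (B k)"
      "\<And>U x. open U \<Longrightarrow> x \<in> U \<Longrightarrow> \<exists>k. x \<in> B k \<and> B k \<subseteq> U"
    using compact_countable_base[OF assms(1)] by blast
  \<comment> \<open>The code has ternary expansion with digits 0 and 1, where digit k records
    membership in \<open>B k\<close>. In base 3 with these digits, all later digits together weigh
    at most half of one digit, so close codes have equal leading digits.\<close>
  define c where "c k x = indicator (B k) x * (1 / 3 :: real) ^ k" for k x
  define h where "h x = (\<Sum>k. c k x)" for x
  have c: "0 \<le> c k x" "c k x \<le> (1 / 3) ^ k" for k x
    by (auto simp: c_def indicator_def)
  have geo: "summable (\<lambda>k. (1 / 3 :: real) ^ k)"
    by (intro summable_geometric) simp
  have summ: "summable (\<lambda>k. c k x)" for x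
    by (rule summable_comparison_test'[OF geo]) (simp add: c)
  \<comment> \<open>The factor 3 / 2 is the sum of the geometric series with ratio 1 / 3; at k + 1
    the bound is half of the weight of digit k, and at 0 it gives h \<le> 2.\<close>
  have tail: "0 \<le> (\<Sum>j. c (j + k) x)" "(\<Sum>j. c (j + k) x) \<le> (1 / 3) ^ k * (3 / 2)" for k x
  proof -
    have s: "summable (\<lambda>j. c (j + k) x)"
      by (rule summable_ignore_initial_segment[OF summ])
    then show "0 \<le> (\<Sum>j. c (j + k) x)"
      by (intro suminf_nonneg c)
    have "(\<Sum>j. c (j + k) x) \<le> (\<Sum>j. (1 / 3 :: real) ^ k * (1 / 3) ^ j)"
      by (intro suminf_le s summable_mult geo) (metis c(2) add.commute power_add)
    also have "\<dots> = (1 / 3) ^ k * (3 / 2)"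
      using geo by (simp add: suminf_mult suminf_geometric)
    finally show "(\<Sum>j. c (j + k) x) \<le> (1 / 3) ^ k * (3 / 2)" .
  qed
  \<comment> \<open>If all digits before k agree and digit k differs, the tails can undo at most
    half of its weight, so the codes are at least half that weight apart. Strong induction supplies
    the agreement of the earlier digits.\<close>
  have digits: "x \<in> B k \<longleftrightarrow> y \<in> B k" if "\<bar>h x - h y\<bar> < (1 / 3) ^ N / 2" "k \<le> N" for x y k N
    using that(2)
  proof (induction k rule: less_induct)
    case (less k)
    have split: "h z = (\<Sum>j. c (j + Suc k) z) + c k z + (\<Sum>j<k. c j z)" for z
      unfolding h_def using suminf_split_initial_segment[OF summ, of z "Suc k"] by simp
    have "(\<Sum>j<k. c j x) = (\<Sum>j<k. c j y)"
      using less by (intro sum.cong) (auto simp: c_def indicator_def)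
    then have "\<bar>c k x - c k y\<bar> \<le> \<bar>h x - h y\<bar> + \<bar>(\<Sum>j. c (j + Suc k) x) - (\<Sum>j. c (j + Suc k) y)\<bar>"
      using split[of x] split[of y] by linarith
    also have "\<bar>(\<Sum>j. c (j + Suc k) x) - (\<Sum>j. c (j + Suc k) y)\<bar> \<le> (1 / 3) ^ k / 2"
      using tail[where k = "Suc k" and x = x] tail[where k = "Suc k" and x = y] unfolding power_Suc by linarith
    also have "\<bar>h x - h y\<bar> < (1 / 3) ^ k / 2"
    proof -
      have "(1 / 3 :: real) ^ N \<le> (1 / 3) ^ k"
        using less by (intro power_decreasing) auto
      then show ?thesis
        using that(1) by linarith
    qed
    finally have "\<bar>c k x - c k y\<bar> < (1 / 3) ^ k"
      by simp
    then show ?case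
      by (cases "x \<in> B k"; cases "y \<in> B k") (auto simp: c_def)
  qed
  show thesis
  proof (rule that[of h])
    have "(\<lambda>x. c k x) \<in> borel_measurable borel" for k
      unfolding c_def using B(1) by (intro borel_measurable_times borel_measurable_indicator) auto
    then show "h \<in> borel_measurable borel"
      unfolding h_def[abs_def] by (rule borel_measurable_suminf)
    show "0 \<le> h x" "h x \<le> 2" for x
      using tail[where k = 0 and x = x] by (simp_all add: h_def)
    fix e :: real assume "0 < e"
    \<comment> \<open>Indices of base sets in which any two points have distance below e. Finitely
      many of them cover M, and agreement of the digits up to the largest of these indices puts x
      and y into a common one.\<close>
    define C where "C = {k. \<forall>x\<in>B k. \<forall>y\<in>B k. dist x y < e}"
    have cover: "(UNIV :: 'a set) \<subseteq> (\<Union>k\<in>C. B k)"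
    proof
      fix z :: 'a
      obtain k where k: "z \<in> B k" "B k \<subseteq> ball z (e / 2)"
        using B(2)[of "ball z (e / 2)" z] \<open>0 < e\<close> by auto
      have "dist x y < e" if "x \<in> B k" "y \<in> B k" for x y
      proof -
        have "dist z x < e / 2" "dist z y < e / 2"
          using that k by auto
        then show ?thesis
          using dist_triangle[of x y z] by (simp add: dist_commute)
      qed
      then show "z \<in> (\<Union>k\<in>C. B k)"
        using k by (auto simp: C_def)
    qed
    have "\<exists>D\<subseteq>C. finite D \<and> (UNIV :: 'a set) \<subseteq> (\<Union>k\<in>D. B k)"
      using compactE_image[OF assms B(1) cover] by metis
    then obtain D where D: "D \<subseteq> C" "finite D" "(UNIV :: 'a set) \<subseteq> (\<Union>k\<in>D. B k)"
      by blast
    show "\<exists>d>0. \<forall>x y. \<bar>h x - h y\<bar> < d \<longrightarrow> dist x y < e"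
    proof (intro exI[of _ "(1 / 3) ^ Max D / 2"] conjI allI impI)
      fix x y assume xy: "\<bar>h x - h y\<bar> < (1 / 3) ^ Max D / 2"
      obtain k where k: "k \<in> D" "x \<in> B k"
        using D(3) by blast
      then have "y \<in> B k"
        using digits[OF xy] Max_ge[OF D(2)] by blast
      then show "dist x y < e"
        using k D(1) by (auto simp: C_def)
    qed simp
  qed
qed

text \<open>Since h is only Borel, its range need not be closed, and a weak limit of coded measures
  may charge the rest of the closure; hence the inverse is extended there. Compactness of M yields a
  candidate value from any approximating sequence, and uniform continuity of the inverse makes it
  independent of the sequence.\<close>

lemma real_decode:
  fixes h :: "'a::metric_space \<Rightarrow> real"
  assumes compact: "compact (UNIV :: 'a set)"
    and h: "\<And>e. 0 < e \<Longrightarrow> \<exists>d>0. \<forall>x y. \<bar>h x - h y\<bar> < d \<longrightarrow> dist x y < e"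
  obtains p :: "real \<Rightarrow> 'a" where "p \<in> borel_measurable borel"
    "\<And>t xs. t \<in> closure (range h) \<Longrightarrow> (\<lambda>n::nat. h (xs n)) \<longlonglongrightarrow> t \<Longrightarrow> xs \<longlonglongrightarrow> p t"
proof -
  let ?K = "closure (range h)"
  have "\<exists>z. \<forall>e>0. \<exists>d>0. \<forall>x. \<bar>h x - t\<bar> < d \<longrightarrow> dist x z < e" if t: "t \<in> ?K" for t
  proof -
    obtain ts where ts: "\<And>n::nat. ts n \<in> range h" "ts \<longlonglongrightarrow> t"
      using t unfolding closure_sequential by blast
    have "\<forall>n. \<exists>x. ts n = h x"
      using ts(1) by blast
    then obtain xs where xs: "\<And>n. ts n = h (xs n)"
      by metis
    obtain z s where s: "strict_mono (s :: nat \<Rightarrow> nat)" "(xs \<circ> s) \<longlonglongrightarrow> z"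
      using compact[unfolded compact_def, rule_format, of xs] by blast
    have lim: "(\<lambda>n. h (xs (s n))) \<longlonglongrightarrow> t"
      using LIMSEQ_subseq_LIMSEQ[OF ts(2) s(1)] by (simp add: o_def xs)
    show ?thesis
    proof (intro exI[of _ z] allI impI)
      fix e :: real assume "0 < e"
      then obtain d where d: "0 < d" "\<And>x y. \<bar>h x - h y\<bar> < d \<Longrightarrow> dist x y < e / 2"
        using h[of "e / 2"] by auto
      have "\<forall>\<^sub>F n in sequentially. dist (h (xs (s n))) t < d / 2"
        using lim d(1) by (intro tendstoD) simp_all
      moreover have "\<forall>\<^sub>F n in sequentially. dist ((xs \<circ> s) n) z < e / 2"
        using tendstoD[OF s(2), of "e / 2"] \<open>0 < e\<close> by simp
      ultimately have "\<forall>\<^sub>F n in sequentially. dist (h (xs (s n))) t < d / 2 \<and> dist ((xs \<circ> s) n) z < e / 2"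
        by (rule eventually_conj)
      then obtain n where n: "dist (h (xs (s n))) t < d / 2" "dist (xs (s n)) z < e / 2"
        using eventually_happens'[OF sequentially_bot] by fastforce
      show "\<exists>d>0. \<forall>x. \<bar>h x - t\<bar> < d \<longrightarrow> dist x z < e"
      proof (intro exI[of _ "d / 2"] conjI allI impI)
        fix x assume "\<bar>h x - t\<bar> < d / 2"
        then have "\<bar>h x - h (xs (s n))\<bar> < d"
          using n(1) unfolding dist_real_def by linarith
        then show "dist x z < e"
          using d(2)[of x "xs (s n)"] n(2) dist_triangle[of x z "xs (s n)"] by simp
      qed (simp add: d)
    qed
  qed
  then obtain q where q: "\<And>t e. t \<in> ?K \<Longrightarrow> 0 < e \<Longrightarrow> \<exists>d>0. \<forall>x. \<bar>h x - t\<bar> < d \<longrightarrow> dist x (q t) < e"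
    by metis
  have cont: "continuous_on ?K q"
    unfolding continuous_on_iff
  proof (intro ballI allI impI)
    fix t and e :: real assume t: "t \<in> ?K" and "0 < e"
    then obtain d where d: "0 < d" "\<And>x. \<bar>h x - t\<bar> < d \<Longrightarrow> dist x (q t) < e / 2"
      using q[of t "e / 2"] by auto
    show "\<exists>d>0. \<forall>t'\<in>?K. dist t' t < d \<longrightarrow> dist (q t') (q t) < e"
    proof (intro exI[of _ "d / 2"] conjI ballI impI)
      fix t' assume t': "t' \<in> ?K" "dist t' t < d / 2"
      then obtain d' where d': "0 < d'" "\<And>x. \<bar>h x - t'\<bar> < d' \<Longrightarrow> dist x (q t') < e / 2"
        using q[of t' "e / 2"] \<open>0 < e\<close> by auto
      obtain x where x: "dist (h x) t' < min d' (d / 2)"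
        using t'(1) d(1) d'(1) unfolding closure_approachable by (metis half_gt_zero imageE min_less_iff_conj)
      have "\<bar>h x - t\<bar> < d"
        using x t'(2) unfolding dist_real_def by linarith
      moreover have "\<bar>h x - t'\<bar> < d'"
        using x unfolding dist_real_def by linarith
      ultimately show "dist (q t') (q t) < e"
        using d(2)[of x] d'(2)[of x] dist_triangle[of "q t'" "q t" x] by (simp add: dist_commute)
    qed (simp add: d)
  qed
  \<comment> \<open>The default off the closure only serves to make p total and Borel; the limit
    measure will be shown to have no mass there.\<close>
  define p where "p t = (if t \<in> ?K then q t else undefined)" for t
  show thesis
  proof (rule that[of p])
    show "p \<in> borel_measurable borel"
      unfolding p_def[abs_def]
      by (intro borel_measurable_continuous_on_if cont continuous_on_const) simp
    fix t :: real and xs :: "nat \<Rightarrow> 'a" assume t: "t \<in> ?K" and lim: "(\<lambda>n. h (xs n)) \<longlonglongrightarrow> t"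
    show "xs \<longlonglongrightarrow> p t"
    proof (rule tendstoI)
      fix e :: real assume "0 < e"
      obtain d where d: "0 < d" "\<And>x. \<bar>h x - t\<bar> < d \<Longrightarrow> dist x (q t) < e"
        using q[OF t \<open>0 < e\<close>] by auto
      have "\<forall>\<^sub>F n in sequentially. dist (h (xs n)) t < d"
        using lim d(1) by (rule tendstoD)
      then show "\<forall>\<^sub>F n in sequentially. dist (xs n) (p t) < e"
        by eventually_elim (use d(2) t in \<open>auto simp: p_def dist_real_def\<close>)
    qed
  qed
qed

text \<open>The coded measures live on [0, 2], so they are tight and Helly's theorem gives a limit m
  on the line, which is carried back to M by p. Test functions on M need not be continuous in the
  code variable a priori; the continuity of the inverse code provides this.\<close>

theorem prob_measures_sequentially_compact:
  fixes \<mu>s :: "nat \<Rightarrow> 'a::metric_space measure"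
  assumes compact: "compact (UNIV :: 'a set)" and \<mu>s: "\<And>n. \<mu>s n \<in> prob_measures"
  obtains r \<mu> where "strict_mono (r :: nat \<Rightarrow> nat)" "limitin weak_topology (\<mu>s \<circ> r) \<mu> sequentially"
proof -
  obtain h :: "'a \<Rightarrow> real" where h [measurable]: "h \<in> borel_measurable borel" and h_le: "\<And>x. 0 \<le> h x" "\<And>x. h x \<le> 2"
    and h_inv: "\<And>e. 0 < e \<Longrightarrow> \<exists>d>0. \<forall>x y. \<bar>h x - h y\<bar> < d \<longrightarrow> dist x y < e"
    using compact_real_code[OF compact] by blast
  obtain p :: "real \<Rightarrow> 'a" where p [measurable]: "p \<in> borel_measurable borel"
    and p_lim: "\<And>t xs. t \<in> closure (range h) \<Longrightarrow> (\<lambda>n::nat. h (xs n)) \<longlonglongrightarrow> t \<Longrightarrow> xs \<longlonglongrightarrow> p t"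
    using real_decode[OF compact h_inv] by blast
  let ?K = "closure (range h)"
  define \<rho>s where "\<rho>s n = distr (\<mu>s n) borel h" for n
  have hm: "h \<in> borel_measurable (\<mu>s n)" for n
    using h prob_measuresD(2)[OF \<mu>s] by (simp cong: measurable_cong_sets)
  have rd: "real_distribution (\<rho>s n)" for n
    unfolding \<rho>s_def real_distribution_def real_distribution_axioms_def
    by (simp add: prob_space.prob_space_distr[OF prob_measuresD(1)[OF \<mu>s] hm])
  have "tight \<rho>s"
    unfolding tight_def
  proof (intro conjI allI impI)
    fix e :: real assume "0 < e"
    \<comment> \<open>Tightness uses intervals open on the left, so the left endpoint lies strictly
      below the possible code 0.\<close>
    have "1 - e < measure (\<rho>s n) {- 1<..2}" for n
    proof -
      interpret prob_space "\<mu>s n"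
        by (intro prob_measuresD \<mu>s)
      have "- 1 < h x" for x
        using h_le(1)[of x] by linarith
      then have "h -` {- 1<..2} = UNIV"
        using h_le(2) by auto
      then have "measure (\<rho>s n) {- 1<..2} = 1"
        unfolding \<rho>s_def using prob_space prob_measuresD(3)[OF \<mu>s, of n] by (simp add: measure_distr[OF hm])
      then show ?thesis
        using \<open>0 < e\<close> by simp
    qed
    then show "\<exists>a b. a < b \<and> (\<forall>n. 1 - e < measure (\<rho>s n) {a<..b})"
      by (intro exI[of _ "- 1"] exI[of _ "2 :: real"]) simp
  qed (rule rd)
  from tight_imp_convergent_subsubsequence[OF this strict_mono_id]
  obtain r m where r: "strict_mono (r :: nat \<Rightarrow> nat)" and m: "real_distribution m" "weak_conv_m (\<rho>s \<circ> id \<circ> r) m"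
    by blast
  interpret m: real_distribution m
    by (rule m)
  have conv: "(\<lambda>n. \<integral>x. g (h x) \<partial>\<mu>s (r n)) \<longlonglongrightarrow> (\<integral>t. g t \<partial>m)"
    if g: "continuous_on UNIV g" "\<And>t. norm (g t) \<le> B" for g :: "real \<Rightarrow> real" and B
  proof -
    have "(\<lambda>n. \<integral>t. g t \<partial>\<rho>s (r n)) \<longlonglongrightarrow> (\<integral>t. g t \<partial>m)"
      using weak_conv_imp_integral_bdd_continuous_conv[of "\<rho>s \<circ> id \<circ> r" m g B] m rd g
      by (simp add: continuous_on_eq_continuous_at)
    moreover have "(\<integral>t. g t \<partial>\<rho>s (r n)) = (\<integral>x. g (h x) \<partial>\<mu>s (r n))" for n
      unfolding \<rho>s_def by (intro integral_distr hm borel_measurable_continuous_onI g)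
    ultimately show ?thesis
      by simp
  qed
  \<comment> \<open>The truncated distance to the closure is bounded, continuous and zero at every
    code, so its integral against the limit m vanishes too.\<close>
  have K: "AE t in m. t \<in> ?K"
  proof -
    let ?g = "\<lambda>t. min 1 (infdist t ?K)"
    have cont: "continuous_on UNIV ?g"
      by (intro continuous_intros)
    have bd: "norm (?g t) \<le> 1" for t
      by (simp add: infdist_nonneg)
    have "h x \<in> ?K" for x
      using closure_subset by fast
    then have "?g (h x) = 0" for x
      by (simp add: infdist_zero)
    then have "(\<integral>t. ?g t \<partial>m) = 0"
      using conv[OF cont bd] by (simp add: LIMSEQ_const_iff)
    moreover have "integrable m ?g"
      by (intro m.integrable_const_bound[where B = 1]) (use bd borel_measurable_continuous_onI[OF cont] in \<open>auto\<close>)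
    ultimately have "AE t in m. ?g t = 0"
      by (subst (asm) integral_nonneg_eq_0_iff_AE) (auto simp: infdist_nonneg)
    then show ?thesis
    proof eventually_elim
      case (elim t)
      then have "infdist t ?K = 0"
        by (auto simp: min_def split: if_splits)
      then show ?case
        using in_closed_iff_infdist_zero[of ?K t] by (simp add: closure_eq_empty)
    qed
  qed
  define \<mu> where "\<mu> = distr m borel p"
  have pm: "p \<in> borel_measurable m"
    by simp
  have "limitin weak_topology (\<mu>s \<circ> r) \<mu> sequentially"
    unfolding limitin_weak_topology
  proof (intro conjI allI impI)
    show "\<mu> \<in> prob_measures"
      unfolding \<mu>_def by (intro prob_measuresI m.prob_space_distr pm) simp
    show "\<forall>\<^sub>F i in sequentially. (\<mu>s \<circ> r) i \<in> prob_measures"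
      using \<mu>s by simp
    fix f :: "'a \<Rightarrow> real" assume f: "continuous_on UNIV f" "bounded (range f)"
    obtain B where B: "\<And>x. norm (f x) \<le> B"
      using f(2) unfolding bounded_iff by auto
    have "0 \<le> B"
      using B[of undefined] norm_ge_zero order_trans by blast
    have inj: "inj h"
    proof (rule injI)
      fix x y assume "h x = h y"
      then have "dist x y < e" if "0 < e" for e
        using h_inv[OF that] by auto
      then show "x = y"
        by (metis less_irrefl zero_less_dist_iff)
    qed
    have "uniformly_continuous_on UNIV f"
      using f(1) compact by (rule compact_uniformly_continuous)
    \<comment> \<open>Read in the code variable, f is uniformly continuous on the range. It
      therefore extends to the closure, where it equals f composed with p, and from there by Tietze
      to the whole line with the same bound, which makes it a test function for m.\<close>
    have "uniformly_continuous_on (range h) (\<lambda>t. f (inv h t))"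
      unfolding uniformly_continuous_on_def
    proof (intro allI impI)
      fix e :: real assume "0 < e"
      then obtain d where d: "0 < d" "\<And>x y. dist y x < d \<Longrightarrow> dist (f y) (f x) < e"
        using \<open>uniformly_continuous_on UNIV f\<close> unfolding uniformly_continuous_on_def by (metis UNIV_I)
      then obtain d' where "0 < d'" "\<And>x y. \<bar>h x - h y\<bar> < d' \<Longrightarrow> dist x y < d"
        using h_inv[OF d(1)] by auto
      then show "\<exists>d>0. \<forall>x\<in>range h. \<forall>x'\<in>range h. dist x' x < d \<longrightarrow> dist (f (inv h x')) (f (inv h x)) < e"
        using d(2) inj by (intro exI[of _ d']) (auto simp: dist_real_def)
    qed
    then obtain g where g: "uniformly_continuous_on ?K g" "\<And>x. g (h x) = f x"
      using uniformly_continuous_on_extension_on_closure[of "range h" "\<lambda>t. f (inv h t)"] inj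
      by (metis inv_f_f rangeI)
    have contg: "continuous_on ?K g"
      using g(1) by (rule uniformly_continuous_imp_continuous)
    have gp: "g t = f (p t)" if t: "t \<in> ?K" for t
    proof -
      obtain ts where ts: "\<And>n::nat. ts n \<in> range h" "ts \<longlonglongrightarrow> t"
        using t unfolding closure_sequential by blast
      have "\<forall>n. \<exists>x. ts n = h x"
        using ts(1) by blast
      then obtain xs where xs: "\<And>n. ts n = h (xs n)"
        by metis
      have "xs \<longlonglongrightarrow> p t"
        using ts(2) unfolding xs by (intro p_lim t)
      then have "(\<lambda>n. f (xs n)) \<longlonglongrightarrow> f (p t)"
        using f(1) by (intro continuous_on_tendsto_compose[OF f(1)]) auto
      moreover have "(\<lambda>n. g (ts n)) \<longlonglongrightarrow> g t"
        using subsetD[OF closure_subset ts(1)]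
        by (intro continuous_on_tendsto_compose[OF contg ts(2) t] always_eventually allI)
      then have "(\<lambda>n. f (xs n)) \<longlonglongrightarrow> g t"
        by (simp add: xs g)
      ultimately show ?thesis
        by (rule LIMSEQ_unique[symmetric])
    qed
    have gB: "norm (g t) \<le> B" if "t \<in> ?K" for t
      using gp[OF that] B by simp
    have "closedin (top_of_set UNIV) ?K"
      by simp
    then obtain f' :: "real \<Rightarrow> real" where f': "continuous_on UNIV f'" "\<And>t. t \<in> ?K \<Longrightarrow> f' t = g t" "\<And>t. norm (f' t) \<le> B"
      by (rule Tietze[OF contg _ \<open>0 \<le> B\<close> gB]) auto
    have "h x \<in> ?K" for x
      using closure_subset by fast
    then have "f' (h x) = f x" for x
      by (simp add: f' g)
    then have "(\<lambda>n. \<integral>x. f x \<partial>\<mu>s (r n)) \<longlonglongrightarrow> (\<integral>t. f' t \<partial>m)"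
      using conv[OF f'(1,3)] by simp
    moreover have "(\<integral>t. f' t \<partial>m) = (\<integral>t. f (p t) \<partial>m)"
    proof (rule integral_cong_AE)
      show "AE t in m. f' t = f (p t)"
        using K by eventually_elim (simp add: f' gp)
      show "f' \<in> borel_measurable m"
        using borel_measurable_continuous_onI[OF f'(1)] by simp
      show "(\<lambda>t. f (p t)) \<in> borel_measurable m"
        using measurable_compose[OF pm borel_measurable_continuous_onI[OF f(1)]] .
    qed
    moreover have "(\<integral>t. f (p t) \<partial>m) = (\<integral>x. f x \<partial>\<mu>)"
      unfolding \<mu>_def by (intro integral_distr[symmetric] pm borel_measurable_continuous_onI f)
    ultimately show "(\<lambda>n. \<integral>x. f x \<partial>(\<mu>s \<circ> r) n) \<longlonglongrightarrow> (\<integral>x. f x \<partial>\<mu>)"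
      by simp
  qed
  with r show thesis
    by (rule that)
qed

section \<open>Law of large numbers and change of measure\<close>

lemma borel_measurable_ext_exp [measurable]: "ext_exp \<in> borel_measurable borel"
  unfolding ext_exp_def[abs_def] by measurable

lemma ext_ln_mono: "a \<le> b \<Longrightarrow> ext_ln a \<le> ext_ln b"
proof (cases a; cases b)
  fix r s assume ab: "a \<le> b" "0 \<le> r" "a = ennreal r" "0 \<le> s" "b = ennreal s"
  then show ?thesis
    by (auto simp: ext_ln_def ennreal_eq_0_iff)
qed (auto simp: ext_ln_def top_unique)

lemma ext_ln_ennreal: "0 < r \<Longrightarrow> ext_ln (ennreal r) = ereal (ln r)"
  by (simp add: ext_ln_def)

text \<open>Passing to the nonnegative integral discards the negative part. It is applied to the
  Jensen lower bound, which may take negative values.\<close>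

lemma ennreal_integral_le:
  fixes g :: "'b \<Rightarrow> real"
  assumes "integrable M g"
  shows "ennreal (\<integral>x. g x \<partial>M) \<le> (\<integral>\<^sup>+x. ennreal (g x) \<partial>M)"
proof -
  have fin: "(\<integral>\<^sup>+x. ennreal (g x) \<partial>M) \<noteq> \<infinity>"
    using assms by (simp add: real_integrable_def)
  have "(\<integral>x. g x \<partial>M) \<le> enn2real (\<integral>\<^sup>+x. ennreal (g x) \<partial>M)"
    unfolding real_lebesgue_integral_def[OF assms] by simp
  then have "ennreal (\<integral>x. g x \<partial>M) \<le> ennreal (enn2real (\<integral>\<^sup>+x. ennreal (g x) \<partial>M))"
    by (rule ennreal_leI)
  also have "\<dots> = (\<integral>\<^sup>+x. ennreal (g x) \<partial>M)"
    using fin by (intro ennreal_enn2real) (simp add: less_top)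
  finally show ?thesis .
qed

lemma sets_PiM_prob:
  assumes "\<mu> \<in> prob_measures"
  shows "sets (PiM I (\<lambda>_. \<mu>)) = sets (PiM I (\<lambda>_. borel))"
  by (intro sets_PiM_cong refl prob_measuresD assms)

lemma space_PiM_prob:
  assumes "\<mu> \<in> prob_measures"
  shows "space (PiM I (\<lambda>_. \<mu>)) = I \<rightarrow>\<^sub>E UNIV"
  using prob_measuresD(3)[OF assms] by (simp add: space_PiM)

lemma prob_space_PiM_prob:
  assumes "\<mu> \<in> prob_measures"
  shows "prob_space (PiM I (\<lambda>_. \<mu>))"
  by (intro prob_space_PiM prob_measuresD assms)

lemma
  fixes g :: "'a::topological_space \<Rightarrow> real"
  assumes "\<mu> \<in> prob_measures" and "integrable \<mu> g" and "i \<in> I"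
  shows integrable_PiM_component: "integrable (PiM I (\<lambda>_. \<mu>)) (\<lambda>x. g (x i))"
    and integral_PiM_component: "(\<integral>x. g (x i) \<partial>PiM I (\<lambda>_. \<mu>)) = (\<integral>y. g y \<partial>\<mu>)"
proof -
  have d: "distr (PiM I (\<lambda>_. \<mu>)) \<mu> (\<lambda>x. x i) = \<mu>"
    by (intro distr_PiM_component prob_measuresD assms)
  have c: "(\<lambda>x. x i) \<in> measurable (PiM I (\<lambda>_. \<mu>)) \<mu>"
    using assms(3) by (rule measurable_component_singleton)
  have "integrable (distr (PiM I (\<lambda>_. \<mu>)) \<mu> (\<lambda>x. x i)) g"
    unfolding d by (rule assms)
  then show "integrable (PiM I (\<lambda>_. \<mu>)) (\<lambda>x. g (x i))"
    by (rule integrable_distr[OF c])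
  have "(\<integral>y. g y \<partial>distr (PiM I (\<lambda>_. \<mu>)) \<mu> (\<lambda>x. x i)) = (\<integral>x. g (x i) \<partial>PiM I (\<lambda>_. \<mu>))"
    using assms(2) by (intro integral_distr c) simp
  then show "(\<integral>x. g (x i) \<partial>PiM I (\<lambda>_. \<mu>)) = (\<integral>y. g y \<partial>\<mu>)"
    unfolding d by simp
qed

lemma indep_vars_PiM_coordinate:
  assumes "\<mu> \<in> prob_measures" and "I \<noteq> {}"
  shows "prob_space.indep_vars (PiM I (\<lambda>_. \<mu>)) (\<lambda>_. \<mu>) (\<lambda>i x. x i) I"
proof -
  interpret P: prob_space "PiM I (\<lambda>_. \<mu>)"
    by (rule prob_space_PiM_prob[OF assms(1)])
  have "distr (PiM I (\<lambda>_. \<mu>)) (PiM I (\<lambda>_. \<mu>)) (\<lambda>x. \<lambda>i\<in>I. x i) = distr (PiM I (\<lambda>_. \<mu>)) (PiM I (\<lambda>_. \<mu>)) (\<lambda>x. x)"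
    by (intro distr_cong) (auto simp: space_PiM PiE_restrict)
  also have "\<dots> = PiM I (\<lambda>i. distr (PiM I (\<lambda>_. \<mu>)) \<mu> (\<lambda>x. x i))"
    unfolding distr_id by (intro PiM_cong refl distr_PiM_component[symmetric] prob_measuresD assms)
  finally show ?thesis
    by (subst P.indep_vars_iff_distr_eq_PiM'[OF assms(2)]) auto
qed

lemma empirical_set_measurable:
  assumes "compact (UNIV :: 'a::metric_space set)" and "n \<ge> 1" and "\<mu> \<in> prob_measures" and "A \<in> sets weak_borel"
  shows "{x \<in> configs n. empirical n x \<in> A} \<in> sets (PiM {..<n} (\<lambda>_. \<mu> :: 'a measure))"
proof -
  have "empirical n -` A \<inter> space (PiM {..<n} (\<lambda>_. borel)) \<in> sets (PiM {..<n} (\<lambda>_. borel :: 'a measure))"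
    by (rule measurable_sets[OF measurable_empirical assms(4)]) fact+
  moreover have "empirical n -` A \<inter> space (PiM {..<n} (\<lambda>_. borel :: 'a measure)) = {x \<in> configs n. empirical n x \<in> A}"
    by (auto simp: space_PiM)
  ultimately show ?thesis
    by (simp add: sets_PiM_prob[OF assms(3)])
qed

text \<open>The coordinates are independent and f takes values in an interval of length 2 B, so the
  exponent is $2 (n e)^2 / (n (2 B)^2) = n e^2 / (2 B^2)$.\<close>

lemma Hoeffding_empirical:
  fixes f :: "'a::metric_space \<Rightarrow> real"
  assumes "n \<ge> 1" and \<mu>: "\<mu> \<in> prob_measures" and f: "f \<in> borel_measurable borel" "\<And>x. \<bar>f x\<bar> \<le> B" and "0 < B" "0 < e"
  shows "measure (PiM {..<n} (\<lambda>_. \<mu>)) {x \<in> configs n. e \<le> \<bar>(\<integral>y. f y \<partial>empirical n x) - (\<integral>y. f y \<partial>\<mu>)\<bar>}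
    \<le> 2 * exp (- (e\<^sup>2 / (2 * B\<^sup>2)) * n)"
proof -
  let ?P = "PiM {..<n} (\<lambda>_. \<mu>)"
  interpret P: prob_space ?P
    by (rule prob_space_PiM_prob[OF \<mu>])
  interpret \<mu>: prob_space \<mu>
    using \<mu> by (rule prob_measuresD)
  have fm: "f \<in> borel_measurable \<mu>"
    using f(1) prob_measuresD(2)[OF \<mu>] by (simp cong: measurable_cong_sets)
  have int: "integrable \<mu> f"
    by (rule \<mu>.integrable_const_bound[where B = B]) (use f fm in auto)
  have ne: "{..<n} \<noteq> {}"
    using assms(1) by (simp add: lessThan_empty_iff)
  have indep: "P.indep_vars (\<lambda>_. borel) (\<lambda>i x. f (x i)) {..<n}"
    by (rule P.indep_vars_compose2[OF indep_vars_PiM_coordinate[OF \<mu> ne]]) (rule fm)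
  interpret H: Hoeffding_ineq ?P "{..<n}" "\<lambda>i x. f (x i)" "\<lambda>_. - B" "\<lambda>_. B" "real n * (\<integral>y. f y \<partial>\<mu>)"
  proof unfold_locales
    show "AE x in ?P. f (x i) \<in> {- B..B}" for i
      using f(2) by (auto simp: abs_le_iff minus_le_iff)
    show "real n * (\<integral>y. f y \<partial>\<mu>) \<equiv> \<Sum>i<n. P.expectation (\<lambda>x. f (x i))"
      by (rule eq_reflection) (simp add: integral_PiM_component[OF \<mu> int])
  qed (use indep in auto)
  have sq: "(\<Sum>i<n. (B - - B)\<^sup>2) = real n * (4 * B\<^sup>2)"
    by (simp add: power2_eq_square)
  have eq: "{x \<in> configs n. e \<le> \<bar>(\<integral>y. f y \<partial>empirical n x) - (\<integral>y. f y \<partial>\<mu>)\<bar>} =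
      {x \<in> space ?P. real n * e \<le> \<bar>(\<Sum>i<n. f (x i)) - real n * (\<integral>y. f y \<partial>\<mu>)\<bar>}"
  proof -
    have "real n * \<bar>(\<Sum>i<n. f (x i)) / n - (\<integral>y. f y \<partial>\<mu>)\<bar> = \<bar>(\<Sum>i<n. f (x i)) - real n * (\<integral>y. f y \<partial>\<mu>)\<bar>" for x
      using assms(1) by (simp add: abs_mult_pos' right_diff_distrib)
    then have "e \<le> \<bar>(\<integral>y. f y \<partial>empirical n x) - (\<integral>y. f y \<partial>\<mu>)\<bar> \<longleftrightarrow>
        real n * e \<le> \<bar>(\<Sum>i<n. f (x i)) - real n * (\<integral>y. f y \<partial>\<mu>)\<bar>" for x
      using integral_empirical[OF assms(1) f(1), of x] assms(1)
      by (metis le_numeral_extra(4) mult_le_cancel_left_pos of_nat_0_less_iff order_less_le_trans zero_less_one)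
    then show ?thesis
      by (simp add: space_PiM_prob[OF \<mu>])
  qed
  have "measure ?P {x \<in> space ?P. real n * e \<le> \<bar>(\<Sum>i<n. f (x i)) - real n * (\<integral>y. f y \<partial>\<mu>)\<bar>}
      \<le> 2 * exp (- 2 * (real n * e)\<^sup>2 / (\<Sum>i<n. (B - - B)\<^sup>2))"
    by (rule H.Hoeffding_ineq_abs_ge) (use assms in \<open>auto simp: sq\<close>)
  also have "- 2 * (real n * e)\<^sup>2 / (\<Sum>i<n. (B - - B)\<^sup>2) = - (e\<^sup>2 / (2 * B\<^sup>2)) * n"
    unfolding sq using assms by (simp add: power2_eq_square field_simps)
  finally show ?thesis
    unfolding eq .
qed

text \<open>Induction over the generation of the weak topology reduces to a single test function,
  where Hoeffding applies. Intersections follow from inclusion-exclusion, and a union is at least as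
  probable as a member containing \<mu>.\<close>

lemma empirical_law_of_large_numbers:
  fixes \<mu> :: "'a::metric_space measure"
  assumes compact: "compact (UNIV :: 'a set)" and \<mu>: "\<mu> \<in> prob_measures"
    and A: "openin weak_topology A" "\<mu> \<in> A"
  shows "(\<lambda>n. measure (PiM {..<n} (\<lambda>_. \<mu>)) {x \<in> configs n. empirical n x \<in> A}) \<longlonglongrightarrow> 1"
proof -
  let ?P = "\<lambda>n. PiM {..<n} (\<lambda>_. \<mu>)"
  let ?E = "\<lambda>n A. {x \<in> configs n. empirical n x \<in> A}"
  interpret P: prob_space "?P n" for n :: nat
    by (rule prob_space_PiM_prob[OF \<mu>])
  note meas = empirical_set_measurable[OF compact _ \<mu> openin_weak_borel]
  have ge1: "\<forall>\<^sub>F n :: nat in sequentially. n \<ge> 1"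
    by (rule eventually_ge_at_top)
  have "generate_topology_on {{\<mu> \<in> prob_measures. (\<integral>x. f x \<partial>\<mu>) \<in> U} | (f :: 'a \<Rightarrow> real) U.
        continuous_on UNIV f \<and> bounded (range f) \<and> open U} A"
    using A(1) by (simp add: openin_weak_topology_iff)
  then have "\<mu> \<in> A \<longrightarrow> (\<lambda>n. measure (?P n) (?E n A)) \<longlonglongrightarrow> 1"
  proof (induction rule: generate_topology_on.induct)
    case Empty
    show ?case
      by simp
  next
    case (Int a b)
    show ?case
    proof
      assume "\<mu> \<in> a \<inter> b"
      then have "(\<lambda>n. measure (?P n) (?E n a) + measure (?P n) (?E n b) - 1) \<longlonglongrightarrow> 1 + 1 - 1"
        using Int by (intro tendsto_intros) auto
      then have lim: "(\<lambda>n. measure (?P n) (?E n a) + measure (?P n) (?E n b) - 1) \<longlonglongrightarrow> 1"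
        by simp
      have o: "openin weak_topology a" "openin weak_topology b"
        using Int by (simp_all add: openin_weak_topology_iff)
      show "(\<lambda>n. measure (?P n) (?E n (a \<inter> b))) \<longlonglongrightarrow> 1"
      proof (rule tendsto_sandwich[OF _ _ lim tendsto_const])
        show "\<forall>\<^sub>F n in sequentially. measure (?P n) (?E n a) + measure (?P n) (?E n b) - 1 \<le> measure (?P n) (?E n (a \<inter> b))"
          using ge1
        proof eventually_elim
          case (elim n)
          have m: "?E n a \<in> sets (?P n)" "?E n b \<in> sets (?P n)"
            using meas elim o by blast+
          have "measure (?P n) (?E n a \<union> ?E n b) = measure (?P n) (?E n a) + measure (?P n) (?E n b) - measure (?P n) (?E n a \<inter> ?E n b)"
            using m by (intro measure_Un3) (auto simp: P.fmeasurable_eq_sets)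
          moreover have "measure (?P n) (?E n a \<union> ?E n b) \<le> 1"
            by simp
          moreover have "?E n a \<inter> ?E n b = ?E n (a \<inter> b)"
            by auto
          ultimately show ?case
            by simp
        qed
      qed simp
    qed
  next
    case (UN K)
    show ?case
    proof
      assume "\<mu> \<in> \<Union>K"
      then obtain k where k: "k \<in> K" "\<mu> \<in> k"
        by blast
      have o: "openin weak_topology k" "openin weak_topology (\<Union>K)"
        using UN.hyps k generate_topology_on.UN[OF UN.hyps] by (simp_all add: openin_weak_topology_iff)
      show "(\<lambda>n. measure (?P n) (?E n (\<Union>K))) \<longlonglongrightarrow> 1"
      proof (rule tendsto_sandwich[OF _ _ _ tendsto_const])
        show "(\<lambda>n. measure (?P n) (?E n k)) \<longlonglongrightarrow> 1"
          using UN k by blast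
        show "\<forall>\<^sub>F n in sequentially. measure (?P n) (?E n k) \<le> measure (?P n) (?E n (\<Union>K))"
          using ge1
        proof eventually_elim
          case (elim n)
          show ?case
            using k meas[OF elim o(2)] by (intro P.finite_measure_mono) auto
        qed
      qed simp
    qed
  next
    case (Basis s)
    then obtain f :: "'a \<Rightarrow> real" and U where s: "s = {\<mu> \<in> prob_measures. (\<integral>x. f x \<partial>\<mu>) \<in> U}"
      and f: "continuous_on UNIV f" "bounded (range f)" and U: "open U"
      by blast
    show ?case
    proof
      assume "\<mu> \<in> s"
      then have "(\<integral>x. f x \<partial>\<mu>) \<in> U"
        by (simp add: s)
      then obtain e where e: "0 < e" "\<And>r. \<bar>r - (\<integral>x. f x \<partial>\<mu>)\<bar> < e \<Longrightarrow> r \<in> U"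
        using U unfolding open_dist dist_real_def by blast
      obtain B' where B': "\<And>x. \<bar>f x\<bar> \<le> B'"
        using f(2) unfolding bounded_iff by auto
      \<comment> \<open>The maximum with 1 makes the bound positive, as it is a denominator in the
        Hoeffding exponent.\<close>
      define B where "B = max B' 1"
      have B: "\<And>x. \<bar>f x\<bar> \<le> B" "0 < B"
        using B' by (auto simp: B_def intro: max.coboundedI1)
      have fm: "f \<in> borel_measurable borel"
        using f(1) by (rule borel_measurable_continuous_onI)
      have o: "openin weak_topology s"
        unfolding s using f U by (rule openin_weak_basis)
      have "LIM n sequentially. - (e\<^sup>2 / (2 * B\<^sup>2)) * real n :> at_bot"
        using e(1) B(2) by (intro filterlim_tendsto_neg_mult_at_bot[OF tendsto_const] filterlim_real_sequentially) simp
      then have "(\<lambda>n. exp (- (e\<^sup>2 / (2 * B\<^sup>2)) * real n)) \<longlonglongrightarrow> 0"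
        by (rule filterlim_compose[OF exp_at_bot])
      then have "(\<lambda>n. 1 - 2 * exp (- (e\<^sup>2 / (2 * B\<^sup>2)) * real n)) \<longlonglongrightarrow> 1 - 2 * 0"
        by (intro tendsto_intros)
      then have lim: "(\<lambda>n. 1 - 2 * exp (- (e\<^sup>2 / (2 * B\<^sup>2)) * real n)) \<longlonglongrightarrow> 1"
        by simp
      show "(\<lambda>n. measure (?P n) (?E n s)) \<longlonglongrightarrow> 1"
      proof (rule tendsto_sandwich[OF _ _ lim tendsto_const])
        show "\<forall>\<^sub>F n in sequentially. 1 - 2 * exp (- (e\<^sup>2 / (2 * B\<^sup>2)) * real n) \<le> measure (?P n) (?E n s)"
          using ge1
        proof eventually_elim
          case (elim n)
          let ?D = "{x \<in> configs n. e \<le> \<bar>(\<integral>y. f y \<partial>empirical n x) - (\<integral>y. f y \<partial>\<mu>)\<bar>}"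
          have "1 - measure (?P n) (?E n s) = measure (?P n) (space (?P n) - ?E n s)"
            using meas[OF elim o] by (rule P.prob_compl[symmetric])
          also have "\<dots> \<le> measure (?P n) ?D"
          proof (rule P.finite_measure_mono)
            show "space (?P n) - ?E n s \<subseteq> ?D"
              using e(2) empirical_in_prob_measures[OF elim]
              by (auto simp: s space_PiM_prob[OF \<mu>] not_less[symmetric])
            have "?D = {x \<in> space (PiM {..<n} (\<lambda>_. borel)). e \<le> \<bar>(\<Sum>i<n. f (x i)) / n - (\<integral>y. f y \<partial>\<mu>)\<bar>}"
              using integral_empirical[OF elim fm] by (simp add: space_PiM)
            also have "\<dots> \<in> sets (PiM {..<n} (\<lambda>_. borel))"
              using fm by measurable
            finally show "?D \<in> sets (?P n)"
              by (simp add: sets_PiM_prob[OF \<mu>])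
          qed
          also have "\<dots> \<le> 2 * exp (- (e\<^sup>2 / (2 * B\<^sup>2)) * n)"
            by (intro Hoeffding_empirical elim \<mu> fm B e)
          finally show ?case
            by simp
        qed
      qed simp
    qed
  qed
  with A(2) show ?thesis
    by blast
qed

section \<open>Finite relative entropy and change of measure on product spaces\<close>

lemma rel_entropy_finite:
  assumes \<pi>: "\<pi> \<in> prob_measures" and \<mu>: "\<mu> \<in> prob_measures" and fin: "rel_entropy \<mu> \<pi> < \<infinity>"
  obtains \<rho> :: "'a::topological_space \<Rightarrow> real" where "\<rho> \<in> borel_measurable borel" "\<And>x. 0 \<le> \<rho> x"
    "density \<pi> (\<lambda>x. ennreal (\<rho> x)) = \<mu>" "integrable \<mu> (\<lambda>x. ln (\<rho> x))"
proof -
  interpret \<pi>: prob_space \<pi> using \<pi> by (rule prob_measuresD)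
  interpret \<mu>: prob_space \<mu> using \<mu> by (rule prob_measuresD)
  have ac: "absolutely_continuous \<pi> \<mu>"
    using fin unfolding rel_entropy_def by (auto split: if_splits)
  define \<rho> where "\<rho> x = enn2real (RN_deriv \<pi> \<mu> x)" for x
  have sets: "sets \<mu> = sets \<pi>"
    using prob_measuresD(2)[OF \<mu>] prob_measuresD(2)[OF \<pi>] by simp
  have \<rho>m: "\<rho> \<in> borel_measurable \<pi>"
    unfolding \<rho>_def[abs_def] by measurable
  have "AE x in \<pi>. RN_deriv \<pi> \<mu> x \<noteq> \<infinity>"
    by (rule \<pi>.RN_deriv_finite[OF \<mu>.sigma_finite_measure_axioms ac sets])
  then have "AE x in \<pi>. RN_deriv \<pi> \<mu> x = ennreal (\<rho> x)"
    by eventually_elim (simp add: \<rho>_def less_top)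
  then have "density \<pi> (RN_deriv \<pi> \<mu>) = density \<pi> (\<lambda>x. ennreal (\<rho> x))"
    using \<rho>m by (intro density_cong) auto
  then have dens: "density \<pi> (\<lambda>x. ennreal (\<rho> x)) = \<mu>"
    using \<pi>.density_RN_deriv[OF ac sets] by simp
  \<comment> \<open>From ln t \<le> t - 1 at t = 1 / r, which gives r ln r \<ge> r - 1. The entropy
    integrand is thus bounded below, and a finite extended integral means integrability.\<close>
  have xlnx: "- 1 \<le> r * ln r" if "0 \<le> r" for r :: real
  proof (cases "r = 0")
    case False
    with that have r: "0 < r"
      by simp
    then have "ln (1 / r) \<le> 1 / r - 1"
      by (intro ln_le_minus_one) simp
    then have "r * (- ln r) \<le> r * (1 / r - 1)"
      using r by (intro mult_left_mono) (simp_all add: ln_div)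
    then show ?thesis
      using r by (simp add: right_diff_distrib)
  qed simp
  have m2: "(\<lambda>x. ereal (\<rho> x * ln (\<rho> x))) \<in> borel_measurable \<pi>"
    using \<rho>m by measurable
  have e: "ext_integral \<pi> (\<lambda>x. ereal (\<rho> x * ln (\<rho> x))) < \<infinity>"
    using fin ac by (simp add: rel_entropy_def \<rho>_def)
  have "integrable \<pi> (\<lambda>x. real_of_ereal (ereal (\<rho> x * ln (\<rho> x))))"
    by (rule ext_integral_finite(2)[OF \<pi>.prob_space_axioms m2, of 1]) (use xlnx e in \<open>auto simp: \<rho>_def\<close>)
  then have "integrable \<pi> (\<lambda>x. \<rho> x * ln (\<rho> x))"
    by simp
  \<comment> \<open>Moving the factor \<rho> into the measure turns integrability of \<rho> ln
    \<rho> under \<pi> into integrability of ln \<rho> under \<mu>.\<close>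
  then have "integrable (density \<pi> (\<lambda>x. ennreal (\<rho> x))) (\<lambda>x. ln (\<rho> x))"
    using \<rho>m by (subst integrable_density) (auto simp: \<rho>_def)
  then have "integrable \<mu> (\<lambda>x. ln (\<rho> x))"
    unfolding dens .
  moreover have "\<rho> \<in> borel_measurable borel"
    using \<rho>m prob_measuresD(2)[OF \<pi>] by (simp cong: measurable_cong_sets)
  ultimately show thesis
    using dens by (intro that[of \<rho>]) (auto simp: \<rho>_def)
qed

text \<open>A product measure is determined by its values on boxes, and on a box the integral of the
  product density factorizes.\<close>

lemma density_PiM:
  fixes \<rho> :: "'a::topological_space \<Rightarrow> real"
  assumes \<pi>: "\<pi> \<in> prob_measures" and \<mu>: "\<mu> \<in> prob_measures" and "finite I"
    and \<rho>: "\<rho> \<in> borel_measurable borel" "\<And>x. 0 \<le> \<rho> x" "density \<pi> (\<lambda>x. ennreal (\<rho> x)) = \<mu>"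
  shows "density (PiM I (\<lambda>_. \<pi>)) (\<lambda>x. ennreal (\<Prod>i\<in>I. \<rho> (x i))) = PiM I (\<lambda>_. \<mu>)"
proof -
  interpret \<pi>: prob_space \<pi> using \<pi> by (rule prob_measuresD)
  interpret \<mu>: prob_space \<mu> using \<mu> by (rule prob_measuresD)
  interpret P: product_sigma_finite "\<lambda>_. \<mu>" ..
  interpret Q: product_sigma_finite "\<lambda>_. \<pi>" ..
  have [measurable]: "\<rho> \<in> borel_measurable \<pi>"
    using \<rho>(1) prob_measuresD(2)[OF \<pi>] by (simp cong: measurable_cong_sets)
  show ?thesis
  proof (rule P.PiM_eqI)
    show "sets (density (PiM I (\<lambda>_. \<pi>)) (\<lambda>x. ennreal (\<Prod>i\<in>I. \<rho> (x i)))) = sets (PiM I (\<lambda>_. \<mu>))"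
      by (simp add: sets_PiM_prob[OF \<pi>] sets_PiM_prob[OF \<mu>])
    fix A :: "'b \<Rightarrow> 'a set" assume "\<And>i. i \<in> I \<Longrightarrow> A i \<in> sets \<mu>"
    then have A: "\<And>i. i \<in> I \<Longrightarrow> A i \<in> sets \<pi>"
      using prob_measuresD(2)[OF \<mu>] prob_measuresD(2)[OF \<pi>] by simp
    have "emeasure (density (PiM I (\<lambda>_. \<pi>)) (\<lambda>x. ennreal (\<Prod>i\<in>I. \<rho> (x i)))) (Pi\<^sub>E I A) =
        (\<integral>\<^sup>+x. ennreal (\<Prod>i\<in>I. \<rho> (x i)) * indicator (Pi\<^sub>E I A) x \<partial>PiM I (\<lambda>_. \<pi>))"
      using A \<open>finite I\<close> by (intro emeasure_density sets_PiM_I_finite) measurable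
    also have "\<dots> = (\<integral>\<^sup>+x. (\<Prod>i\<in>I. ennreal (\<rho> (x i)) * indicator (A i) (x i)) \<partial>PiM I (\<lambda>_. \<pi>))"
    proof (rule nn_integral_cong)
      fix x assume x: "x \<in> space (PiM I (\<lambda>_. \<pi>))"
      have "(indicator (Pi\<^sub>E I A) x :: ennreal) = (\<Prod>i\<in>I. indicator (A i) (x i))"
      proof (cases "x \<in> Pi\<^sub>E I A")
        case False
        then obtain i where "i \<in> I" "x i \<notin> A i"
          using x by (auto simp: space_PiM PiE_iff)
        then have "(\<Prod>i\<in>I. indicator (A i) (x i) :: ennreal) = 0"
          using \<open>finite I\<close> by (intro prod_zero bexI[of _ i]) auto
        then show ?thesis
          using False by simp
      next
        case True
        then have "(\<Prod>i\<in>I. indicator (A i) (x i) :: ennreal) = 1"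
          by (intro prod.neutral ballI indicator_simps(1)) (rule PiE_mem)
        then show ?thesis
          using True by simp
      qed
      then show "ennreal (\<Prod>i\<in>I. \<rho> (x i)) * indicator (Pi\<^sub>E I A) x = (\<Prod>i\<in>I. ennreal (\<rho> (x i)) * indicator (A i) (x i))"
        using \<rho>(2) by (simp add: prod.distrib prod_ennreal)
    qed
    also have "\<dots> = (\<Prod>i\<in>I. \<integral>\<^sup>+y. ennreal (\<rho> y) * indicator (A i) y \<partial>\<pi>)"
      using A \<open>finite I\<close>
      by (intro Q.product_nn_integral_prod borel_measurable_times_ennreal borel_measurable_indicator) auto
    also have "\<dots> = (\<Prod>i\<in>I. emeasure \<mu> (A i))"
      unfolding \<rho>(3)[symmetric] using A by (intro prod.cong refl emeasure_density[symmetric]) auto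
    finally show "emeasure (density (PiM I (\<lambda>_. \<pi>)) (\<lambda>x. ennreal (\<Prod>i\<in>I. \<rho> (x i)))) (Pi\<^sub>E I A) = (\<Prod>i\<in>I. emeasure \<mu> (A i))" .
  qed fact
qed

text \<open>
  Change of measure from $\pi^n$ to $\mu^n$, followed by Jensen's inequality in the form
  $e^{-u} \ge e^{-a} (1 + a - u)$.
\<close>

lemma change_of_measure_lower_bound:
  fixes V :: "(nat \<Rightarrow> 'a::topological_space) \<Rightarrow> ereal"
  assumes \<pi>: "\<pi> \<in> prob_measures" and \<mu>: "\<mu> \<in> prob_measures"
    and \<rho>: "\<rho> \<in> borel_measurable borel" "\<And>x. 0 \<le> \<rho> x" "density \<pi> (\<lambda>x. ennreal (\<rho> x)) = \<mu>"
    and ent: "integrable \<mu> (\<lambda>x. ln (\<rho> x))"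
    and V: "V \<in> borel_measurable (PiM {..<n} (\<lambda>_. borel))" "\<And>x. ereal (- c) \<le> V x" "0 \<le> c"
    and w: "ext_integral (PiM {..<n} (\<lambda>_. \<mu>)) V \<le> ereal w"
    and B: "B \<in> sets (PiM {..<n} (\<lambda>_. borel))" and "0 < s"
    and a: "s * (w + c * (1 - p)) + real n * (\<integral>x. \<bar>ln (\<rho> x)\<bar> \<partial>\<mu>) \<le> p * a"
    and p: "p = measure (PiM {..<n} (\<lambda>_. \<mu>)) B"
  shows "ennreal (p * exp (- a)) \<le> (\<integral>\<^sup>+x. ext_exp (- (ereal s * V x)) * indicator B x \<partial>PiM {..<n} (\<lambda>_. \<pi>))"
proof -
  let ?P = "PiM {..<n} (\<lambda>_. \<mu>)" and ?Q = "PiM {..<n} (\<lambda>_. \<pi>)"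
  interpret P: prob_space ?P
    by (rule prob_space_PiM_prob[OF \<mu>])
  define v where "v x = real_of_ereal (V x)" for x
  define l where "l x = (\<Sum>i<n. ln (\<rho> (x i)))" for x
  \<comment> \<open>Points of infinite energy are removed, since the real version v does not
    represent V there; they form a null set for the product of \<mu> because the expected energy is
    finite.\<close>
  define B' where "B' = {x \<in> space (PiM {..<n} (\<lambda>_. borel)). x \<in> B \<and> V x \<noteq> \<infinity>}"
  have setsP: "sets ?P = sets (PiM {..<n} (\<lambda>_. borel))" and setsQ: "sets ?Q = sets (PiM {..<n} (\<lambda>_. borel))"
    by (intro sets_PiM_prob \<mu> \<pi>)+
  have VP [measurable]: "V \<in> borel_measurable ?P" and VQ [measurable]: "V \<in> borel_measurable ?Q"
    using V(1) setsP setsQ by (simp_all cong: measurable_cong_sets)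
  note V(1)[measurable] B[measurable] \<rho>(1)[measurable]
  have B': "B' \<in> sets (PiM {..<n} (\<lambda>_. borel))"
    unfolding B'_def by measurable
  have fin: "ext_integral ?P V < \<infinity>"
    using w by (auto intro: le_less_trans)
  note V_fin = ext_integral_finite[OF P.prob_space_axioms VP V(2,3) fin]
  have int_v: "integrable ?P v" and w': "(\<integral>x. v x \<partial>?P) \<le> w"
    using V_fin(2,3) w by (simp_all add: v_def[abs_def])
  have int_ln: "integrable ?P (\<lambda>x. ln (\<rho> (x i)))" if "i < n" for i
    using integrable_PiM_component[OF \<mu> ent, of i "{..<n}"] that by simp
  have int_l: "integrable ?P l"
    unfolding l_def[abs_def] by (intro Bochner_Integration.integrable_sum int_ln) simp
  have int_abs: "integrable ?P (\<lambda>x. \<bar>ln (\<rho> (x i))\<bar>)" if "i < n" for i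
    by (intro integrable_abs int_ln that)
  have intB: "integrable ?P (\<lambda>x. indicator B' x * g x)" if "integrable ?P g" for g :: "_ \<Rightarrow> real"
    using integrable_mult_indicator[of B' ?P g] B' setsP that by simp
  have AE: "AE x in ?P. (x \<in> B') = (x \<in> B)"
    using V_fin(1) AE_space
  proof eventually_elim
    case (elim x)
    then show ?case
      by (auto simp: B'_def space_PiM_prob[OF \<mu>] space_PiM)
  qed
  have pB': "measure ?P B' = p"
    unfolding p using AE B B' setsP by (intro P.finite_measure_eq_AE) auto
  have intB1: "integrable ?P (\<lambda>x. indicator B' x :: real)"
    using intB[of "\<lambda>_. 1"] by simp
  \<comment> \<open>The energy outside B' may be negative but not below -c, so restricting the
    expectation to B' costs at most c (1 - p).\<close>
  have "(\<integral>x. indicator B' x * v x \<partial>?P) \<le> (\<integral>x. v x + c - c * indicator B' x \<partial>?P)"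
  proof (intro integral_mono intB int_v Bochner_Integration.integrable_diff Bochner_Integration.integrable_add)
    fix x
    have "- c \<le> v x"
      unfolding v_def using V(2)[of x] V(3) by (cases "V x") auto
    then show "indicator B' x * v x \<le> v x + c - c * indicator B' x"
      by (cases "x \<in> B'") auto
  qed (auto intro: intB1)
  also have "\<dots> = (\<integral>x. v x \<partial>?P) + c * (1 - p)"
    using int_v intB1 B' setsP pB' by (simp add: P.prob_space right_diff_distrib)
  finally have 1: "(\<integral>x. indicator B' x * v x \<partial>?P) \<le> w + c * (1 - p)"
    using w' by simp
  \<comment> \<open>The log density has no sign, so it is bounded by absolute values before the
    restriction to B' is dropped; this is why the absolute integral appears instead of the entropy
    itself.\<close>
  have "(\<integral>x. indicator B' x * l x \<partial>?P) \<le> (\<integral>x. (\<Sum>i<n. \<bar>ln (\<rho> (x i))\<bar>) \<partial>?P)"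
  proof (intro integral_mono intB int_l Bochner_Integration.integrable_sum int_abs)
    fix x
    have "l x \<le> (\<Sum>i<n. \<bar>ln (\<rho> (x i))\<bar>)"
      unfolding l_def by (intro sum_mono) simp
    then show "indicator B' x * l x \<le> (\<Sum>i<n. \<bar>ln (\<rho> (x i))\<bar>)"
      by (cases "x \<in> B'") (auto intro: sum_nonneg)
  qed simp
  also have "\<dots> = (\<Sum>i<n. \<integral>x. \<bar>ln (\<rho> (x i))\<bar> \<partial>?P)"
    by (intro Bochner_Integration.integral_sum int_abs) simp
  also have "\<dots> = (\<Sum>i<n. \<integral>x. \<bar>ln (\<rho> x)\<bar> \<partial>\<mu>)"
    by (intro sum.cong refl integral_PiM_component[OF \<mu> integrable_abs[OF ent]]) simp
  finally have 2: "(\<integral>x. indicator B' x * l x \<partial>?P) \<le> real n * (\<integral>x. \<bar>ln (\<rho> x)\<bar> \<partial>\<mu>)"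
    by simp
  \<comment> \<open>The exponent after the change of measure: multiplying exp (- u) by the product
    density, where it is positive, leaves exp (- s v).\<close>
  define u where "u x = s * v x + l x" for x
  have int_u: "integrable ?P u"
    unfolding u_def[abs_def] by (intro Bochner_Integration.integrable_add integrable_mult_right int_v int_l)
  have "(\<integral>x. indicator B' x * u x \<partial>?P) = (\<integral>x. s * (indicator B' x * v x) + indicator B' x * l x \<partial>?P)"
    by (simp add: u_def algebra_simps)
  also have "\<dots> = s * (\<integral>x. indicator B' x * v x \<partial>?P) + (\<integral>x. indicator B' x * l x \<partial>?P)"
    using intB[OF int_v] intB[OF int_l] by simp
  also have "\<dots> \<le> s * (w + c * (1 - p)) + real n * (\<integral>x. \<bar>ln (\<rho> x)\<bar> \<partial>\<mu>)"
    using 1 2 \<open>0 < s\<close> by (intro add_mono mult_left_mono) auto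
  finally have u_le: "(\<integral>x. indicator B' x * u x \<partial>?P) \<le> p * a"
    using a by simp
  \<comment> \<open>The tangent line at a to the map u \<mapsto> exp (- u), cut off to B'. Its
    integral is at least p exp (- a) because u has integral at most p a over B'.\<close>
  let ?g = "\<lambda>x. exp (- a) * ((1 + a) * indicator B' x - indicator B' x * u x)"
  have int_g: "integrable ?P ?g"
    by (intro integrable_mult_right Bochner_Integration.integrable_diff intB1 intB int_u)
  have "p * exp (- a) \<le> exp (- a) * ((1 + a) * p - (\<integral>x. indicator B' x * u x \<partial>?P))"
    using u_le by (simp add: algebra_simps)
  also have "\<dots> = (\<integral>x. ?g x \<partial>?P)"
    using intB1 intB[OF int_u] B' setsP pB' by simp
  finally have "ennreal (p * exp (- a)) \<le> ennreal (\<integral>x. ?g x \<partial>?P)"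
    by (rule ennreal_leI)
  also have "\<dots> \<le> (\<integral>\<^sup>+x. ennreal (?g x) \<partial>?P)"
    by (rule ennreal_integral_le[OF int_g])
  also have "\<dots> \<le> (\<integral>\<^sup>+x. ennreal (exp (- u x)) * indicator B' x \<partial>?P)"
  proof (intro nn_integral_mono)
    fix x
    have "exp (- a) * (1 + (a - u x)) \<le> exp (- a) * exp (a - u x)"
      by (intro mult_left_mono exp_ge_add_one_self) simp
    also have "\<dots> = exp (- u x)"
      by (simp flip: exp_add)
    finally show "ennreal (?g x) \<le> ennreal (exp (- u x)) * indicator B' x"
      by (cases "x \<in> B'") (auto intro!: ennreal_leI simp: algebra_simps)
  qed
  also have "\<dots> = (\<integral>\<^sup>+x. ennreal (\<Prod>i<n. \<rho> (x i)) * (ennreal (exp (- u x)) * indicator B' x) \<partial>?Q)"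
  proof -
    have "u \<in> borel_measurable (PiM {..<n} (\<lambda>_. borel))"
      unfolding u_def[abs_def] v_def[abs_def] l_def[abs_def] by measurable
    then have [measurable]: "u \<in> borel_measurable ?Q"
      using setsQ by (simp cong: measurable_cong_sets)
    have "(\<lambda>x. \<Prod>i<n. \<rho> (x i)) \<in> borel_measurable (PiM {..<n} (\<lambda>_. borel))"
      by measurable
    then have 1: "(\<lambda>x. ennreal (\<Prod>i<n. \<rho> (x i))) \<in> borel_measurable ?Q"
      using setsQ by (simp cong: measurable_cong_sets)
    have [measurable]: "B' \<in> sets ?Q"
      using B' setsQ by simp
    have 2: "(\<lambda>x. ennreal (exp (- u x)) * indicator B' x) \<in> borel_measurable ?Q"
      by measurable
    show ?thesis
      unfolding density_PiM[OF \<pi> \<mu> finite_lessThan \<rho>, symmetric]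
      by (rule nn_integral_density[OF 1 2])
  qed
  also have "\<dots> \<le> (\<integral>\<^sup>+x. ext_exp (- (ereal s * V x)) * indicator B x \<partial>?Q)"
  proof (intro nn_integral_mono)
    fix x
    show "ennreal (\<Prod>i<n. \<rho> (x i)) * (ennreal (exp (- u x)) * indicator B' x) \<le> ext_exp (- (ereal s * V x)) * indicator B x"
    \<comment> \<open>Where some factor of the density is zero the left side is zero, whatever value
      \<open>ln\<close> takes at 0.\<close>
    proof (cases "x \<in> B' \<and> (\<forall>i<n. \<rho> (x i) \<noteq> 0)")
      case True
      then have pos: "0 < \<rho> (x i)" if "i < n" for i
        using \<rho>(2)[of "x i"] that by (simp add: less_le)
      have "(\<Prod>i<n. \<rho> (x i)) = exp (l x)"
        unfolding l_def by (simp add: exp_sum pos)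
      then have "(\<Prod>i<n. \<rho> (x i)) * exp (- u x) = exp (- (s * v x))"
        by (simp add: u_def flip: exp_add)
      moreover have "V x = ereal (v x)"
        using True V(2)[of x] unfolding v_def B'_def by (cases "V x") auto
      then have "ext_exp (- (ereal s * V x)) = ennreal (exp (- (s * v x)))"
        by (simp add: ext_exp_def)
      ultimately show ?thesis
        using True by (simp add: B'_def prod_nonneg \<rho>(2) flip: ennreal_mult)
    next
      case False
      then have "x \<notin> B' \<or> (\<Prod>i<n. \<rho> (x i)) = 0"
        by auto
      then show ?thesis
        by (elim disjE) (simp_all only: indicator_simps not_False_eq_True mult_zero_left mult_zero_right ennreal_0 zero_le)
    qed
  qed
  finally show ?thesis .
qed

section \<open>Laplace principle and large deviations\<close>

text \<open>Extracts factors such as the inverse partition function or a constant exponential weight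
  from the logarithm, including for sets of measure 0 or \<infinity>.\<close>

lemma ext_ln_exp_mult: "ext_ln (ennreal (exp t) * z) = ereal t + ext_ln z"
proof (cases z)
  case (real r)
  show ?thesis
  proof (cases "r = 0")
    case False
    then have "0 < r"
      using real by simp
    have "ennreal (exp t) * z = ennreal (exp t * r)"
      using real by (simp add: ennreal_mult)
    then show ?thesis
      using \<open>0 < r\<close> real by (simp add: ext_ln_ennreal ln_mult)
  qed (simp add: real ext_ln_def)
next
  case top
  have "ennreal (exp t) * top = top"
    by (simp add: ennreal_mult_top)
  then show ?thesis
    by (simp add: top ext_ln_def)
qed

lemma ereal_inverse_mult_add: "0 < s \<Longrightarrow> ereal (1 / s) * (ereal t + L) = ereal (t / s) + ereal (1 / s) * L"
  by (cases L) (simp_all add: add_divide_distrib)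

lemma ereal_less_uminus_iff: "ereal r < - b \<longleftrightarrow> b < ereal (- r)"
  by (cases b) auto

lemma ereal_uminus_less_iff: "- b < ereal r \<longleftrightarrow> ereal (- r) < b"
  by (cases b) auto

lemma ereal_less_add_left: "ereal (r + a) < L \<Longrightarrow> ereal r < ereal (- a) + L"
  by (cases L) auto

text \<open>
  (A1) is assumed along arbitrary filters below \<^const>\<open>sequentially\<close>, which includes subsequences, because
  the upper bounds pass to convergent subsequences of minimizing configurations.
\<close>

locale gibbs_limit =
  fixes \<pi> :: "'a::metric_space measure" and Wn :: "nat \<Rightarrow> (nat \<Rightarrow> 'a) \<Rightarrow> ereal" and W :: "'a measure \<Rightarrow> ereal"
    and c :: real and \<beta> :: "nat \<Rightarrow> real"
  assumes compact: "compact (UNIV :: 'a set)"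
    and \<pi>: "\<pi> \<in> prob_measures"
    and Wn_meas: "\<And>n. n \<ge> 1 \<Longrightarrow> Wn n \<in> borel_measurable (PiM {..<n} (\<lambda>_. borel))"
    and Wn_ge: "\<And>n x. n \<ge> 1 \<Longrightarrow> ereal (- c) \<le> Wn n x" and c: "0 \<le> c"
    and W_ge: "\<And>\<mu>. \<mu> \<in> prob_measures \<Longrightarrow> ereal (- c) \<le> W \<mu>"
    and liminf: "\<And>F x \<mu> y. F \<le> sequentially \<Longrightarrow> limitin weak_topology (\<lambda>n. empirical n (x n)) \<mu> F \<Longrightarrow>
      y < W \<mu> \<Longrightarrow> \<forall>\<^sub>F n in F. y < Wn n (x n)"
    and recovery: "\<And>\<mu>. \<mu> \<in> prob_measures \<Longrightarrow> W \<mu> < \<infinity> \<Longrightarrow>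
      \<exists>\<mu>s. (\<forall>n. \<mu>s n \<in> recovery_set \<pi> Wn W) \<and> limitin weak_topology \<mu>s \<mu> sequentially \<and>
          limsup (\<lambda>n. W (\<mu>s n)) \<le> W \<mu>"
    and \<beta>_pos: "\<And>n. n \<ge> 1 \<Longrightarrow> 0 < \<beta> n"
    and \<beta>_lim: "filterlim \<beta> at_top sequentially"
begin

abbreviation "\<gamma> \<equiv> gibbs \<pi> Wn \<beta>"
abbreviation "s n \<equiv> real n * \<beta> n"
abbreviation "preimage n A \<equiv> {x \<in> configs n. empirical n x \<in> A}"

section \<open>Gibbs weights and their measurability\<close>

lemma s_pos: "n \<ge> 1 \<Longrightarrow> 0 < s n"
  using \<beta>_pos by simp

lemma s_lim: "filterlim s at_top sequentially"
proof (rule filterlim_at_top_mono[OF \<beta>_lim])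
  show "\<forall>\<^sub>F n in sequentially. \<beta> n \<le> s n"
    using eventually_ge_at_top[of "1 :: nat"]
  proof eventually_elim
    case (elim n)
    then have "1 * \<beta> n \<le> s n"
      using \<beta>_pos[OF elim] by (intro mult_right_mono) auto
    then show ?case
      by simp
  qed
qed

lemma sets_gibbs: "sets (\<gamma> n) = sets (PiM {..<n} (\<lambda>_. borel))"
  by (simp add: gibbs_def sets_PiM_prob[OF \<pi>])

lemma space_gibbs: "space (\<gamma> n) = configs n"
  by (simp add: gibbs_def space_PiM_prob[OF \<pi>])

lemma weight_measurable:
  assumes "n \<ge> 1"
  shows "(\<lambda>x. ext_exp (- (ereal (s n) * Wn n x))) \<in> borel_measurable (PiM {..<n} (\<lambda>_. \<pi>))"
proof -
  have [measurable]: "Wn n \<in> borel_measurable (PiM {..<n} (\<lambda>_. \<pi>))"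
    using Wn_meas[OF assms] sets_PiM_prob[OF \<pi>, of "{..<n}"] by (simp cong: measurable_cong_sets)
  show ?thesis
    by measurable
qed

lemma nn_integral_gibbs:
  assumes "n \<ge> 1" and "h \<in> borel_measurable (PiM {..<n} (\<lambda>_. borel))"
  shows "(\<integral>\<^sup>+x. h x \<partial>\<gamma> n) = (\<integral>\<^sup>+x. ext_exp (- (ereal (s n) * Wn n x)) * h x \<partial>PiM {..<n} (\<lambda>_. \<pi>))"
proof -
  have "h \<in> borel_measurable (PiM {..<n} (\<lambda>_. \<pi>))"
    using assms(2) sets_PiM_prob[OF \<pi>, of "{..<n}"] by (simp cong: measurable_cong_sets)
  then show ?thesis
    unfolding gibbs_def by (rule nn_integral_density[OF weight_measurable[OF assms(1)]])
qed

lemma emeasure_gibbs: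
  assumes "n \<ge> 1" and "B \<in> sets (PiM {..<n} (\<lambda>_. borel))"
  shows "emeasure (\<gamma> n) B = (\<integral>\<^sup>+x. ext_exp (- (ereal (s n) * Wn n x)) * indicator B x \<partial>PiM {..<n} (\<lambda>_. \<pi>))"
  unfolding gibbs_def using assms
  by (intro emeasure_density weight_measurable) (simp_all add: sets_PiM_prob[OF \<pi>])

lemma preimage_measurable:
  assumes "n \<ge> 1" and "(A :: 'a measure set) \<in> sets weak_borel"
  shows "preimage n A \<in> sets (PiM {..<n} (\<lambda>_. borel))"
  using empirical_set_measurable[OF compact assms(1) \<pi> assms(2)] by (simp add: sets_PiM_prob[OF \<pi>])

text \<open>On the scale \<open>s n\<close> the entropy cost n K becomes K /
  \<open>\<beta> n\<close> and the logarithm of the probability p n is negligible, so the bound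
  tends to -w, where w is chosen strictly between W \<mu> and -y.\<close>

lemma recovery_set_lower_bound:
  assumes \<mu>: "\<mu> \<in> recovery_set \<pi> Wn W" and A: "openin weak_topology A" "\<mu> \<in> A" and y: "ereal y < - W \<mu>"
  shows "\<forall>\<^sub>F n in sequentially. ereal y \<le> ereal (1 / s n) * ext_ln (emeasure (\<gamma> n) (preimage n A))"
proof -
  have \<mu>P: "\<mu> \<in> prob_measures" and ent: "rel_entropy \<mu> \<pi> < \<infinity>"
    and lims: "limsup (\<lambda>n. ext_integral (PiM {..<n} (\<lambda>_. \<mu>)) (Wn n)) \<le> W \<mu>"
    using \<mu> by (auto simp: recovery_set_def)
  have "W \<mu> < ereal (- y)"
    using y by (simp add: ereal_less_uminus_iff)
  then obtain w where w: "W \<mu> < ereal w" "w < - y"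
    using ereal_dense2 by force
  obtain \<rho> :: "'a \<Rightarrow> real" where \<rho>: "\<rho> \<in> borel_measurable borel" "\<And>x. 0 \<le> \<rho> x"
    "density \<pi> (\<lambda>x. ennreal (\<rho> x)) = \<mu>" "integrable \<mu> (\<lambda>x. ln (\<rho> x))"
    by (rule rel_entropy_finite[OF \<pi> \<mu>P ent]) auto
  define K where "K = (\<integral>x. \<bar>ln (\<rho> x)\<bar> \<partial>\<mu>)"
  define p where "p n = measure (PiM {..<n} (\<lambda>_. \<mu>)) (preimage n A)" for n
  have p: "p \<longlonglongrightarrow> 1"
    unfolding p_def[abs_def] by (rule empirical_law_of_large_numbers[OF compact \<mu>P A])
  have "(\<lambda>n. ln (p n) * (1 / s n)) \<longlonglongrightarrow> ln 1 * 0"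
    by (intro tendsto_intros p tendsto_divide_0[OF tendsto_const] filterlim_at_top_imp_at_infinity s_lim) simp
  moreover have "(\<lambda>n. (w + c * (1 - p n) + K / \<beta> n) / p n) \<longlonglongrightarrow> (w + c * (1 - 1) + 0) / 1"
    by (intro tendsto_intros p tendsto_divide_0[OF tendsto_const] filterlim_at_top_imp_at_infinity \<beta>_lim) simp
  ultimately have "(\<lambda>n. ln (p n) * (1 / s n) - (w + c * (1 - p n) + K / \<beta> n) / p n) \<longlonglongrightarrow> ln 1 * 0 - (w + c * (1 - 1) + 0) / 1"
    by (rule tendsto_diff)
  moreover have "y < - w"
    using w(2) by linarith
  then have "y < ln 1 * 0 - (w + c * (1 - 1) + 0) / 1"
    by simp
  ultimately have "\<forall>\<^sub>F n in sequentially. y < ln (p n) * (1 / s n) - (w + c * (1 - p n) + K / \<beta> n) / p n"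
    by (rule order_tendstoD(1))
  moreover have "\<forall>\<^sub>F n in sequentially. 0 < p n"
    using p by (rule order_tendstoD) simp
  moreover have "\<forall>\<^sub>F n in sequentially. ext_integral (PiM {..<n} (\<lambda>_. \<mu>)) (Wn n) < ereal w"
    using le_less_trans[OF lims w(1)] by (rule Limsup_lessD)
  ultimately show ?thesis
    using eventually_ge_at_top[of "1 :: nat"]
  proof eventually_elim
    case (elim n)
    \<comment> \<open>The exponent for which the hypothesis of the change of measure holds with
      equality; divided by \<open>s n\<close> it tends to w.\<close>
    define a where "a = (s n * (w + c * (1 - p n)) + real n * K) / p n"
    have s: "0 < s n"
      using elim by (intro s_pos)
    have B: "preimage n A \<in> sets (PiM {..<n} (\<lambda>_. borel))"
      using elim A by (intro preimage_measurable openin_weak_borel)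
    have "ennreal (p n * exp (- a)) \<le> emeasure (\<gamma> n) (preimage n A)"
      unfolding emeasure_gibbs[OF elim(4) B]
    proof (rule change_of_measure_lower_bound[OF \<pi> \<mu>P \<rho> Wn_meas[OF elim(4)] Wn_ge[OF elim(4)] c _ B s _ p_def])
      show "ext_integral (PiM {..<n} (\<lambda>_. \<mu>)) (Wn n) \<le> ereal w"
        using elim by simp
      show "s n * (w + c * (1 - p n)) + real n * (\<integral>x. \<bar>ln (\<rho> x)\<bar> \<partial>\<mu>) \<le> p n * a"
        using elim by (simp add: a_def K_def)
    qed
    then have "ext_ln (ennreal (p n * exp (- a))) \<le> ext_ln (emeasure (\<gamma> n) (preimage n A))"
      by (rule ext_ln_mono)
    moreover have "ext_ln (ennreal (p n * exp (- a))) = ereal (ln (p n) - a)"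
      using elim by (simp add: ext_ln_ennreal ln_mult)
    ultimately have "ereal (1 / s n) * ereal (ln (p n) - a) \<le> ereal (1 / s n) * ext_ln (emeasure (\<gamma> n) (preimage n A))"
      using s by (intro ereal_mult_left_mono) auto
    moreover have "a / s n = (w + c * (1 - p n) + K / \<beta> n) / p n"
      using elim s \<beta>_pos[of n] by (simp add: a_def field_simps)
    then have "y \<le> (1 / s n) * (ln (p n) - a)"
      using elim(1) by (simp add: right_diff_distrib)
    then have "ereal y \<le> ereal (1 / s n) * ereal (ln (p n) - a)"
      by simp
    ultimately show ?case
      by (rule order_trans[rotated])
  qed
qed

text \<open>A near-minimizer in A need not admit a change of measure itself. Its recovery sequence
  eventually enters the open set A with almost the same energy, and one member of it, fixed while n
  grows, suffices.\<close>

lemma open_lower_bound: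
  assumes A: "openin weak_topology A"
  shows "- (INF \<mu>\<in>A. W \<mu>) \<le> Liminf sequentially (\<lambda>n. ereal (1 / s n) * ext_ln (emeasure (\<gamma> n) (preimage n A)))"
  unfolding le_Liminf_iff
proof (intro allI impI)
  fix y assume "y < - (INF \<mu>\<in>A. W \<mu>)"
  then obtain r where r: "y < ereal r" "ereal r < - (INF \<mu>\<in>A. W \<mu>)"
    using ereal_dense2 by blast
  then have "(INF \<mu>\<in>A. W \<mu>) < ereal (- r)"
    by (simp only: ereal_less_uminus_iff)
  then obtain \<mu> where \<mu>: "\<mu> \<in> A" "W \<mu> < ereal (- r)"
    by (auto simp: INF_less_iff)
  have "\<mu> \<in> prob_measures"
    using \<mu>(1) openin_weak_topology_subset[OF A] by blast
  moreover have "W \<mu> < \<infinity>"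
    using \<mu>(2) by (auto intro: less_trans)
  ultimately obtain \<mu>s where \<mu>s: "\<And>n. \<mu>s n \<in> recovery_set \<pi> Wn W" "limitin weak_topology \<mu>s \<mu> sequentially"
    "limsup (\<lambda>n. W (\<mu>s n)) \<le> W \<mu>"
    using recovery by blast
  have "\<forall>\<^sub>F k in sequentially. \<mu>s k \<in> A"
    by (rule limitinD[OF \<mu>s(2) A \<mu>(1)])
  moreover have "\<forall>\<^sub>F k in sequentially. W (\<mu>s k) < ereal (- r)"
    using le_less_trans[OF \<mu>s(3) \<mu>(2)] by (rule Limsup_lessD)
  ultimately have "\<forall>\<^sub>F k in sequentially. \<mu>s k \<in> A \<and> W (\<mu>s k) < ereal (- r)"
    by (rule eventually_conj)
  then obtain k where k: "\<mu>s k \<in> A" "W (\<mu>s k) < ereal (- r)"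
    using eventually_happens'[OF sequentially_bot] by blast
  then have "ereal r < - W (\<mu>s k)"
    by (simp add: ereal_less_uminus_iff)
  from recovery_set_lower_bound[OF \<mu>s(1) A k(1) this]
  show "\<forall>\<^sub>F n in sequentially. y < ereal (1 / s n) * ext_ln (emeasure (\<gamma> n) (preimage n A))"
    by eventually_elim (rule less_le_trans[OF r(1)])
qed

text \<open>Uniformity over all configurations is the point: otherwise there are violating
  configurations for infinitely many n, whose empirical measures subconverge to some \<mu> in C, and
  (A1) with continuity of f contradicts the choice of y.\<close>

lemma energy_eventually_ge:
  assumes C: "closedin weak_topology C" and f: "continuous_map weak_topology euclideanreal f"
    and y: "ereal y < (INF \<mu>\<in>C. ereal (f \<mu>) + W \<mu>)"
  shows "\<forall>\<^sub>F n in sequentially. \<forall>x. empirical n x \<in> C \<longrightarrow> ereal y \<le> ereal (f (empirical n x)) + Wn n x"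
proof (rule ccontr)
  assume "\<not> ?thesis"
  \<comment> \<open>Adding n \<ge> 1 ensures that the extracted empirical measures are probability
    measures.\<close>
  then have "\<not> (\<forall>\<^sub>F n in sequentially. 1 \<le> n \<longrightarrow> (\<forall>x. empirical n x \<in> C \<longrightarrow> ereal y \<le> ereal (f (empirical n x)) + Wn n x))"
    by (rule contrapos_nn) (erule eventually_mp[OF _ eventually_ge_at_top[of "1 :: nat"]])
  then obtain r where r: "strict_mono (r :: nat \<Rightarrow> nat)"
    "\<And>k. \<not> (1 \<le> r k \<longrightarrow> (\<forall>x. empirical (r k) x \<in> C \<longrightarrow> ereal y \<le> ereal (f (empirical (r k) x)) + Wn (r k) x))"
    using not_eventually_sequentiallyD by blast
  then have "\<forall>k. \<exists>x. 1 \<le> r k \<and> empirical (r k) x \<in> C \<and> ereal (f (empirical (r k) x)) + Wn (r k) x < ereal y"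
    by (meson not_le)
  then obtain x where x: "\<And>k. 1 \<le> r k" "\<And>k. empirical (r k) (x k) \<in> C"
    "\<And>k. ereal (f (empirical (r k) (x k))) + Wn (r k) (x k) < ereal y"
    by metis
  obtain q \<mu> where q: "strict_mono (q :: nat \<Rightarrow> nat)"
    "limitin weak_topology ((\<lambda>k. empirical (r k) (x k)) \<circ> q) \<mu> sequentially"
    by (rule prob_measures_sequentially_compact[OF compact, of "\<lambda>k. empirical (r k) (x k)"])
       (auto intro: empirical_in_prob_measures x)
  \<comment> \<open>The violating configurations are numbered by position in the subsequence, while
    (A1) is indexed by the particle number. They are re-indexed by that number, and the filter F
    records the further subsequence.\<close>
  define x' where "x' n = x (inv r n)" for n
  have x': "x' (r k) = x k" for k
    unfolding x'_def using strict_mono_imp_inj_on[OF r(1)] by simp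
  define F where "F = filtermap (r \<circ> q) sequentially"
  have "filterlim (r \<circ> q) sequentially sequentially"
    by (intro filterlim_subseq strict_mono_o r q)
  then have F: "F \<le> sequentially"
    by (simp add: F_def filterlim_def)
  have ne: "F \<noteq> bot"
    by (simp add: F_def filtermap_bot_iff)
  have lim: "limitin weak_topology (\<lambda>n. empirical n (x' n)) \<mu> F"
    using q(2) by (simp add: limitin_def F_def eventually_filtermap x')
  have inC: "\<forall>\<^sub>F n in F. empirical n (x' n) \<in> C"
    by (simp add: F_def eventually_filtermap x' x)
  have "\<mu> \<in> C"
    using limitin_closedin[OF lim C inC] ne by simp
  then have "ereal y < ereal (f \<mu>) + W \<mu>"
    using y by (meson INF_lower less_le_trans)
  then have "ereal (y - f \<mu>) < W \<mu>"
    by (cases "W \<mu>") auto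
  \<comment> \<open>z splits the threshold: y - z lies below f \<mu> and z below W \<mu>, so the two
    terms are treated separately even if W \<mu> is infinite.\<close>
  then obtain z where z: "ereal (y - f \<mu>) < ereal z" "ereal z < W \<mu>"
    using ereal_dense2 by blast
  have "limitin euclideanreal (f \<circ> (\<lambda>n. empirical n (x' n))) (f \<mu>) F"
    by (rule continuous_map_limit[OF f lim])
  then have "((\<lambda>n. f (empirical n (x' n))) \<longlongrightarrow> f \<mu>) F"
    by (simp add: o_def)
  moreover have "y - z < f \<mu>"
    using z(1) by (simp add: less_diff_eq diff_less_eq add.commute)
  ultimately have "\<forall>\<^sub>F n in F. y - z < f (empirical n (x' n))"
    by (rule order_tendstoD(1))
  moreover have "\<forall>\<^sub>F n in F. ereal z < Wn n (x' n)"
    by (rule liminf[OF F lim z(2)])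
  ultimately have "\<forall>\<^sub>F n in F. ereal y < ereal (f (empirical n (x' n))) + Wn n (x' n)"
  proof eventually_elim
    case (elim n)
    then show ?case
      by (cases "Wn n (x' n)") auto
  qed
  then have "\<forall>\<^sub>F k in sequentially. ereal y < ereal (f (empirical (r (q k)) (x (q k)))) + Wn (r (q k)) (x (q k))"
    by (simp add: F_def eventually_filtermap x')
  then obtain k where "ereal y < ereal (f (empirical (r (q k)) (x (q k)))) + Wn (r (q k)) (x (q k))"
    using eventually_happens'[OF sequentially_bot] by blast
  with x(3)[of "q k"] show False
    by simp
qed

text \<open>One estimate for two purposes: C = P(M) gives the upper half of the Laplace principle, f
  = 0 that of the large deviation principle. The integrand is eventually at most
  \<open>exp (s n * r)\<close> and the reference measure has mass 1.\<close>

lemma closed_upper_bound: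
  assumes C: "closedin weak_topology C" and f: "continuous_map weak_topology euclideanreal f"
  shows "Limsup sequentially (\<lambda>n. ereal (1 / s n) *
      ext_ln (\<integral>\<^sup>+x. ennreal (exp (- (s n * f (empirical n x)))) * indicator (preimage n C) x \<partial>\<gamma> n))
    \<le> - (INF \<mu>\<in>C. ereal (f \<mu>) + W \<mu>)"
  unfolding Limsup_le_iff
proof (intro allI impI)
  fix y assume "- (INF \<mu>\<in>C. ereal (f \<mu>) + W \<mu>) < y"
  then obtain r where r: "- (INF \<mu>\<in>C. ereal (f \<mu>) + W \<mu>) < ereal r" "ereal r < y"
    using ereal_dense2 by blast
  then have "ereal (- r) < (INF \<mu>\<in>C. ereal (f \<mu>) + W \<mu>)"
    by (simp only: ereal_uminus_less_iff)
  from energy_eventually_ge[OF C f this] eventually_ge_at_top[of "1 :: nat"]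
  show "\<forall>\<^sub>F n in sequentially. ereal (1 / s n) *
      ext_ln (\<integral>\<^sup>+x. ennreal (exp (- (s n * f (empirical n x)))) * indicator (preimage n C) x \<partial>\<gamma> n) < y"
  proof eventually_elim
    case (elim n)
    have s: "0 < s n"
      using elim by (intro s_pos)
    interpret Q: prob_space "PiM {..<n} (\<lambda>_. \<pi>)"
      by (rule prob_space_PiM_prob[OF \<pi>])
    have [measurable]: "(\<lambda>x. f (empirical n x)) \<in> borel_measurable (PiM {..<n} (\<lambda>_. borel))"
      by (rule measurable_compose[OF measurable_empirical[OF compact elim(2)] borel_measurable_weak_continuous[OF f]])
    have [measurable]: "preimage n C \<in> sets (PiM {..<n} (\<lambda>_. borel))"
      using elim C by (intro preimage_measurable closedin_weak_borel)
    have "(\<integral>\<^sup>+x. ennreal (exp (- (s n * f (empirical n x)))) * indicator (preimage n C) x \<partial>\<gamma> n) =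
       (\<integral>\<^sup>+x. ext_exp (- (ereal (s n) * Wn n x)) *
          (ennreal (exp (- (s n * f (empirical n x)))) * indicator (preimage n C) x) \<partial>PiM {..<n} (\<lambda>_. \<pi>))"
      by (intro nn_integral_gibbs elim) measurable
    also have "\<dots> \<le> (\<integral>\<^sup>+x. ennreal (exp (s n * r)) \<partial>PiM {..<n} (\<lambda>_. \<pi>))"
    proof (intro nn_integral_mono)
      fix x
      show "ext_exp (- (ereal (s n) * Wn n x)) * (ennreal (exp (- (s n * f (empirical n x)))) * indicator (preimage n C) x)
        \<le> ennreal (exp (s n * r))"
      proof (cases "x \<in> preimage n C")
        case True
        then have ge: "ereal (- r) \<le> ereal (f (empirical n x)) + Wn n x"
          using elim by blast
        show ?thesis
        proof (cases "Wn n x")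
          case (real v)
          then have "- r \<le> f (empirical n x) + v"
            using ge by simp
          then have "s n * (- r) \<le> s n * (f (empirical n x) + v)"
            using s by (intro mult_left_mono) auto
          then have "exp (- (s n * v)) * exp (- (s n * f (empirical n x))) \<le> exp (s n * r)"
            by (simp add: algebra_simps flip: exp_add)
          then show ?thesis
            using True real by (simp add: ext_exp_def flip: ennreal_mult)
        next
          case PInf
          then have "ext_exp (- (ereal (s n) * Wn n x)) = 0"
            using elim(2) \<beta>_pos[OF elim(2)] by (simp add: ext_exp_def)
          then show ?thesis
            by simp
        next
          case MInf
          then show ?thesis
            using Wn_ge[OF elim(2), of x] by simp
        qed
      qed (simp only: indicator_simps not_False_eq_True mult_zero_right zero_le)
    qed
    also have "\<dots> = ennreal (exp (s n * r))"
      by (simp add: Q.emeasure_space_1)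
    finally have "ext_ln (\<integral>\<^sup>+x. ennreal (exp (- (s n * f (empirical n x)))) * indicator (preimage n C) x \<partial>\<gamma> n) \<le>
        ext_ln (ennreal (exp (s n * r)))"
      by (rule ext_ln_mono)
    then have "ereal (1 / s n) *
        ext_ln (\<integral>\<^sup>+x. ennreal (exp (- (s n * f (empirical n x)))) * indicator (preimage n C) x \<partial>\<gamma> n) \<le>
        ereal (1 / s n) * ereal (s n * r)"
      using s by (intro ereal_mult_left_mono) (auto simp: ext_ln_ennreal)
    also have "\<dots> = ereal r"
      using elim(2) \<beta>_pos[OF elim(2)] by simp
    finally show ?case
      using r(2) by (rule le_less_trans)
  qed
qed

text \<open>For the lower half the integral is restricted to the open set where f is below f \<mu> +
  e, for a near-minimizer \<mu>; there the exponential factor is bounded below by a constant and the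
  open lower bound applies.\<close>

theorem laplace_principle:
  assumes f: "continuous_map weak_topology euclideanreal f"
  shows "(\<lambda>n. ereal (1 / s n) * ext_ln (\<integral>\<^sup>+x. ennreal (exp (- (s n * f (empirical n x)))) \<partial>\<gamma> n))
    \<longlonglongrightarrow> - (INF \<mu>\<in>prob_measures. ereal (f \<mu>) + W \<mu>)" (is "?X \<longlonglongrightarrow> ?L")
proof (rule order_tendstoI)
  fix y assume y: "?L < y"
  have closed: "closedin weak_topology (prob_measures :: 'a measure set)"
    using closedin_topspace[of "weak_topology :: 'a measure topology"] by (simp add: topspace_weak_topology)
  have "\<forall>\<^sub>F n in sequentially. ereal (1 / s n) *
      ext_ln (\<integral>\<^sup>+x. ennreal (exp (- (s n * f (empirical n x)))) * indicator (preimage n prob_measures) x \<partial>\<gamma> n) < y"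
    using closed_upper_bound[OF closed f] y unfolding Limsup_le_iff by blast
  then show "\<forall>\<^sub>F n in sequentially. ?X n < y"
    using eventually_ge_at_top[of "1 :: nat"]
  proof eventually_elim
    case (elim n)
    have "(\<integral>\<^sup>+x. ennreal (exp (- (s n * f (empirical n x)))) * indicator (preimage n prob_measures) x \<partial>\<gamma> n) =
        (\<integral>\<^sup>+x. ennreal (exp (- (s n * f (empirical n x)))) \<partial>\<gamma> n)"
      using empirical_in_prob_measures[OF elim(2), where 'a = 'a]
      by (intro nn_integral_cong) (simp add: space_gibbs)
    then show ?case
      using elim(1) by simp
  qed
next
  fix y assume "y < ?L"
  then obtain r where r: "y < ereal r" "ereal r < ?L"
    using ereal_dense2 by blast
  then have "(INF \<mu>\<in>prob_measures. ereal (f \<mu>) + W \<mu>) < ereal (- r)"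
    by (simp only: ereal_less_uminus_iff)
  then obtain \<mu> where \<mu>: "\<mu> \<in> prob_measures" "ereal (f \<mu>) + W \<mu> < ereal (- r)"
    unfolding INF_less_iff by blast
  obtain w where w: "W \<mu> = ereal w" "f \<mu> + w < - r"
    using \<mu>(2) W_ge[OF \<mu>(1)] by (cases "W \<mu>") auto
  \<comment> \<open>Half of the slack in f \<mu> + w < - r: one half is spent on the variation of f
    over A, the other keeps the inequality strict.\<close>
  define e where "e = (- r - f \<mu> - w) / 2"
  have e: "0 < e"
    using w by (simp add: e_def)
  define A where "A = {\<mu>' \<in> topspace weak_topology. f \<mu>' \<in> {..< f \<mu> + e}}"
  have A: "openin weak_topology A"
    unfolding A_def using openin_continuous_map_preimage[OF f, of "{..< f \<mu> + e}"] by simp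
  have "\<mu> \<in> A"
    using \<mu>(1) e by (simp add: A_def topspace_weak_topology)
  then have "- W \<mu> \<le> - (INF \<mu>\<in>A. W \<mu>)"
    by (simp add: INF_lower)
  moreover have "ereal (r + f \<mu> + e) < - W \<mu>"
    using w by (simp add: e_def field_simps)
  ultimately have "ereal (r + f \<mu> + e) < - (INF \<mu>\<in>A. W \<mu>)"
    by (rule less_le_trans[rotated])
  then have "\<forall>\<^sub>F n in sequentially. ereal (r + f \<mu> + e) < ereal (1 / s n) * ext_ln (emeasure (\<gamma> n) (preimage n A))"
    using open_lower_bound[OF A] unfolding le_Liminf_iff by blast
  then show "\<forall>\<^sub>F n in sequentially. y < ?X n"
    using eventually_ge_at_top[of "1 :: nat"]
  proof eventually_elim
    case (elim n)
    have s: "0 < s n"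
      using elim by (intro s_pos)
    have B: "preimage n A \<in> sets (\<gamma> n)"
      unfolding sets_gibbs using elim A by (intro preimage_measurable openin_weak_borel)
    have "ennreal (exp (- (s n * (f \<mu> + e)))) * emeasure (\<gamma> n) (preimage n A) =
        (\<integral>\<^sup>+x. ennreal (exp (- (s n * (f \<mu> + e)))) * indicator (preimage n A) x \<partial>\<gamma> n)"
      using B by (simp add: nn_integral_cmult_indicator)
    also have "\<dots> \<le> (\<integral>\<^sup>+x. ennreal (exp (- (s n * f (empirical n x)))) \<partial>\<gamma> n)"
    proof (intro nn_integral_mono)
      fix x
      show "ennreal (exp (- (s n * (f \<mu> + e)))) * indicator (preimage n A) x \<le> ennreal (exp (- (s n * f (empirical n x))))"
      proof (cases "x \<in> preimage n A")
        case True
        then have "s n * f (empirical n x) \<le> s n * (f \<mu> + e)"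
          using s by (intro mult_left_mono) (auto simp: A_def)
        then show ?thesis
          using True by (simp add: ennreal_leI)
      qed (simp only: indicator_simps not_False_eq_True mult_zero_right zero_le)
    qed
    finally have "ereal (1 / s n) * ext_ln (ennreal (exp (- (s n * (f \<mu> + e)))) * emeasure (\<gamma> n) (preimage n A)) \<le> ?X n"
      using s by (intro ereal_mult_left_mono ext_ln_mono) auto
    moreover have "ereal (1 / s n) * ext_ln (ennreal (exp (- (s n * (f \<mu> + e)))) * emeasure (\<gamma> n) (preimage n A)) =
        ereal (- (f \<mu> + e)) + ereal (1 / s n) * ext_ln (emeasure (\<gamma> n) (preimage n A))"
    proof -
      have "- (s n * (f \<mu> + e)) / s n = - (f \<mu> + e)"
        using elim(2) \<beta>_pos[OF elim(2)] by simp
      then show ?thesis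
        unfolding ext_ln_exp_mult ereal_inverse_mult_add[OF s] by (simp only:)
    qed
    moreover have "ereal (r + (f \<mu> + e)) < ereal (1 / s n) * ext_ln (emeasure (\<gamma> n) (preimage n A))"
      using elim(1) by (simp only: add.assoc)
    note ereal_less_add_left[OF this]
    ultimately have "ereal r < ?X n"
      by (simp only: less_le_trans)
    then show ?case
      by (rule less_trans[OF r(1)])
  qed
qed

section \<open>Normalization and the large deviation principle\<close>

lemma partition_function_eq: "partition_function \<pi> Wn \<beta> n = emeasure (\<gamma> n) (configs n)"
  by (simp add: partition_function_def space_gibbs)

lemma partition_function_finite:
  assumes "n \<ge> 1"
  shows "partition_function \<pi> Wn \<beta> n < \<infinity>"
proof -
  interpret Q: prob_space "PiM {..<n} (\<lambda>_. \<pi>)"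
    by (rule prob_space_PiM_prob[OF \<pi>])
  have "configs n \<in> sets (PiM {..<n} (\<lambda>_. borel :: 'a measure))"
    using sets.top[of "PiM {..<n} (\<lambda>_. borel :: 'a measure)"] by (simp add: space_PiM)
  then have "partition_function \<pi> Wn \<beta> n =
      (\<integral>\<^sup>+x. ext_exp (- (ereal (s n) * Wn n x)) * indicator (configs n) x \<partial>PiM {..<n} (\<lambda>_. \<pi>))"
    unfolding partition_function_eq by (rule emeasure_gibbs[OF assms])
  also have "\<dots> \<le> (\<integral>\<^sup>+x. ennreal (exp (s n * c)) \<partial>PiM {..<n} (\<lambda>_. \<pi>))"
  proof (intro nn_integral_mono)
    fix x
    have "ext_exp (- (ereal (s n) * Wn n x)) \<le> ennreal (exp (s n * c))"
    proof (cases "Wn n x")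
      case (real v)
      then have "- c \<le> v"
        using Wn_ge[OF assms, of x] by simp
      then have "s n * (- c) \<le> s n * v"
        using s_pos[OF assms] by (intro mult_left_mono) auto
      then show ?thesis
        using real by (simp add: ext_exp_def ennreal_leI)
    next
      case PInf
      then show ?thesis
        using s_pos[OF assms] by (simp add: ext_exp_def)
    next
      case MInf
      then show ?thesis
        using Wn_ge[OF assms, of x] by simp
    qed
    then show "ext_exp (- (ereal (s n) * Wn n x)) * indicator (configs n) x \<le> ennreal (exp (s n * c))"
      by (auto simp: indicator_def)
  qed
  also have "\<dots> < \<infinity>"
    by (simp add: Q.emeasure_space_1)
  finally show ?thesis .
qed

text \<open>Normalizing adds \<open>d n\<close> to the logarithmic rate of the unnormalized measure.
  By the Laplace principle with f = 0 it converges to inf W, which accounts for the shift in the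
  rate function.\<close>

theorem large_deviations:
  assumes pos: "\<forall>n\<ge>1. 0 < partition_function \<pi> Wn \<beta> n" and fin: "(INF \<mu>\<in>prob_measures. W \<mu>) \<noteq> \<infinity>"
  shows "large_deviation_principle s (gibbs_law \<pi> Wn \<beta>) (\<lambda>\<mu>. W \<mu> - (INF \<mu>'\<in>prob_measures. W \<mu>'))"
proof -
  let ?Z = "partition_function \<pi> Wn \<beta>" and ?Q = "gibbs_law \<pi> Wn \<beta>"
  have "ereal (- c) \<le> (INF \<mu>\<in>prob_measures. W \<mu>)"
    by (intro INF_greatest W_ge)
  \<comment> \<open>With a real infimum the convergent sequence \<open>d n\<close> can be pulled out
    of \<open>liminf\<close> and \<open>limsup\<close>, even when the remaining term is
    infinite.\<close>
  then obtain i where i: "(INF \<mu>\<in>prob_measures. W \<mu>) = ereal i"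
    using fin by (cases "INF \<mu>\<in>prob_measures. W \<mu>") auto
  have Z: "?Z n = ennreal (exp (ln (enn2real (?Z n))))" if "n \<ge> 1" for n
    using pos that partition_function_finite[OF that] by (simp add: enn2real_positive_iff)
  define d where "d n = - ln (enn2real (?Z n)) / s n" for n
  have emb: "empirical n \<in> \<gamma> n \<rightarrow>\<^sub>M weak_borel" if "n \<ge> 1" for n
    using measurable_empirical[OF compact that] sets_gibbs[of n] by (simp cong: measurable_cong_sets)
  have Q: "emeasure (?Q n) A = inverse (?Z n) * emeasure (\<gamma> n) (preimage n A)" if "n \<ge> 1" "A \<in> sets weak_borel" for n A
  proof -
    have "empirical n -` A \<inter> space (\<gamma> n) = preimage n A"
      by (auto simp: space_gibbs)
    moreover have "empirical n \<in> scale_measure (inverse (?Z n)) (\<gamma> n) \<rightarrow>\<^sub>M weak_borel"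
      using emb[OF that(1)] by (simp cong: measurable_cong_sets)
    ultimately show ?thesis
      unfolding gibbs_law_def using that by (simp add: emeasure_distr space_scale_measure)
  qed
  have log_Q: "ereal (1 / s n) * ext_ln (emeasure (?Q n) A) =
      ereal (d n) + ereal (1 / s n) * ext_ln (emeasure (\<gamma> n) (preimage n A))"
    if "n \<ge> 1" "A \<in> sets weak_borel" for n A
  proof -
    have "inverse (?Z n) = ennreal (exp (- ln (enn2real (?Z n))))"
      by (subst Z[OF that(1)]) (simp add: inverse_ennreal exp_minus)
    then show ?thesis
      unfolding Q[OF that] d_def by (simp only: ext_ln_exp_mult ereal_inverse_mult_add[OF s_pos[OF that(1)]])
  qed
  have "(\<lambda>n. ereal (1 / s n) * ext_ln (?Z n)) \<longlonglongrightarrow> - ereal i"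
    using laplace_principle[of "\<lambda>_. 0"] by (simp add: partition_function_eq space_gibbs i zero_ereal_def[symmetric])
  then have "(\<lambda>n. - (ereal (1 / s n) * ext_ln (?Z n))) \<longlonglongrightarrow> - (- ereal i)"
    by (intro tendsto_uminus_ereal)
  moreover have "\<forall>\<^sub>F n in sequentially. - (ereal (1 / s n) * ext_ln (?Z n)) = ereal (d n)"
    using eventually_ge_at_top[of "1 :: nat"]
  proof eventually_elim
    case (elim n)
    have "ext_ln (?Z n) = ereal (ln (enn2real (?Z n)))"
      by (subst Z[OF elim]) (simp add: ext_ln_ennreal)
    then show ?case
      by (simp add: d_def)
  qed
  ultimately have d: "(\<lambda>n. ereal (d n)) \<longlonglongrightarrow> ereal i"
    by (simp add: tendsto_cong)
  show ?thesis
    unfolding large_deviation_principle_def i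
  proof (intro conjI allI impI)
    fix n :: nat assume n: "1 \<le> n"
    show "sets (?Q n) = sets weak_borel"
      by (simp add: gibbs_law_def)
    have sp: "space (?Q n) = prob_measures"
      unfolding gibbs_law_def space_distr by (rule space_weak_borel)
    have pre: "preimage n prob_measures = configs n"
      by (simp add: empirical_in_prob_measures[OF n])
    have "(prob_measures :: 'a measure set) \<in> sets weak_borel"
      using sets.top[of "weak_borel :: 'a measure measure"] unfolding space_weak_borel .
    from Q[OF n this] have "emeasure (?Q n) (space (?Q n)) = inverse (?Z n) * ?Z n"
      unfolding sp pre partition_function_eq .
    also have "\<dots> = 1"
    proof -
      have "?Z n / ?Z n = 1"
        using pos[rule_format, OF n] partition_function_finite[OF n] by (intro ennreal_divide_self) auto
      then show ?thesis
        by (simp add: divide_ennreal_def mult.commute)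
    qed
    finally show "prob_space (?Q n)"
      by (rule prob_spaceI)
  next
    fix A :: "'a measure set" assume A: "openin weak_topology A"
    have "ereal i + - (INF \<mu>\<in>A. W \<mu>) \<le> ereal i + liminf (\<lambda>n. ereal (1 / s n) * ext_ln (emeasure (\<gamma> n) (preimage n A)))"
      by (intro add_left_mono open_lower_bound A)
    also have "\<dots> = liminf (\<lambda>n. ereal (d n) + ereal (1 / s n) * ext_ln (emeasure (\<gamma> n) (preimage n A)))"
      by (rule ereal_liminf_lim_add[symmetric]) (use d in auto)
    also have "\<dots> = liminf (\<lambda>n. ereal (1 / s n) * ext_ln (emeasure (?Q n) A))"
      by (intro Liminf_eq eventually_mono[OF eventually_ge_at_top[of "1 :: nat"]] log_Q[symmetric] openin_weak_borel A)
    finally have le: "ereal i + - (INF \<mu>\<in>A. W \<mu>) \<le> liminf (\<lambda>n. ereal (1 / s n) * ext_ln (emeasure (?Q n) A))" .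
    have "(INF \<mu>\<in>A. W \<mu>) - ereal i \<le> (INF \<mu>\<in>A. W \<mu> - ereal i)"
      by (intro INF_greatest ereal_minus_mono INF_lower order_refl)
    then have "- (INF \<mu>\<in>A. W \<mu> - ereal i) \<le> ereal i + - (INF \<mu>\<in>A. W \<mu>)"
      by (cases "INF \<mu>\<in>A. W \<mu>"; cases "INF \<mu>\<in>A. W \<mu> - ereal i") auto
    then show "- (INF \<mu>\<in>A. W \<mu> - ereal i) \<le> liminf (\<lambda>n. ereal (1 / s n) * ext_ln (emeasure (?Q n) A))"
      using le by (rule order_trans)
  next
    fix C :: "'a measure set" assume C: "closedin weak_topology C"
    have eq: "(\<integral>\<^sup>+x. ennreal (exp (- (s n * 0))) * indicator (preimage n C) x \<partial>\<gamma> n) = emeasure (\<gamma> n) (preimage n C)"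
      if "n \<ge> 1" for n
      using that preimage_measurable[OF that closedin_weak_borel[OF C]] sets_gibbs by simp
    have "limsup (\<lambda>n. ereal (1 / s n) * ext_ln (emeasure (?Q n) C)) =
        limsup (\<lambda>n. ereal (d n) + ereal (1 / s n) *
          ext_ln (\<integral>\<^sup>+x. ennreal (exp (- (s n * 0))) * indicator (preimage n C) x \<partial>\<gamma> n))"
      by (intro Limsup_eq eventually_mono[OF eventually_ge_at_top[of "1 :: nat"]])
         (simp only: eq log_Q closedin_weak_borel[OF C])
    also have "\<dots> = ereal i + limsup (\<lambda>n. ereal (1 / s n) *
          ext_ln (\<integral>\<^sup>+x. ennreal (exp (- (s n * 0))) * indicator (preimage n C) x \<partial>\<gamma> n))"
      by (rule ereal_limsup_lim_add) (use d in auto)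
    also have "\<dots> \<le> ereal i + - (INF \<mu>\<in>C. ereal 0 + W \<mu>)"
      by (intro add_left_mono closed_upper_bound C) simp
    finally have le: "limsup (\<lambda>n. ereal (1 / s n) * ext_ln (emeasure (?Q n) C)) \<le> ereal i + - (INF \<mu>\<in>C. W \<mu>)"
      by (simp flip: zero_ereal_def)
    have "(INF \<mu>\<in>C. W \<mu> - ereal i) + ereal i \<le> W \<mu>" if "\<mu> \<in> C" for \<mu>
    proof -
      have "(INF \<mu>\<in>C. W \<mu> - ereal i) + ereal i \<le> (W \<mu> - ereal i) + ereal i"
        using that by (intro add_right_mono INF_lower)
      also have "\<dots> = W \<mu>"
        by (cases "W \<mu>") auto
      finally show ?thesis .
    qed
    then have "(INF \<mu>\<in>C. W \<mu> - ereal i) + ereal i \<le> (INF \<mu>\<in>C. W \<mu>)"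
      by (rule INF_greatest)
    then have "ereal i + - (INF \<mu>\<in>C. W \<mu>) \<le> - (INF \<mu>\<in>C. W \<mu> - ereal i)"
      by (cases "INF \<mu>\<in>C. W \<mu>"; cases "INF \<mu>\<in>C. W \<mu> - ereal i") auto
    with le show "limsup (\<lambda>n. ereal (1 / s n) * ext_ln (emeasure (?Q n) C)) \<le> - (INF \<mu>\<in>C. W \<mu> - ereal i)"
      by (rule order_trans)
  qed
qed

end

section \<open>Two-particle marginals of product measures\<close>

lemma ext_integral_cong_AE:
  assumes "f \<in> borel_measurable M" "g \<in> borel_measurable M" "AE x in M. f x = g x"
  shows "ext_integral M f = ext_integral M g"
  unfolding ext_integral_def
  by (intro arg_cong2[where f = "(-)"] arg_cong[where f = enn2ereal] nn_integral_cong_AE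
      eventually_mono[OF assms(3)]) simp_all

lemma measurable_PiM_pair:
  assumes "i \<in> I" "j \<in> I"
  shows "(\<lambda>x. (x i, x j)) \<in> PiM I (\<lambda>_. M) \<rightarrow>\<^sub>M M \<Otimes>\<^sub>M M"
  by (intro measurable_Pair measurable_component_singleton assms)

text \<open>A rectangle in the two coordinates is a cylinder over {i, j}, whose product measure
  factorizes because the indices are distinct. Hence every off-diagonal pair has expectation exactly
  the double integral of \<open>GI\<close>.\<close>

lemma distr_PiM_pair:
  assumes M: "prob_space M" and ij: "i \<in> I" "j \<in> I" "i \<noteq> j"
  shows "distr (PiM I (\<lambda>_. M)) (M \<Otimes>\<^sub>M M) (\<lambda>x. (x i, x j)) = M \<Otimes>\<^sub>M M"
proof -
  interpret prob_space M by fact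
  show ?thesis
  proof (rule pair_measure_eqI[symmetric])
    fix A B assume AB: "A \<in> sets M" "B \<in> sets M"
    have "emeasure (distr (PiM I (\<lambda>_. M)) (M \<Otimes>\<^sub>M M) (\<lambda>x. (x i, x j))) (A \<times> B) =
        emeasure (PiM I (\<lambda>_. M)) ((\<lambda>x. (x i, x j)) -` (A \<times> B) \<inter> space (PiM I (\<lambda>_. M)))"
      using AB by (intro emeasure_distr measurable_PiM_pair ij) auto
    also have "(\<lambda>x. (x i, x j)) -` (A \<times> B) \<inter> space (PiM I (\<lambda>_. M)) =
        prod_emb I (\<lambda>_. M) {i, j} (Pi\<^sub>E {i, j} (\<lambda>k. if k = i then A else B))"
      using ij by (auto simp: prod_emb_def space_PiM)
    also have "emeasure (PiM I (\<lambda>_. M)) \<dots> = (\<Prod>k\<in>{i, j}. emeasure M (if k = i then A else B))"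
      using AB ij by (intro emeasure_PiM_emb M) auto
    finally show "emeasure M A * emeasure M B = emeasure (distr (PiM I (\<lambda>_. M)) (M \<Otimes>\<^sub>M M) (\<lambda>x. (x i, x j))) (A \<times> B)"
      using ij by simp
  qed (auto intro: sigma_finite_measure_axioms)
qed

section \<open>Convergence of two-body energies\<close>

context two_body
begin

lemma GE_measurable:
  assumes "\<mu> \<in> prob_measures" "\<mu>' \<in> prob_measures"
  shows "GE \<in> borel_measurable (\<mu> \<Otimes>\<^sub>M \<mu>')"
  using borel_measurable_pair_lower_semicontinuous[OF compact GE_lsc] sets_pair_prob_measures[OF assms]
  by (simp cong: measurable_cong_sets)

lemma GI_measurable:
  assumes "\<mu> \<in> prob_measures" "\<mu>' \<in> prob_measures"
  shows "GI \<in> borel_measurable (\<mu> \<Otimes>\<^sub>M \<mu>')"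
  using borel_measurable_pair_lower_semicontinuous[OF compact GI_lsc] sets_pair_prob_measures[OF assms]
  by (simp cong: measurable_cong_sets)

lemma field_potential_measurable:
  assumes "n \<ge> 1"
  shows "field_potential GE \<nu>s n \<in> borel_measurable borel"
proof -
  note \<nu>n = \<nu>s[OF assms]
  \<comment> \<open>The outer occurrence of \<open>\<nu>s n\<close> only supplies a measure carrying
    the Borel \<sigma>-algebra.\<close>
  have "(\<lambda>x. ext_integral (\<nu>s n) (\<lambda>y. GE (x, y))) \<in> borel_measurable (\<nu>s n)"
    by (rule borel_measurable_ext_integral_fst[OF prob_measuresD(1)[OF \<nu>n] prob_measuresD(1)[OF \<nu>n]
        GE_measurable[OF \<nu>n \<nu>n] lower_bound(2,1)])
  then show ?thesis
    using prob_measuresD(2)[OF \<nu>n] by (simp add: field_potential_def[abs_def] cong: measurable_cong_sets)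
qed

lemma n_body_energy_measurable:
  assumes "n \<ge> 1"
  shows "Wn n \<in> borel_measurable (PiM {..<n} (\<lambda>_. borel))"
proof -
  have "(\<lambda>x. field_potential GE \<nu>s n (x i)) \<in> borel_measurable (PiM {..<n} (\<lambda>_. borel))" if "i < n" for i
    using that by (intro measurable_compose[OF _ field_potential_measurable[OF assms]] measurable_component_singleton) simp
  moreover have "(\<lambda>x. GI (x i, x j)) \<in> borel_measurable (PiM {..<n} (\<lambda>_. borel))" if "i < n" "j < n" for i j
    using that
    by (intro measurable_compose[OF _ borel_measurable_pair_lower_semicontinuous[OF compact GI_lsc]] measurable_PiM_pair) simp_all
  ultimately show ?thesis
    unfolding n_body_energy_def[abs_def]
    by (intro borel_measurable_ereal_add borel_measurable_ereal_times borel_measurable_const borel_measurable_ereal_sum)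
       (auto simp: split_def)
qed

lemma n_body_energy_symmetric: "symmetric_fun n (Wn n)"
  unfolding symmetric_fun_def
proof (intro allI impI ballI)
  fix \<sigma> and x :: "nat \<Rightarrow> 'a" assume \<sigma>: "\<sigma> permutes {..<n}"
  have "(\<Sum>i<n. field_potential GE \<nu>s n ((x \<circ> \<sigma>) i)) = (\<Sum>i<n. field_potential GE \<nu>s n (x i))"
    using sum.permute[OF \<sigma>, of "\<lambda>i. field_potential GE \<nu>s n (x i)"] by (simp add: o_def)
  moreover have "(\<Sum>(i, j) \<in> {(i, j). i < j \<and> j < n}. GI ((x \<circ> \<sigma>) i, (x \<circ> \<sigma>) j)) =
      (\<Sum>(i, j) \<in> {(i, j). i < j \<and> j < n}. GI (x i, x j))"
  proof -
    \<comment> \<open>A permutation acts on unordered pairs, represented here with the smaller index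
      in front. The inverse permutation gives the inverse action, and symmetry of \<open>GI\<close>
      absorbs the reordering.\<close>
    define m where "m \<tau> p = (min (\<tau> (fst p)) (\<tau> (snd p)), max (\<tau> (fst p)) (\<tau> (snd p)))"
      for \<tau> :: "nat \<Rightarrow> nat" and p
    have inT: "m \<tau> p \<in> {(i, j). i < j \<and> j < n}" if \<tau>: "\<tau> permutes {..<n}" and pT: "p \<in> {(i, j). i < j \<and> j < n}" for \<tau> p
    proof -
      obtain i j where p: "p = (i, j)" "i < j" "j < n"
        using pT by auto
      have "\<tau> i \<noteq> \<tau> j"
        using p permutes_inj[OF \<tau>] by (auto dest: injD)
      moreover have "\<tau> i < n" "\<tau> j < n"
        using p permutes_in_image[OF \<tau>] by auto
      ultimately show ?thesis
        using p by (auto simp: m_def)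
    qed
    have inv: "m \<tau> (m \<tau>' p) = p" if "\<And>i. \<tau> (\<tau>' i) = i" "p \<in> {(i, j). i < j \<and> j < n}" for \<tau> \<tau>' p
      using that by (auto simp: m_def min_def max_def)
    show ?thesis
    proof (rule sum.reindex_bij_witness[of _ "m (inv \<sigma>)" "m \<sigma>"])
      fix p assume p: "p \<in> {(i, j). i < j \<and> j < n}"
      show "m (inv \<sigma>) (m \<sigma> p) = p" "m \<sigma> (m (inv \<sigma>) p) = p"
        using p permutes_inverses[OF \<sigma>] by (auto intro!: inv)
      show "m \<sigma> p \<in> {(i, j). i < j \<and> j < n}" "m (inv \<sigma>) p \<in> {(i, j). i < j \<and> j < n}"
        using inT[OF \<sigma> p] inT[OF permutes_inv[OF \<sigma>] p] by auto
      show "(case m \<sigma> p of (i, j) \<Rightarrow> GI (x i, x j)) = (case p of (i, j) \<Rightarrow> GI ((x \<circ> \<sigma>) i, (x \<circ> \<sigma>) j))"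
        by (cases p) (simp add: m_def min_def max_def GI_sym)
    qed
  qed
  ultimately show "Wn n (x \<circ> \<sigma>) = Wn n x"
    unfolding n_body_energy_def by simp
qed

text \<open>One-particle marginals and Fubini turn the field term into the integral of g, and each
  of the n (n - 1) / 2 pairs contributes J; the prefactor $1 / n^2$ turns this count into (1 - 1 /
  n) / 2.\<close>

lemma n_body_energy_expectation:
  assumes n: "n \<ge> 1" and \<mu>: "\<mu> \<in> prob_measures"
    and g: "continuous_on UNIV g" "\<And>y. ext_integral \<mu> (\<lambda>x. GE (x, y)) = ereal (g y)"
    and fin: "ext_integral (\<mu> \<Otimes>\<^sub>M \<mu>) GI = ereal J"
  shows "ext_integral (PiM {..<n} (\<lambda>_. \<mu>)) (Wn n) = ereal ((\<integral>y. g y \<partial>\<nu>s n) + (1 - 1 / n) / 2 * J)"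
proof -
  let ?P = "PiM {..<n} (\<lambda>_. \<mu>)"
  note \<nu>n = \<nu>s[OF n]
  note PM = prob_measuresD(1)[OF \<mu>] and PN = prob_measuresD(1)[OF \<nu>n]
  define V where "V = field_potential GE \<nu>s n"
  define v where "v x = real_of_ereal (V x)" for x
  define gI where "gI p = real_of_ereal (GI p)" for p
  have Vm: "V \<in> borel_measurable \<mu>"
    using field_potential_measurable[OF n] prob_measuresD(2)[OF \<mu>]
    by (simp add: V_def cong: measurable_cong_sets)
  have "ext_integral \<mu> V = ext_integral (\<mu> \<Otimes>\<^sub>M \<nu>s n) GE"
    unfolding V_def field_potential_def[abs_def]
    by (rule ext_integral_fst[OF PM PN GE_measurable[OF \<mu> \<nu>n] lower_bound(2,1), symmetric])
  also have "\<dots> = ext_integral (\<nu>s n) (\<lambda>y. ereal (g y))"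
    by (subst ext_integral_snd[OF PM PN GE_measurable[OF \<mu> \<nu>n] lower_bound(2,1)]) (simp add: g)
  also have "\<dots> = ereal (\<integral>y. g y \<partial>\<nu>s n)"
    by (intro ext_integral_real integrable_continuous compact g \<nu>n)
  finally have EV: "ext_integral \<mu> V = ereal (\<integral>y. g y \<partial>\<nu>s n)" .
  have V_ge: "ereal (- lower_bound) \<le> V x" for x
    unfolding V_def by (rule field_potential_ge[OF n])
  have "ext_integral \<mu> V < \<infinity>"
    by (simp add: EV)
  note V = ext_integral_finite[OF PM Vm V_ge lower_bound(1) this]
  have "ext_integral (\<mu> \<Otimes>\<^sub>M \<mu>) GI < \<infinity>"
    by (simp add: fin)
  note G = ext_integral_finite[OF prob_space_pair[OF PM PM] GI_measurable[OF \<mu> \<mu>] lower_bound(3,1) this]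
  have int_v: "integrable \<mu> v" "(\<integral>x. v x \<partial>\<mu>) = (\<integral>y. g y \<partial>\<nu>s n)"
    using V(2,3) by (simp_all add: v_def[abs_def] EV)
  have int_g: "integrable (\<mu> \<Otimes>\<^sub>M \<mu>) gI" "(\<integral>p. gI p \<partial>(\<mu> \<Otimes>\<^sub>M \<mu>)) = J"
    using G(2,3) by (simp_all add: gI_def[abs_def] fin)
  have int_vi: "integrable ?P (\<lambda>x. v (x i))" "(\<integral>x. v (x i) \<partial>?P) = (\<integral>y. g y \<partial>\<nu>s n)" if "i < n" for i
    using integrable_PiM_component[OF \<mu> int_v(1), of i "{..<n}"] integral_PiM_component[OF \<mu> int_v(1), of i "{..<n}"]
      that int_v(2) by simp_all
  have int_gij: "integrable ?P (\<lambda>x. gI (x i, x j))" "(\<integral>x. gI (x i, x j) \<partial>?P) = J"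
    and AE_gij: "AE x in ?P. GI (x i, x j) \<noteq> \<infinity>" if "i < j" "j < n" for i j
  proof -
    have d: "distr ?P (\<mu> \<Otimes>\<^sub>M \<mu>) (\<lambda>x. (x i, x j)) = \<mu> \<Otimes>\<^sub>M \<mu>"
      using that by (intro distr_PiM_pair PM) auto
    have m: "(\<lambda>x. (x i, x j)) \<in> ?P \<rightarrow>\<^sub>M \<mu> \<Otimes>\<^sub>M \<mu>"
      using that by (intro measurable_PiM_pair) auto
    have "integrable (distr ?P (\<mu> \<Otimes>\<^sub>M \<mu>) (\<lambda>x. (x i, x j))) gI"
      unfolding d by (rule int_g)
    then show "integrable ?P (\<lambda>x. gI (x i, x j))"
      by (rule integrable_distr[OF m])
    have "(\<integral>p. gI p \<partial>distr ?P (\<mu> \<Otimes>\<^sub>M \<mu>) (\<lambda>x. (x i, x j))) = (\<integral>x. gI (x i, x j) \<partial>?P)"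
      using int_g(1) by (intro integral_distr m) simp
    then show "(\<integral>x. gI (x i, x j) \<partial>?P) = J"
      unfolding d int_g(2) by simp
    have "AE p in distr ?P (\<mu> \<Otimes>\<^sub>M \<mu>) (\<lambda>x. (x i, x j)). GI p \<noteq> \<infinity>"
      unfolding d by (rule G(1))
    then show "AE x in ?P. GI (x i, x j) \<noteq> \<infinity>"
      by (rule AE_distrD[OF m])
  qed
  let ?T = "{(i, j). i < j \<and> j < n}"
  have finT: "finite ?T"
    by (rule finite_subset[of _ "{..<n} \<times> {..<n}"]) auto
  \<comment> \<open>A real-valued version of the energy. It agrees with \<open>Wn n\<close> almost
    everywhere, as finitely many null sets of infinite one- and two-particle terms are
    discarded.\<close>
  define R where "R x = 1 / n * (\<Sum>i<n. v (x i)) + 1 / (real n)\<^sup>2 * (\<Sum>(i, j)\<in>?T. gI (x i, x j))" for x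
  have int_R1: "integrable ?P (\<lambda>x. \<Sum>i<n. v (x i))"
    by (intro Bochner_Integration.integrable_sum int_vi) simp
  have int_R2: "integrable ?P (\<lambda>x. \<Sum>(i, j)\<in>?T. gI (x i, x j))"
    by (intro Bochner_Integration.integrable_sum) (auto intro: int_gij)
  have int_R: "integrable ?P R"
    unfolding R_def[abs_def] by (intro Bochner_Integration.integrable_add integrable_mult_right int_R1 int_R2)
  have AE1: "AE x in ?P. \<forall>i\<in>{..<n}. V (x i) \<noteq> \<infinity>"
    by (intro AE_finite_allI AE_PiM_component PM V(1)) auto
  have AE2: "AE x in ?P. \<forall>p\<in>?T. GI (x (fst p), x (snd p)) \<noteq> \<infinity>"
    by (intro AE_finite_allI finT) (auto intro!: AE_gij)
  have "AE x in ?P. Wn n x = ereal (R x)"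
    using AE1 AE2
  proof eventually_elim
    case (elim x)
    have 1: "V (x i) = ereal (v (x i))" if "i < n" for i
      using elim(1) that V_ge[of "x i"] unfolding v_def by (cases "V (x i)") auto
    have 2: "GI (x i, x j) = ereal (gI (x i, x j))" if "i < j" "j < n" for i j
      using elim(2) that GI_range[of "(x i, x j)"] unfolding gI_def by (cases "GI (x i, x j)") auto
    have "(\<Sum>i<n. V (x i)) = (\<Sum>i<n. ereal (v (x i)))"
      by (intro sum.cong) (auto simp: 1)
    moreover have "(\<Sum>(i, j)\<in>?T. GI (x i, x j)) = (\<Sum>(i, j)\<in>?T. ereal (gI (x i, x j)))"
      by (intro sum.cong) (auto simp: 2)
    ultimately show ?case
      unfolding n_body_energy_def R_def V_def[symmetric] by (simp add: split_def)
  qed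
  moreover have "Wn n \<in> borel_measurable ?P"
    using n_body_energy_measurable[OF n] sets_PiM_prob[OF \<mu>, of "{..<n}"]
    by (simp cong: measurable_cong_sets)
  moreover have "(\<lambda>x. ereal (R x)) \<in> borel_measurable ?P"
    using int_R by simp
  ultimately have "ext_integral ?P (Wn n) = ext_integral ?P (\<lambda>x. ereal (R x))"
    by (intro ext_integral_cong_AE)
  also have "\<dots> = ereal (\<integral>x. R x \<partial>?P)"
    by (rule ext_integral_real[OF int_R])
  also have "(\<integral>x. R x \<partial>?P) = 1 / n * (\<Sum>i<n. \<integral>x. v (x i) \<partial>?P) + 1 / (real n)\<^sup>2 * (\<Sum>(i, j)\<in>?T. \<integral>x. gI (x i, x j) \<partial>?P)"
  proof -
    have "(\<integral>x. (\<Sum>i<n. v (x i)) \<partial>?P) = (\<Sum>i<n. \<integral>x. v (x i) \<partial>?P)"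
      by (intro Bochner_Integration.integral_sum int_vi) simp
    moreover have "(\<integral>x. (\<Sum>p\<in>?T. gI (x (fst p), x (snd p))) \<partial>?P) = (\<Sum>p\<in>?T. \<integral>x. gI (x (fst p), x (snd p)) \<partial>?P)"
      by (intro Bochner_Integration.integral_sum) (auto intro: int_gij)
    ultimately show ?thesis
      unfolding R_def[abs_def] using int_R1 int_R2 by (simp add: split_def)
  qed
  also have "(\<Sum>i<n. \<integral>x. v (x i) \<partial>?P) = n * (\<integral>y. g y \<partial>\<nu>s n)"
    by (simp add: int_vi)
  also have "(\<Sum>(i, j)\<in>?T. \<integral>x. gI (x i, x j) \<partial>?P) = (\<Sum>(i, j)\<in>?T. J)"
    by (intro sum.cong) (auto simp: int_gij)
  also have "(\<Sum>(i, j)\<in>?T. J) = ((real n)\<^sup>2 * J - n * J) / 2"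
    by (subst sum_pairs_symmetric) (simp_all add: power2_eq_square)
  finally show ?thesis
    using n by (simp add: power2_eq_square field_simps)
qed

text \<open>With finite interaction energy the explicit expectations converge to W \<mu>, the field
  term because g is continuous; with infinite interaction energy W \<mu> = \<infinity> and the bound
  is trivial.\<close>

lemma regular_in_recovery_set:
  assumes "\<mu> \<in> regular_measures \<pi> GE"
  shows "\<mu> \<in> recovery_set \<pi> Wn W"
proof -
  obtain g :: "'a \<Rightarrow> real" where \<mu>: "\<mu> \<in> prob_measures" "rel_entropy \<mu> \<pi> < \<infinity>"
    and g: "continuous_on UNIV g" "\<And>y. ext_integral \<mu> (\<lambda>x. GE (x, y)) = ereal (g y)"
    using assms unfolding regular_measures_def real_continuous_def by blast
  note PM = prob_measuresD(1)[OF \<mu>(1)] and PN = prob_measuresD(1)[OF \<nu>]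
  have "external_energy GE \<nu> \<mu> = ext_integral \<nu> (\<lambda>y. ereal (g y))"
    unfolding external_energy_def
    by (subst ext_integral_snd[OF PM PN GE_measurable[OF \<mu>(1) \<nu>] lower_bound(2,1)]) (simp add: g)
  also have "\<dots> = ereal (\<integral>y. g y \<partial>\<nu>)"
    by (intro ext_integral_real integrable_continuous compact g \<nu>)
  finally have ext: "external_energy GE \<nu> \<mu> = ereal (\<integral>y. g y \<partial>\<nu>)" .
  have "limsup (\<lambda>n. ext_integral (PiM {..<n} (\<lambda>_. \<mu>)) (Wn n)) \<le> W \<mu>"
  proof (cases "ext_integral (\<mu> \<Otimes>\<^sub>M \<mu>) GI")
    case (real J)
    have "(\<lambda>n. \<integral>y. g y \<partial>\<nu>s n) \<longlonglongrightarrow> (\<integral>y. g y \<partial>\<nu>)"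
      using \<nu>s_lim g(1) bounded_range_continuous[OF compact g(1)] unfolding limitin_weak_topology by blast
    then have "(\<lambda>n. (\<integral>y. g y \<partial>\<nu>s n) + (1 - 1 / real n) / 2 * J) \<longlonglongrightarrow> (\<integral>y. g y \<partial>\<nu>) + (1 - 0) / 2 * J"
      by (intro tendsto_intros lim_1_over_n) simp_all
    then have lim: "(\<lambda>n. ereal ((\<integral>y. g y \<partial>\<nu>s n) + (1 - 1 / real n) / 2 * J)) \<longlonglongrightarrow> W \<mu>"
      by (simp add: macroscopic_energy_def ext interaction_energy_def real)
    have "limsup (\<lambda>n. ext_integral (PiM {..<n} (\<lambda>_. \<mu>)) (Wn n)) = limsup (\<lambda>n. ereal ((\<integral>y. g y \<partial>\<nu>s n) + (1 - 1 / real n) / 2 * J))"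
      by (intro Limsup_eq eventually_mono[OF eventually_ge_at_top[of "1 :: nat"]] n_body_energy_expectation \<mu>(1) g real)
    also have "\<dots> = W \<mu>"
      by (rule lim_imp_Limsup[OF sequentially_bot lim])
    finally show ?thesis
      by simp
  next
    case PInf
    then show ?thesis
      by (simp add: macroscopic_energy_def ext interaction_energy_def)
  next
    case MInf
    then show ?thesis
      using ext_integral_ge[OF prob_space_pair[OF PM PM], of lower_bound GI] lower_bound(3) by simp
  qed
  with \<mu> show ?thesis
    by (simp add: recovery_set_def)
qed

text \<open>The external energy is the integral of the real continuous function v. Being finite, it
  lets W \<mu> < \<infinity> imply finite interaction energy, so the approximation hypothesis
  applies; being weakly continuous, it converges along the resulting sequence.\<close>

lemma macroscopic_energy_recovery:
  assumes V_cont: "real_continuous (\<lambda>x. ext_integral \<nu> (\<lambda>y. GE (x, y)))"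
    and approx: "\<And>\<mu>. \<mu> \<in> prob_measures \<Longrightarrow> interaction_energy GI \<mu> < \<infinity> \<Longrightarrow>
      \<exists>\<mu>s. (\<forall>n. \<mu>s n \<in> regular_measures \<pi> GE) \<and> limitin weak_topology \<mu>s \<mu> sequentially \<and>
        (\<lambda>n. interaction_energy GI (\<mu>s n)) \<longlonglongrightarrow> interaction_energy GI \<mu>"
    and \<mu>: "\<mu> \<in> prob_measures" "W \<mu> < \<infinity>"
  shows "\<exists>\<mu>s. (\<forall>n. \<mu>s n \<in> recovery_set \<pi> Wn W) \<and> limitin weak_topology \<mu>s \<mu> sequentially \<and>
          limsup (\<lambda>n. W (\<mu>s n)) \<le> W \<mu>"
proof -
  obtain v :: "'a \<Rightarrow> real" where v: "continuous_on UNIV v" "\<And>x. ext_integral \<nu> (\<lambda>y. GE (x, y)) = ereal (v x)"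
    using V_cont unfolding real_continuous_def by blast
  have ext: "external_energy GE \<nu> \<rho> = ereal (\<integral>x. v x \<partial>\<rho>)" if \<rho>: "\<rho> \<in> prob_measures" for \<rho>
  proof -
    have "external_energy GE \<nu> \<rho> = ext_integral \<rho> (\<lambda>x. ereal (v x))"
      unfolding external_energy_def
      by (subst ext_integral_fst[OF prob_measuresD(1)[OF \<rho>] prob_measuresD(1)[OF \<nu>]
            GE_measurable[OF \<rho> \<nu>] lower_bound(2,1)]) (simp add: v)
    also have "\<dots> = ereal (\<integral>x. v x \<partial>\<rho>)"
      by (intro ext_integral_real integrable_continuous compact v \<rho>)
    finally show ?thesis .
  qed
  have "interaction_energy GI \<mu> < \<infinity>"
    using \<mu>(2) unfolding macroscopic_energy_def ext[OF \<mu>(1)] by (cases "interaction_energy GI \<mu>") auto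
  from approx[OF \<mu>(1) this] obtain \<mu>s where \<mu>s: "\<And>n. \<mu>s n \<in> regular_measures \<pi> GE"
    "limitin weak_topology \<mu>s \<mu> sequentially"
    "(\<lambda>n. interaction_energy GI (\<mu>s n)) \<longlonglongrightarrow> interaction_energy GI \<mu>"
    by blast
  have "\<mu>s n \<in> prob_measures" for n
    using \<mu>s(1)[of n] by (simp add: regular_measures_def)
  then have W_eq: "W (\<mu>s n) = ereal (\<integral>x. v x \<partial>\<mu>s n) + interaction_energy GI (\<mu>s n)" for n
    by (simp add: macroscopic_energy_def ext)
  have "(\<lambda>n. \<integral>x. v x \<partial>\<mu>s n) \<longlonglongrightarrow> (\<integral>x. v x \<partial>\<mu>)"
    using \<mu>s(2) v(1) bounded_range_continuous[OF compact v(1)] unfolding limitin_weak_topology by blast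
  then have "(\<lambda>n. ereal (\<integral>x. v x \<partial>\<mu>s n)) \<longlonglongrightarrow> ereal (\<integral>x. v x \<partial>\<mu>)"
    by simp
  from tendsto_add_ereal_general2[OF _ this \<mu>s(3)]
  have "(\<lambda>n. ereal (\<integral>x. v x \<partial>\<mu>s n) + interaction_energy GI (\<mu>s n)) \<longlonglongrightarrow> ereal (\<integral>x. v x \<partial>\<mu>) + interaction_energy GI \<mu>"
    by simp
  then have "(\<lambda>n. W (\<mu>s n)) \<longlonglongrightarrow> W \<mu>"
    unfolding W_eq by (simp add: macroscopic_energy_def ext[OF \<mu>(1)])
  then have "limsup (\<lambda>n. W (\<mu>s n)) = W \<mu>"
    by (rule lim_imp_Limsup[OF sequentially_bot])
  then show ?thesis
    using \<mu>s(2) regular_in_recovery_set[OF \<mu>s(1)] by (intro exI[of _ \<mu>s]) simp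
qed

text \<open>At indices where \<open>\<mu>s n\<close> is no empirical measure the lifted energy is
  \<infinity>, so only the remaining set S matters. The filter version of (A1) covers it uniformly,
  whether S is finite or infinite.\<close>

lemma lift_energy_liminf:
  assumes lim: "limitin weak_topology \<mu>s \<mu> sequentially"
  shows "W \<mu> \<le> liminf (\<lambda>n. lift_energy Wn n (\<mu>s n))"
  unfolding le_Liminf_iff
proof (intro allI impI)
  fix y assume y: "y < W \<mu>"
  define S where "S = {n. \<exists>x \<in> configs n. \<mu>s n = empirical n x}"
  \<comment> \<open>The same choice as in \<open>lift_energy\<close>, so that on S the lifted energy
    unfolds to the energy of \<open>x n\<close>.\<close>
  define x where "x n = (SOME x. x \<in> configs n \<and> \<mu>s n = empirical n x)" for n
  have x: "\<mu>s n = empirical n (x n)" if "n \<in> S" for n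
    using that someI_ex[of "\<lambda>x. x \<in> configs n \<and> \<mu>s n = empirical n x"] unfolding S_def x_def by blast
  let ?F = "inf sequentially (principal S)"
  have "limitin weak_topology (\<lambda>n. empirical n (x n)) \<mu> ?F"
    unfolding limitin_def
  proof (intro conjI allI impI)
    show "\<mu> \<in> topspace weak_topology"
      using lim by (rule limitin_topspace)
    fix U assume "openin weak_topology U \<and> \<mu> \<in> U"
    then have "\<forall>\<^sub>F n in sequentially. \<mu>s n \<in> U"
      using limitinD[OF lim] by blast
    then show "\<forall>\<^sub>F n in ?F. empirical n (x n) \<in> U"
      unfolding eventually_inf_principal by eventually_elim (metis x)
  qed
  from n_body_energy_liminf[OF inf_le1 this y]
  have "\<forall>\<^sub>F n in sequentially. n \<in> S \<longrightarrow> y < Wn n (x n)"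
    unfolding eventually_inf_principal .
  then show "\<forall>\<^sub>F n in sequentially. y < lift_energy Wn n (\<mu>s n)"
  proof eventually_elim
    case (elim n)
    have "y < \<infinity>"
      using y by (auto intro: less_le_trans)
    with elim show ?case
      by (auto simp: lift_energy_def S_def x_def)
  qed
qed

end

theorem theorem4p1:
  fixes \<pi> \<nu> :: "'a::metric_space measure"
    and \<nu>s :: "nat \<Rightarrow> 'a measure"
    and GE GI :: "'a \<times> 'a \<Rightarrow> ereal"
  assumes compact: "compact (UNIV :: 'a set)"
    and \<pi>: "\<pi> \<in> prob_measures"
    and \<nu>s: "\<And>n. n \<ge> 1 \<Longrightarrow> \<nu>s n \<in> prob_measures"
    and \<nu>: "\<nu> \<in> prob_measures"
    and \<nu>s_lim: "limitin weak_topology \<nu>s \<nu> sequentially"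
    and GE_range: "\<And>p. GE p \<noteq> -\<infinity>"
    and GE_lsc: "lower_semicontinuous GE"
    and GI_range: "\<And>p. GI p \<noteq> -\<infinity>"
    and GI_lsc: "lower_semicontinuous GI"
    and GI_sym: "\<And>x y. GI (x, y) = GI (y, x)"
    and V_cont: "real_continuous (\<lambda>x. ext_integral \<nu> (\<lambda>y. GE (x, y)))"
    and approx: "\<And>\<mu>. \<mu> \<in> prob_measures \<Longrightarrow> interaction_energy GI \<mu> < \<infinity> \<Longrightarrow>
      \<exists>\<mu>s. (\<forall>n. \<mu>s n \<in> regular_measures \<pi> GE) \<and> limitin weak_topology \<mu>s \<mu> sequentially \<and>
        (\<lambda>n. interaction_energy GI (\<mu>s n)) \<longlonglongrightarrow> interaction_energy GI \<mu>"
  defines "Wn \<equiv> n_body_energy GE GI \<nu>s"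
    and "W \<equiv> macroscopic_energy GE GI \<nu>"
  shows "zero_temperature_limit \<pi> Wn W \<and>
    (\<forall>\<beta>. (\<forall>n\<ge>1. 0 < \<beta> n) \<and> filterlim \<beta> at_top sequentially \<longrightarrow>
      (\<forall>f. continuous_map weak_topology euclideanreal f \<and> bounded (f ` prob_measures) \<longrightarrow>
        (\<lambda>n. ereal (1 / (real n * \<beta> n)) *
            ext_ln (\<integral>\<^sup>+ x. ennreal (exp (- (real n * \<beta> n * f (empirical n x)))) \<partial>gibbs \<pi> Wn \<beta> n))
          \<longlonglongrightarrow> - (INF \<mu>\<in>prob_measures. ereal (f \<mu>) + W \<mu>)) \<and>
      ((\<forall>n\<ge>1. 0 < partition_function \<pi> Wn \<beta> n) \<and> (INF \<mu>\<in>prob_measures. W \<mu>) \<noteq> \<infinity> \<longrightarrow>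
        large_deviation_principle (\<lambda>n. real n * \<beta> n) (gibbs_law \<pi> Wn \<beta>)
          (\<lambda>\<mu>. W \<mu> - (INF \<mu>'\<in>prob_measures. W \<mu>'))))"
proof -
  interpret two_body \<nu> \<nu>s GE GI
    by unfold_locales fact+
  \<comment> \<open>One \<open>lower_bound\<close> for the field and one for the interaction; the
    same constant bounds the n-body and the macroscopic energies.\<close>
  let ?c = "2 * lower_bound"
  have Wn_ge: "ereal (- ?c) \<le> Wn n x" if "n \<ge> 1" for n x
    using n_body_energy_ge[OF that, of x] unfolding Wn_def by simp
  have W_ge: "ereal (- ?c) \<le> W \<mu>" if "\<mu> \<in> prob_measures" for \<mu>
    using macroscopic_energy_ge[OF that] unfolding W_def by simp
  have recovery: "\<exists>\<mu>s. (\<forall>n. \<mu>s n \<in> recovery_set \<pi> Wn W) \<and> limitin weak_topology \<mu>s \<mu> sequentially \<and>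
      limsup (\<lambda>n. W (\<mu>s n)) \<le> W \<mu>" if "\<mu> \<in> prob_measures" "W \<mu> < \<infinity>" for \<mu>
    unfolding Wn_def W_def by (rule macroscopic_energy_recovery[OF V_cont approx]) (use that in \<open>simp_all add: W_def\<close>)
  show ?thesis
  proof (intro conjI allI impI)
    show "zero_temperature_limit \<pi> Wn W"
      unfolding zero_temperature_limit_def
    proof (intro conjI allI impI ballI)
      show "Wn n \<in> borel_measurable (PiM {..<n} (\<lambda>_. borel))" if "1 \<le> n" for n
        unfolding Wn_def by (rule n_body_energy_measurable[OF that])
      show "symmetric_fun n (Wn n)" for n
        unfolding Wn_def by (rule n_body_energy_symmetric)
      show "Wn n x \<noteq> -\<infinity>" if "1 \<le> n" for n x
        using Wn_ge[OF that, of x] by auto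
      show "W \<in> borel_measurable weak_borel"
        unfolding W_def by (rule borel_measurable_macroscopic_energy)
      show "W \<mu> \<noteq> -\<infinity>" if "\<mu> \<in> prob_measures" for \<mu>
        using W_ge[OF that] by auto
      show "stable Wn"
        unfolding stable_def using Wn_ge by blast
      show "W \<mu> \<le> liminf (\<lambda>n. lift_energy Wn n (\<mu>s n))"
        if "(\<forall>n. \<mu>s n \<in> prob_measures) \<and> limitin weak_topology \<mu>s \<mu> sequentially" for \<mu>s \<mu>
        unfolding Wn_def W_def using that by (intro lift_energy_liminf) simp
    qed (rule recovery)
    fix \<beta> :: "nat \<Rightarrow> real" assume \<beta>: "(\<forall>n\<ge>1. 0 < \<beta> n) \<and> filterlim \<beta> at_top sequentially"
    \<comment> \<open>The liminf requirement is met by the filter form of (A1) for the two-body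
      energies, which also covers the subsequences used in the upper bounds.\<close>
    interpret gibbs_limit \<pi> Wn W ?c \<beta>
    proof
      show "Wn n \<in> borel_measurable (PiM {..<n} (\<lambda>_. borel))" if "n \<ge> 1" for n
        unfolding Wn_def by (rule n_body_energy_measurable[OF that])
      show "\<forall>\<^sub>F n in F. y < Wn n (x n)"
        if "F \<le> sequentially" "limitin weak_topology (\<lambda>n. empirical n (x n)) \<mu> F" "y < W \<mu>" for F x \<mu> y
        using that unfolding Wn_def W_def by (rule n_body_energy_liminf)
    qed (use compact \<pi> Wn_ge W_ge lower_bound(1) recovery \<beta> in auto)
    show "(\<lambda>n. ereal (1 / (real n * \<beta> n)) *
            ext_ln (\<integral>\<^sup>+ x. ennreal (exp (- (real n * \<beta> n * f (empirical n x)))) \<partial>gibbs \<pi> Wn \<beta> n))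
          \<longlonglongrightarrow> - (INF \<mu>\<in>prob_measures. ereal (f \<mu>) + W \<mu>)"
      if "continuous_map weak_topology euclideanreal f \<and> bounded (f ` prob_measures)" for f
      using that by (intro laplace_principle) simp
    show "large_deviation_principle (\<lambda>n. real n * \<beta> n) (gibbs_law \<pi> Wn \<beta>)
          (\<lambda>\<mu>. W \<mu> - (INF \<mu>'\<in>prob_measures. W \<mu>'))"
      if "(\<forall>n\<ge>1. 0 < partition_function \<pi> Wn \<beta> n) \<and> (INF \<mu>\<in>prob_measures. W \<mu>) \<noteq> \<infinity>"
      using that by (intro large_deviations) simp_all
  qed
qed

end
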